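(* Let $\mathbb{K}$ be a field containing $\mathbb{Q}$ and let $A$ be a commutative $\mathbb{K}$-algebra, with Hochschild chain complex $C(A)=\bigoplus_{n\ge 0}C_n(A)$, augmentation ideal $I=\bigoplus_{n>0}C_n(A)$ for the shuffle product $\bullet$, and first eulerian idempotent $e^{(1)}$ acting on $C(A)$. Then the complexes $\mathrm{Ch}(A)=C(A)/I^{\bullet 2}$ and $e^{(1)}C(A)$ are isomorphic.
   Context: Hochschild chains: $C_n(A)=A\otimes A^{\otimes n}$ for $n\ge 0$, with the Hochschild boundary $$(a_0,\dots,a_n)\mapsto\sum_{i=0}^{n-1}(-1)^i(a_0,\dots,a_ia_{i+1},\dots,a_n)+(-1)^n(a_na_0,a_1,\dots,a_{n-1}).$$ The symmetric group $\mathfrak{S}_n$ acts on $C_n(A)$ by $\sigma.(a_0,a_1,\dots,a_n)=(a_0,a_{\sigma^{-1}(1)},\dots,a_{\sigma^{-1}(n)})$. Shuffle product: $$(a_0,a_1,\dots,a_p)\bullet(a_0',a_{p+1},\dots,a_{p+q})=\sum_{\sigma\in Sh_{p,q}}\mathrm{sgn}(\sigma)\,\sigma.(a_0a_0',a_1,\dots,a_{p+q}),$$ where $Sh_{p,q}$ is the set of $\sigma\in\mathfrak{S}_{p+q}$ with $\sigma(1)<\dots<\sigma(p)$ and $\sigma(p+1)<\dots<\sigma(p+q)$. With this product $C(A)$ is a commutative differential graded algebra augmented over $A$, with augmentation ideal $I=\bigoplus_{n>0}C_n(A)$. $I^{\bullet2}=I\bullet I$ is the span of products of two elements of $I$; since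 the Hochschild boundary is a graded derivation of $\bullet$, the quotient $\mathrm{Ch}(A)=C(A)/I^{\bullet 2}$ is a well-defined complex (the Harrison complex). First eulerian idempotent: for a $\mathbb{K}$-vector space $V$, let $\mathcal{T}V=\bigoplus_{n\ge0}V^{\otimes n}$, with unit $\mathbf 1$ and counit $\varepsilon$ (the projection to $V^{\otimes 0}=\mathbb{K}$), the deconcatenation coproduct $\Delta$, and the signed shuffle product $\mu_{sh}$, given by $$\mu_{sh}(x_1\cdots x_p\otimes x_{p+1}\cdots x_{p+q})=\sum_{\sigma\in Sh_{p,q}}\mathrm{sgn}(\sigma)\,x_{\sigma^{-1}(1)}\cdots x_{\sigma^{-1}(p+q)}.$$ On $\mathrm{Hom}(\mathcal{T}V,\mathcal{T}V)$ use the convolution product $f\star g=\mu_{sh}\circ(f\otimes g)\circ\Delta$, with unit $\mathbf 1\varepsilon$. Write $id=\mathbf 1\varepsilon+J$, so that $J$ is the identity on $V^{\otimes n}$ for $n\ge1$ and $0$ on $V^{\otimes 0}$, and set $$e^{(1)}=\log^\star(id)=\sum_{n\ge1}(-1)^{n+1}\frac{J^{\star n}}{n}.$$ In weight $n$, $e^{(1)}$ acts on $V^{\otimes n}$ as a uniquely determined element $e^{(1)}_n\in\mathbb{Q}[\mathfrak{S}_n]$, and $e^{(1)}$ acts on $C_n(A)$ as $e_n^{(1)}$ through the ($\mathbb{K}$-linearly extended) action of $\mathfrak{S}_n$ on $C_n(A)$ given above. $e^{(1)}C(A)$ denotes the image of this action, a complex with the restricted Hochschild boundary.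
   Formalization: As e^(1) is 0 in degree 0 while Ch_0(A)=A, the claim fails there for A nonzero (e.g. A=K); proved instead: the positive-degree part of Ch(A) is isomorphic to e^(1)C(A), and Ch(A) is isomorphic to C_0(A)⊕e^(1)C(A). *)

theory Defs
  imports
    Complex_Main
    "HOL-Library.Poly_Mapping"
    "HOL-Combinatorics.Permutations"
begin

section \<open>Vector spaces with a carrier, graded complexes, quotients\<close>

text \<open>Tensor powers over the field and the Harrison complex are quotients, so their elements
  are cosets and the vector space operations have to be carried along explicitly.\<close>

record ('k, 'v) lin_space =
  carrier :: "'v set"
  vadd :: "'v \<Rightarrow> 'v \<Rightarrow> 'v"
  vzero :: 'v
  vscale :: "'k \<Rightarrow> 'v \<Rightarrow> 'v"

text \<open>The carrier is the total space (the direct sum of the components).\<close>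

record ('k, 'v) chain_complex = "('k, 'v) lin_space" +
  component :: "nat \<Rightarrow> 'v set"
  bd :: "'v \<Rightarrow> 'v"

inductive_set lin_span :: "('k, 'v, 'm) lin_space_scheme \<Rightarrow> 'v set \<Rightarrow> 'v set"
  for V B where
  zero: "vzero V \<in> lin_span V B"
| base: "b \<in> B \<Longrightarrow> b \<in> lin_span V B"
| add: "x \<in> lin_span V B \<Longrightarrow> y \<in> lin_span V B \<Longrightarrow> vadd V x y \<in> lin_span V B"
| scale: "x \<in> lin_span V B \<Longrightarrow> vscale V c x \<in> lin_span V B"

definition coset :: "('k, 'v, 'm) lin_space_scheme \<Rightarrow> 'v set \<Rightarrow> 'v \<Rightarrow> 'v set" where
  "coset V S x = {vadd V x s | s. s \<in> S}"

text \<open>The map on cosets induced by \<open>f\<close>. If \<open>f\<close> respects the subspaces, all sets in the union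
  coincide and the result is the coset of \<open>f x\<close> for any representative \<open>x\<close>.\<close>

definition induced ::
  "('k, 'w, 'm) lin_space_scheme \<Rightarrow> 'w set \<Rightarrow> ('v \<Rightarrow> 'w) \<Rightarrow> 'v set \<Rightarrow> 'w set" where
  "induced W T f X = (\<Union>x\<in>X. coset W T (f x))"

definition induced2 ::
  "('k, 'w, 'm) lin_space_scheme \<Rightarrow> 'w set \<Rightarrow> ('u \<Rightarrow> 'v \<Rightarrow> 'w) \<Rightarrow> 'u set \<Rightarrow> 'v set \<Rightarrow> 'w set" where
  "induced2 W T f X Y = (\<Union>x\<in>X. \<Union>y\<in>Y. coset W T (f x y))"

definition quotient_complex :: "('k, 'v) chain_complex \<Rightarrow> 'v set \<Rightarrow> ('k, 'v set) chain_complex" where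
  "quotient_complex C S =
    \<lparr> carrier = coset C S ` carrier C,
      vadd = induced2 C S (vadd C),
      vzero = coset C S (vzero C),
      vscale = (\<lambda>c. induced C S (vscale C c)),
      component = (\<lambda>n. coset C S ` component C n),
      bd = induced C S (bd C) \<rparr>"

definition subcomplex :: "('k, 'v) chain_complex \<Rightarrow> 'v set \<Rightarrow> ('k, 'v) chain_complex" where
  "subcomplex C W = C\<lparr> carrier := W, component := (\<lambda>n. component C n \<inter> W) \<rparr>"

definition positive_part :: "('k, 'v) chain_complex \<Rightarrow> 'v set" where
  "positive_part C = lin_span C (\<Union>n\<in>{1..}. component C n)"

definition linear_between ::
  "('k, 'v, 'm) lin_space_scheme \<Rightarrow> ('k, 'w, 'n) lin_space_scheme \<Rightarrow> ('v \<Rightarrow> 'w) \<Rightarrow> bool" where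
  "linear_between V W f \<longleftrightarrow>
     f ` carrier V \<subseteq> carrier W \<and>
     (\<forall>x\<in>carrier V. \<forall>y\<in>carrier V. f (vadd V x y) = vadd W (f x) (f y)) \<and>
     (\<forall>c. \<forall>x\<in>carrier V. f (vscale V c x) = vscale W c (f x))"

definition has_boundary :: "('k, 'v) chain_complex \<Rightarrow> bool" where
  "has_boundary C \<longleftrightarrow>
     linear_between C C (bd C) \<and>
     (\<forall>x\<in>component C 0. bd C x = vzero C) \<and>
     (\<forall>n. bd C ` component C (Suc n) \<subseteq> component C n) \<and>
     (\<forall>x\<in>carrier C. bd C (bd C x) = vzero C)"

definition complexes_isomorphic ::
  "('k, 'v) chain_complex \<Rightarrow> ('k, 'w) chain_complex \<Rightarrow> bool" where
  "complexes_isomorphic C D \<longleftrightarrow>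
     has_boundary C \<and> has_boundary D \<and>
     (\<exists>\<phi>. linear_between C D \<phi> \<and>
          bij_betw \<phi> (carrier C) (carrier D) \<and>
          (\<forall>n. \<phi> ` component C n = component D n) \<and>
          (\<forall>x\<in>carrier C. \<phi> (bd C x) = bd D (\<phi> x)))"


section \<open>Free vector spaces on words and tensor powers\<close>

type_synonym ('k, 'v) words = "'v list \<Rightarrow>\<^sub>0 'k"

definition pscale :: "'k::comm_ring_1 \<Rightarrow> ('x \<Rightarrow>\<^sub>0 'k) \<Rightarrow> ('x \<Rightarrow>\<^sub>0 'k)" where
  "pscale c p = Poly_Mapping.map ((*) c) p"

abbreviation word :: "'v list \<Rightarrow> ('k::comm_ring_1, 'v) words" where
  "word w \<equiv> Poly_Mapping.single w 1"

definition lin_ext ::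
  "('x \<Rightarrow> ('y \<Rightarrow>\<^sub>0 'k::comm_ring_1)) \<Rightarrow> ('x \<Rightarrow>\<^sub>0 'k) \<Rightarrow> ('y \<Rightarrow>\<^sub>0 'k)" where
  "lin_ext f p = (\<Sum>x\<in>Poly_Mapping.keys p. pscale (Poly_Mapping.lookup p x) (f x))"

definition bilin_ext ::
  "('x \<Rightarrow> 'y \<Rightarrow> ('z \<Rightarrow>\<^sub>0 'k::comm_ring_1)) \<Rightarrow> ('x \<Rightarrow>\<^sub>0 'k) \<Rightarrow> ('y \<Rightarrow>\<^sub>0 'k) \<Rightarrow> ('z \<Rightarrow>\<^sub>0 'k)" where
  "bilin_ext f p q = lin_ext (\<lambda>x. lin_ext (f x) q) p"

definition word_space :: "('k::comm_ring_1, ('k, 'v) words) lin_space" where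
  "word_space = \<lparr> carrier = UNIV, vadd = (+), vzero = 0, vscale = pscale \<rparr>"

text \<open>The relations that make the word \<open>[x\<^sub>1, \<dots>, x\<^sub>n]\<close> multilinear in its letters. The quotient of
  the span of the words of length \<open>n\<close> by them is the \<open>n\<close>-th tensor power of the vector space
  given by \<open>scale\<close>, and the quotient of \<^const>\<open>word_space\<close> is its tensor algebra.\<close>

definition tensor_relations ::
  "('k::comm_ring_1 \<Rightarrow> 'v::ab_group_add \<Rightarrow> 'v) \<Rightarrow> ('k, 'v) words set" where
  "tensor_relations scale = lin_span word_space
     ({word (u @ (x + y) # v) - word (u @ x # v) - word (u @ y # v) | u x y v. True} \<union>
      {word (u @ scale c x # v) - pscale c (word (u @ x # v)) | c u x v. True})"

definition tensor_class ::
  "('k::comm_ring_1 \<Rightarrow> 'v::ab_group_add \<Rightarrow> 'v) \<Rightarrow> ('k, 'v) words \<Rightarrow> ('k, 'v) words set" where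
  "tensor_class scale = coset word_space (tensor_relations scale)"


section \<open>Shuffles and the first eulerian idempotent\<close>

text \<open>Permutations of \<open>{1, \<dots>, n}\<close> are shifted to \<open>{..<n}\<close>, in accordance with list indices. The left
  action \<open>\<sigma>.(x\<^sub>1, \<dots>, x\<^sub>n) = (x\<^bsub>\<sigma>\<^sup>-\<^sup>1(1)\<^esub>, \<dots>, x\<^bsub>\<sigma>\<^sup>-\<^sup>1(n)\<^esub>)\<close> is \<open>permute_list (inv \<sigma>)\<close>.\<close>

definition act :: "(nat \<Rightarrow> nat) \<Rightarrow> 'v list \<Rightarrow> 'v list" where
  "act \<sigma> xs = permute_list (inv \<sigma>) xs"

definition Sh :: "nat \<Rightarrow> nat \<Rightarrow> (nat \<Rightarrow> nat) set" where
  "Sh p q = {\<sigma>. \<sigma> permutes {..<p + q} \<and> strict_mono_on {..<p} \<sigma> \<and> strict_mono_on {p..<p + q} \<sigma>}"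

definition shuffle_product ::
  "('k::comm_ring_1, 'v) words \<Rightarrow> ('k, 'v) words \<Rightarrow> ('k, 'v) words" where
  "shuffle_product = bilin_ext (\<lambda>u v.
     \<Sum>\<sigma>\<in>Sh (length u) (length v). pscale (of_int (sign \<sigma>)) (word (act \<sigma> (u @ v))))"

text \<open>The structure maps below are given on words. They respect the tensor relations, hence
  describe the corresponding maps of the tensor algebra.

  Since deconcatenation sends \<open>x\<^sub>1 \<cdots> x\<^sub>n\<close> to the sum of \<open>x\<^sub>1 \<cdots> x\<^sub>i \<otimes> x\<^sub>i\<^sub>+\<^sub>1 \<cdots> x\<^sub>n\<close> over \<open>0 \<le> i \<le> n\<close>, the
  formula is \<open>\<mu>\<^sub>s\<^sub>h \<circ> (f \<otimes> g) \<circ> \<Delta>\<close>.\<close>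

definition convolution ::
  "(('k::comm_ring_1, 'v) words \<Rightarrow> ('k, 'v) words) \<Rightarrow> (('k, 'v) words \<Rightarrow> ('k, 'v) words)
    \<Rightarrow> ('k, 'v) words \<Rightarrow> ('k, 'v) words" where
  "convolution f g = lin_ext (\<lambda>w.
     \<Sum>i\<le>length w. shuffle_product (f (word (take i w))) (g (word (drop i w))))"

definition conv_unit :: "('k::comm_ring_1, 'v) words \<Rightarrow> ('k, 'v) words" where
  "conv_unit = lin_ext (\<lambda>w. if w = [] then word [] else 0)"

definition J :: "('k::comm_ring_1, 'v) words \<Rightarrow> ('k, 'v) words" where
  "J p = p - conv_unit p"

fun conv_power ::
  "(('k::comm_ring_1, 'v) words \<Rightarrow> ('k, 'v) words) \<Rightarrow> nat \<Rightarrow> ('k, 'v) words \<Rightarrow> ('k, 'v) words" where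
  "conv_power f 0 = conv_unit"
| "conv_power f (Suc n) = convolution f (conv_power f n)"

text \<open>The logarithm series of \<open>conv_unit + J\<close>, indexed from \<open>0\<close>. It is a finite sum on every argument
  because \<open>conv_power J n\<close> vanishes on words shorter than \<open>n\<close>.\<close>

definition eulerian :: "('k::field_char_0, 'v) words \<Rightarrow> ('k, 'v) words" where
  "eulerian p = Sum_any (\<lambda>n. pscale ((-1) ^ n / of_nat (Suc n)) (conv_power J (Suc n) p))"

text \<open>\<open>c\<close> is an element of the rational group algebra of the symmetric group through which the
  logarithm acts on the \<open>n\<close>-th tensor power of the space given by \<open>scale\<close>.\<close>

definition represents_eulerian ::
  "('k::field_char_0 \<Rightarrow> 'v::ab_group_add \<Rightarrow> 'v) \<Rightarrow> nat \<Rightarrow> ((nat \<Rightarrow> nat) \<Rightarrow> rat) \<Rightarrow> bool" where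
  "represents_eulerian scale n c \<longleftrightarrow>
     (\<forall>\<sigma>. c \<sigma> \<noteq> 0 \<longrightarrow> \<sigma> permutes {..<n}) \<and>
     (\<forall>w. length w = n \<longrightarrow>
        tensor_class scale (eulerian (word w)) =
        tensor_class scale
          (\<Sum>\<sigma> | \<sigma> permutes {..<n}. pscale (of_rat (c \<sigma>)) (word (act \<sigma> w))))"

text \<open>The element is unique only if the dimension of the vector space is at least \<open>n\<close>. It is read
  off from a space of countably infinite dimension, and by naturality it then represents the
  logarithm on every vector space over the same field.\<close>

definition eulerian_element :: "'k::field_char_0 itself \<Rightarrow> nat \<Rightarrow> (nat \<Rightarrow> nat) \<Rightarrow> rat" where
  "eulerian_element _ n =
     (THE c. represents_eulerian (pscale :: 'k \<Rightarrow> (nat \<Rightarrow>\<^sub>0 'k) \<Rightarrow> (nat \<Rightarrow>\<^sub>0 'k)) n c)"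


section \<open>The Hochschild complex, the Harrison complex and the eulerian part\<close>

text \<open>The unit is a parameter (rather than the constant of class \<open>comm_ring_1\<close>), so that the zero
  algebra is included.\<close>

locale comm_unital_algebra = vector_space scale
  for scale :: "'k::field_char_0 \<Rightarrow> 'a::comm_ring \<Rightarrow> 'a" +
  fixes unit :: 'a
  assumes unit_mult: "unit * x = x"
    and scale_mult: "scale c x * y = scale c (x * y)"

text \<open>The word \<open>[a\<^sub>0, a\<^sub>1, \<dots>, a\<^sub>n]\<close> of length \<open>n + 1\<close> stands for the chain \<open>(a\<^sub>0, a\<^sub>1, \<dots>, a\<^sub>n)\<close> of degree
  \<open>n\<close>. The empty word is not a chain.\<close>

definition word_boundary :: "('k::comm_ring_1, 'a::comm_ring) words \<Rightarrow> ('k, 'a) words" where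
  "word_boundary = lin_ext (\<lambda>w. let n = length w - 1 in
     if n = 0 then 0
     else (\<Sum>i<n. pscale ((-1) ^ i) (word (take i w @ (w ! i * w ! Suc i) # drop (i + 2) w)))
          + pscale ((-1) ^ n) (word ((w ! n * w ! 0) # drop 1 (take n w))))"

definition word_complex :: "('k::comm_ring_1, ('k, 'a::comm_ring) words) chain_complex" where
  "word_complex =
    \<lparr> carrier = {p. \<forall>w\<in>Poly_Mapping.keys p. w \<noteq> []},
      vadd = (+), vzero = 0, vscale = pscale,
      component = (\<lambda>n. {p. \<forall>w\<in>Poly_Mapping.keys p. length w = Suc n}),
      bd = word_boundary \<rparr>"

definition hochschild ::
  "('k::comm_ring_1 \<Rightarrow> 'a::comm_ring \<Rightarrow> 'a) \<Rightarrow> ('k, ('k, 'a) words set) chain_complex" where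
  "hochschild scale = quotient_complex word_complex (tensor_relations scale)"

definition act_chain :: "(nat \<Rightarrow> nat) \<Rightarrow> 'a list \<Rightarrow> 'a list" where
  "act_chain \<sigma> w = hd w # act \<sigma> (tl w)"

definition word_bullet ::
  "('k::comm_ring_1, 'a::comm_ring) words \<Rightarrow> ('k, 'a) words \<Rightarrow> ('k, 'a) words" where
  "word_bullet = bilin_ext (\<lambda>v w.
     \<Sum>\<sigma>\<in>Sh (length (tl v)) (length (tl w)).
       pscale (of_int (sign \<sigma>)) (word (act_chain \<sigma> ((hd v * hd w) # tl v @ tl w))))"

definition bullet ::
  "('k::comm_ring_1 \<Rightarrow> 'a::comm_ring \<Rightarrow> 'a)
    \<Rightarrow> ('k, 'a) words set \<Rightarrow> ('k, 'a) words set \<Rightarrow> ('k, 'a) words set" where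
  "bullet scale = induced2 word_complex (tensor_relations scale) word_bullet"

definition augmentation_ideal ::
  "('k::comm_ring_1 \<Rightarrow> 'a::comm_ring \<Rightarrow> 'a) \<Rightarrow> ('k, 'a) words set set" where
  "augmentation_ideal scale = positive_part (hochschild scale)"

definition augmentation_ideal_squared ::
  "('k::comm_ring_1 \<Rightarrow> 'a::comm_ring \<Rightarrow> 'a) \<Rightarrow> ('k, 'a) words set set" where
  "augmentation_ideal_squared scale = lin_span (hochschild scale)
     {bullet scale X Y | X Y. X \<in> augmentation_ideal scale \<and> Y \<in> augmentation_ideal scale}"

definition harrison ::
  "('k::comm_ring_1 \<Rightarrow> 'a::comm_ring \<Rightarrow> 'a) \<Rightarrow> ('k, ('k, 'a) words set set) chain_complex" where
  "harrison scale = quotient_complex (hochschild scale) (augmentation_ideal_squared scale)"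

definition word_e1 :: "('k::field_char_0, 'a) words \<Rightarrow> ('k, 'a) words" where
  "word_e1 = lin_ext (\<lambda>w. let n = length w - 1 in
     \<Sum>\<sigma> | \<sigma> permutes {..<n}.
       pscale (of_rat (eulerian_element TYPE('k) n \<sigma>)) (word (act_chain \<sigma> w)))"

definition e1 ::
  "('k::field_char_0 \<Rightarrow> 'a::comm_ring \<Rightarrow> 'a) \<Rightarrow> ('k, 'a) words set \<Rightarrow> ('k, 'a) words set" where
  "e1 scale = induced word_complex (tensor_relations scale) word_e1"

definition e1_image ::
  "('k::field_char_0 \<Rightarrow> 'a::comm_ring \<Rightarrow> 'a) \<Rightarrow> ('k, 'a) words set set" where
  "e1_image scale = e1 scale ` carrier (hochschild scale)"

text \<open>Since \<open>J\<close> is \<open>0\<close> in weight \<open>0\<close>, the eulerian element in weight \<open>0\<close> is \<open>0\<close> and \<open>e1_image\<close> has no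
  component in degree \<open>0\<close>, whereas the degree \<open>0\<close> component of the Harrison complex is that of the
  Hochschild complex, i.e. the algebra itself. The sum of \<open>e1_image\<close> and the degree \<open>0\<close> chains
  (which is direct) is the image of \<open>e1\<close> under the convention that \<open>e1\<close> is the identity in
  degree \<open>0\<close>.\<close>

definition e1_image_with_degree_0 ::
  "('k::field_char_0 \<Rightarrow> 'a::comm_ring \<Rightarrow> 'a) \<Rightarrow> ('k, 'a) words set set" where
  "e1_image_with_degree_0 scale =
     lin_span (hochschild scale) (component (hochschild scale) 0 \<union> e1_image scale)"

end

(*
  The shuffle product and deconcatenation make the chains a commutative Hopf algebra over A, and the
  Hochschild boundary is a derivation and a coderivation. Hence the convolution powers psi_k of the
  identity are multiplicative and commute with the boundary. On a fixed weight psi_k is a polynomial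
  in k without constant term, with linear coefficient e1. So e1 commutes with the boundary, and it
  kills products of elements of I because psi_k (x y) = psi_k x psi_k y is divisible by the square
  of k. By the logarithm series, x - e1 x is a sum of products for every x in I. Therefore I . I is
  the kernel of e1 on I, and e1 induces the isomorphism.

  All these identities already hold in the free vector space on words in elements of A, before
  passing to the quotient by the tensor relations.
*)

theory Submission
  imports Defs "HOL-Computational_Algebra.Polynomial"
begin

section \<open>Linear maps between free vector spaces\<close>

text \<open>The polynomial dependence on k is the binomial formula for id = 1 + J: psi_k is the sum
  of binomial(k, j) J^j, and on a given weight this stops at j = weight, because every factor J
  consumes a letter. The linear coefficient of binomial(X, j) is (-1)^(j-1)/j, exactly the
  coefficient of J^j in the logarithm.

  The obstacle is the boundary. The coefficient a of a chain (a, w) stays outside the shuffle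
  algebra, yet two faces multiply a letter of w into it, so a derivation and coderivation argument
  on tails alone covers only the inner faces (\<open>bar\<close>). For the two outer faces the
  convolution u . psi_n(v) yields extra terms that absorb the last letter of u or the first letter
  of v; they cancel in pairs when the cut moves by one letter. The unit of A enters here and in (a,
  u . v) = (a, u) . (1, v), which turns shuffles of tails into products in I.

  As e1 is 0 in degree 0 whereas I . I lives in degree at least 2, the comparison map is
  \<open>e1_total\<close>, the identity in degree 0.\<close>

lemma sum_keys_superset:
  assumes "\<And>x. h 0 x = 0" "finite X" "Poly_Mapping.keys p \<subseteq> X"
  shows "(\<Sum>x\<in>Poly_Mapping.keys p. h (Poly_Mapping.lookup p x) x) = (\<Sum>x\<in>X. h (Poly_Mapping.lookup p x) x)"
  by (rule sum.mono_neutral_left) (use assms in \<open>auto simp: in_keys_iff\<close>)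

text \<open>A general additive \<open>h\<close> covers both \<open>lin_ext\<close> and
  \<open>transport\<close>, which also changes the coefficient field.\<close>

lemma sum_keys_add:
  fixes p q :: "'x \<Rightarrow>\<^sub>0 'k::ab_group_add" and h :: "'k \<Rightarrow> 'x \<Rightarrow> 'v::ab_group_add"
  assumes add: "\<And>a b x. h (a + b) x = h a x + h b x"
  shows "(\<Sum>x\<in>Poly_Mapping.keys (p + q). h (Poly_Mapping.lookup (p + q) x) x) =
    (\<Sum>x\<in>Poly_Mapping.keys p. h (Poly_Mapping.lookup p x) x) + (\<Sum>x\<in>Poly_Mapping.keys q. h (Poly_Mapping.lookup q x) x)"
proof -
  let ?X = "Poly_Mapping.keys p \<union> Poly_Mapping.keys q"
  have zero: "h 0 x = 0" for x
    using add[of 0 0 x] by simp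
  have "(\<Sum>x\<in>Poly_Mapping.keys (p + q). h (Poly_Mapping.lookup (p + q) x) x) = (\<Sum>x\<in>?X. h (Poly_Mapping.lookup (p + q) x) x)"
    by (rule sum_keys_superset) (use zero keys_add[of p q] in auto)
  also have "\<dots> = (\<Sum>x\<in>?X. h (Poly_Mapping.lookup p x) x) + (\<Sum>x\<in>?X. h (Poly_Mapping.lookup q x) x)"
    by (simp add: lookup_add add sum.distrib)
  also have "(\<Sum>x\<in>?X. h (Poly_Mapping.lookup p x) x) = (\<Sum>x\<in>Poly_Mapping.keys p. h (Poly_Mapping.lookup p x) x)"
    by (rule sum_keys_superset[symmetric]) (use zero in auto)
  also have "(\<Sum>x\<in>?X. h (Poly_Mapping.lookup q x) x) = (\<Sum>x\<in>Poly_Mapping.keys q. h (Poly_Mapping.lookup q x) x)"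
    by (rule sum_keys_superset[symmetric]) (use zero in auto)
  finally show ?thesis .
qed

lemma lookup_pscale [simp]: "Poly_Mapping.lookup (pscale c p) x = c * Poly_Mapping.lookup p x"
  unfolding pscale_def by (simp add: Poly_Mapping.map.rep_eq when_def)

lemma pscale_add_right: "pscale c (p + q) = pscale c p + pscale c q"
  by (rule poly_mapping_eqI) (simp add: lookup_add algebra_simps)

lemma pscale_add_left: "pscale (c + d) p = pscale c p + pscale d p"
  by (rule poly_mapping_eqI) (simp add: lookup_add algebra_simps)

lemma pscale_pscale [simp]: "pscale c (pscale d p) = pscale (c * d) p"
  by (rule poly_mapping_eqI) (simp add: algebra_simps)

lemma pscale_one [simp]: "pscale 1 p = p"
  by (rule poly_mapping_eqI) simp

lemma pscale_zero_left [simp]: "pscale 0 p = 0"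
  by (rule poly_mapping_eqI) simp

lemma pscale_zero_right [simp]: "pscale c 0 = 0"
  by (rule poly_mapping_eqI) simp

lemma pscale_minus_left [simp]: "pscale (- c) p = - pscale c p"
  by (rule poly_mapping_eqI) simp

lemma pscale_minus_right [simp]: "pscale c (- p) = - pscale c p"
  by (rule poly_mapping_eqI) simp

lemma pscale_diff_right: "pscale c (p - q) = pscale c p - pscale c q"
  by (rule poly_mapping_eqI) (simp add: lookup_minus algebra_simps)

lemma pscale_sum_right: "pscale c (\<Sum>i\<in>I. p i) = (\<Sum>i\<in>I. pscale c (p i))"
  by (rule poly_mapping_eqI) (simp add: lookup_sum sum_distrib_left)

lemma pscale_single: "pscale c (Poly_Mapping.single w d) = Poly_Mapping.single w (c * d)"
  by (rule poly_mapping_eqI) (simp add: lookup_single when_def)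

lemmas pscale_distribs = pscale_add_right pscale_diff_right pscale_sum_right

lemma keys_pscale: "Poly_Mapping.keys (pscale c p) \<subseteq> Poly_Mapping.keys p"
  by (auto simp: in_keys_iff)

lemma sum_keys_word: "p = (\<Sum>w\<in>Poly_Mapping.keys p. pscale (Poly_Mapping.lookup p w) (word w))"
  by (rule poly_mapping_eqI)
    (auto simp: lookup_sum lookup_single when_def in_keys_iff if_distrib[of "(*) _"] cong: if_cong)

definition lin :: "(('x \<Rightarrow>\<^sub>0 'k::comm_ring_1) \<Rightarrow> ('y \<Rightarrow>\<^sub>0 'k)) \<Rightarrow> bool" where
  "lin f \<longleftrightarrow> (\<forall>p q. f (p + q) = f p + f q) \<and> (\<forall>c p. f (pscale c p) = pscale c (f p))"

lemma lin_plus: "lin f \<Longrightarrow> f (p + q) = f p + f q"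
  and lin_scale: "lin f \<Longrightarrow> f (pscale c p) = pscale c (f p)"
  by (auto simp: lin_def)

lemma lin_zero: "lin f \<Longrightarrow> f 0 = 0"
  using lin_scale[of f 0 0] by simp

lemma lin_minus: "lin f \<Longrightarrow> f (- p) = - f p"
  using lin_scale[of f "- 1" p] by simp

lemma lin_diff: "lin f \<Longrightarrow> f (p - q) = f p - f q"
  using lin_plus[of f p "- q"] by (simp add: lin_minus)

lemma lin_sum: "lin f \<Longrightarrow> f (\<Sum>i\<in>I. p i) = (\<Sum>i\<in>I. f (p i))"
  by (induction I rule: infinite_finite_induct) (auto simp: lin_plus lin_zero)

lemmas lin_distribs = lin_plus lin_scale lin_zero lin_minus lin_diff lin_sum

text \<open>Testing only the words that occur in \<open>p\<close> lets identities of chains ignore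
  the empty word, and lets signs that depend on the length be treated as constants.\<close>

lemma lin_eq_on:
  assumes "lin f" "lin g" "\<And>w. w \<in> Poly_Mapping.keys p \<Longrightarrow> f (word w) = g (word w)"
  shows "f p = g p"
proof -
  have "f p = (\<Sum>w\<in>Poly_Mapping.keys p. pscale (Poly_Mapping.lookup p w) (f (word w)))"
    by (subst sum_keys_word) (simp add: lin_sum lin_scale assms(1))
  also have "\<dots> = (\<Sum>w\<in>Poly_Mapping.keys p. pscale (Poly_Mapping.lookup p w) (g (word w)))"
    using assms(3) by simp
  also have "\<dots> = g p"
    by (subst (3) sum_keys_word) (simp add: lin_sum lin_scale assms(2))
  finally show ?thesis .
qed

lemma lin_eqI:
  assumes "lin f" "lin g" "\<And>w. f (word w) = g (word w)"
  shows "f p = g p"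
  using assms by (blast intro: lin_eq_on)

lemma lin_ext_word [simp]: "lin_ext (f :: _ \<Rightarrow> (_ \<Rightarrow>\<^sub>0 'k::comm_ring_1)) (word w) = f w"
  by (cases "(1::'k) = 0") (simp_all add: lin_ext_def)

lemma lin_lin_ext_id: "lin (lin_ext f)"
  unfolding lin_def
proof safe
  fix p q :: "'x \<Rightarrow>\<^sub>0 'k::comm_ring_1" and f :: "'x \<Rightarrow> 'y \<Rightarrow>\<^sub>0 'k" and c :: 'k
  show "lin_ext f (p + q) = lin_ext f p + lin_ext f q"
    unfolding lin_ext_def by (rule sum_keys_add) (rule pscale_add_left)
  have "lin_ext f (pscale c p) =
      (\<Sum>x\<in>Poly_Mapping.keys p. pscale (Poly_Mapping.lookup (pscale c p) x) (f x))"
    unfolding lin_ext_def by (rule sum_keys_superset) (auto intro: keys_pscale[THEN subsetD])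
  then show "lin_ext f (pscale c p) = pscale c (lin_ext f p)"
    by (simp add: lin_ext_def pscale_sum_right)
qed

lemmas lin_ext_distribs = lin_distribs[OF lin_lin_ext_id]
declare lin_ext_distribs [simp]

lemma lin_id: "lin (\<lambda>p. p)"
  by (simp add: lin_def)

lemma lin_const_zero: "lin (\<lambda>p. 0)"
  by (simp add: lin_def)

lemma lin_add: "lin f \<Longrightarrow> lin g \<Longrightarrow> lin (\<lambda>p. f p + g p)"
  by (simp add: lin_def pscale_add_right)

lemma lin_sub: "lin f \<Longrightarrow> lin g \<Longrightarrow> lin (\<lambda>p. f p - g p)"
  by (simp add: lin_def pscale_diff_right)

lemma lin_neg: "lin f \<Longrightarrow> lin (\<lambda>p. - f p)"
  by (simp add: lin_def)

lemma lin_pscale: "lin f \<Longrightarrow> lin (\<lambda>p. pscale c (f p))"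
  by (simp add: lin_def pscale_add_right mult.commute)

lemma lin_setsum: "(\<And>i. i \<in> I \<Longrightarrow> lin (f i)) \<Longrightarrow> lin (\<lambda>p. \<Sum>i\<in>I. f i p)"
  by (auto simp: lin_def sum.distrib pscale_sum_right)

lemma lin_lin_ext: "lin f \<Longrightarrow> lin (\<lambda>p. lin_ext g (f p))"
  by (simp add: lin_def)

lemma lin_pscale_ext: "lin (\<lambda>p. lin_ext (\<lambda>x. h x p) q)" if "\<And>x. lin (h x)"
  using that by (simp add: lin_ext_def lin_def sum.distrib pscale_distribs mult.commute)

lemma lin_bilin_ext_left: "lin f \<Longrightarrow> lin (\<lambda>p. bilin_ext g (f p) q)"
  unfolding bilin_ext_def by (rule lin_lin_ext)

lemma lin_bilin_ext_right: "lin f \<Longrightarrow> lin (\<lambda>q. bilin_ext g p (f q))"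
  unfolding bilin_ext_def by (intro lin_pscale_ext lin_lin_ext)

lemmas lin_intros = lin_id lin_const_zero lin_add lin_sub lin_neg lin_pscale lin_setsum lin_lin_ext
  lin_bilin_ext_left lin_bilin_ext_right

lemma bilin_ext_word [simp]: "bilin_ext g (word u) (word v) = g u v"
  by (simp add: bilin_ext_def)

lemmas bilin_ext_left = lin_distribs[OF lin_bilin_ext_left[OF lin_id]]
lemmas bilin_ext_right = lin_distribs[OF lin_bilin_ext_right[OF lin_id]]
declare bilin_ext_left [simp] bilin_ext_right [simp]

lemma lin_lin_ext_family: "lin_ext (\<lambda>w. f (word w)) p = f p" if "lin f"
  by (rule lin_eqI) (use that in \<open>auto intro: lin_intros\<close>)

abbreviation cons :: "'v \<Rightarrow> ('k::comm_ring_1, 'v) words \<Rightarrow> ('k, 'v) words" where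
  "cons a \<equiv> lin_ext (\<lambda>w. word (a # w))"

section \<open>Shuffles\<close>

text \<open>The copy of S_n in S_(n+1) that fixes 0. Together with \<open>rot\<close> it sorts
  shuffles by the letter that comes first.\<close>

definition lift_perm :: "(nat \<Rightarrow> nat) \<Rightarrow> nat \<Rightarrow> nat" where
  "lift_perm \<sigma> i = (case i of 0 \<Rightarrow> 0 | Suc j \<Rightarrow> Suc (\<sigma> j))"

lemma lift_perm_simps [simp]: "lift_perm \<sigma> 0 = 0" "lift_perm \<sigma> (Suc j) = Suc (\<sigma> j)"
  by (simp_all add: lift_perm_def)

lemma lift_perm_comp: "lift_perm (\<sigma> \<circ> \<tau>) = lift_perm \<sigma> \<circ> lift_perm \<tau>"
  by (auto simp: fun_eq_iff lift_perm_def split: nat.splits)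

lemma lift_perm_id: "lift_perm id = id"
  by (auto simp: fun_eq_iff lift_perm_def split: nat.splits)

lemma lift_perm_inj: "lift_perm \<sigma> = lift_perm \<tau> \<longleftrightarrow> \<sigma> = \<tau>"
  by (metis ext lift_perm_simps(2) nat.inject)

lemma permutes_lift:
  assumes "\<sigma> permutes {..<n}"
  shows "lift_perm \<sigma> permutes {..<Suc n}"
proof (rule bij_imp_permutes)
  have inv: "lift_perm (inv \<sigma>) \<circ> lift_perm \<sigma> = id" "lift_perm \<sigma> \<circ> lift_perm (inv \<sigma>) = id"
    unfolding lift_perm_comp[symmetric] permutes_inv_o[OF assms] lift_perm_id by auto
  show "bij_betw (lift_perm \<sigma>) {..<Suc n} {..<Suc n}"
    using inv assms permutes_inv[OF assms]
    by (intro bij_betw_byWitness[where f' = "lift_perm (inv \<sigma>)"])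
      (auto simp: lift_perm_def fun_eq_iff permutes_in_image[of _ "{..<n}", unfolded lessThan_iff] split: nat.splits)
  show "lift_perm \<sigma> i = i" if "i \<notin> {..<Suc n}" for i
    using that assms by (auto simp: lift_perm_def permutes_def split: nat.splits)
qed

lemma inv_lift_perm: "\<sigma> permutes {..<n} \<Longrightarrow> inv (lift_perm \<sigma>) = lift_perm (inv \<sigma>)"
  by (rule inv_unique_comp)
    (simp_all add: lift_perm_comp[symmetric] permutes_inv_o lift_perm_id)

lemma permutes_fix_0E:
  assumes "\<sigma> permutes {..<Suc n}" "\<sigma> 0 = 0"
  obtains \<tau> where "\<tau> permutes {..<n}" "\<sigma> = lift_perm \<tau>"
proof -
  \<comment> \<open>Inverse of \<open>lift_perm\<close> on permutations fixing 0. The truncated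
    subtraction loses nothing, since injectivity keeps the value 0 away from successors.\<close>
  define drop1 :: "(nat \<Rightarrow> nat) \<Rightarrow> nat \<Rightarrow> nat" where "drop1 = (\<lambda>\<sigma> i. \<sigma> (Suc i) - 1)"
  have lift: "lift_perm (drop1 \<tau>) = \<tau>" if "inj \<tau>" "\<tau> 0 = 0" for \<tau>
  proof
    fix i show "lift_perm (drop1 \<tau>) i = \<tau> i"
    proof (cases i)
      case (Suc j)
      then have "\<tau> (Suc j) \<noteq> 0"
        using that by (metis injD nat.distinct(1))
      then show ?thesis
        using Suc by (simp add: drop1_def)
    qed (use that in simp)
  qed
  have eq: "lift_perm (drop1 \<sigma>) = \<sigma>"
    by (rule lift) (use assms permutes_inj in auto)
  have eq': "lift_perm (drop1 (inv \<sigma>)) = inv \<sigma>"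
    by (rule lift) (use assms permutes_inj permutes_inv permutes_inv_eq in \<open>metis+\<close>)
  have "drop1 \<sigma> permutes {..<n}"
  proof (rule bij_imp_permutes)
    have "drop1 (inv \<sigma>) \<circ> drop1 \<sigma> = id"
      by (rule iffD1[OF lift_perm_inj])
        (simp only: lift_perm_comp eq eq' lift_perm_id permutes_inv_o[OF assms(1)])
    moreover have "drop1 \<sigma> \<circ> drop1 (inv \<sigma>) = id"
      by (rule iffD1[OF lift_perm_inj])
        (simp only: lift_perm_comp eq eq' lift_perm_id permutes_inv_o[OF assms(1)])
    moreover have "drop1 \<tau> i < n" if "i < n" "\<tau> permutes {..<Suc n}" for \<tau> i
      using permutes_in_image[OF that(2), of "Suc i"] that(1) by (auto simp: drop1_def)
    ultimately show "bij_betw (drop1 \<sigma>) {..<n} {..<n}"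
      using assms(1) permutes_inv[OF assms(1)]
      by (intro bij_betw_byWitness[where f' = "drop1 (inv \<sigma>)"]) (auto simp: fun_eq_iff)
    show "drop1 \<sigma> i = i" if "i \<notin> {..<n}" for i
      using that assms(1) by (auto simp: drop1_def permutes_def)
  qed
  with eq show ?thesis
    using that by metis
qed

lemma permutation_of_permutes: "\<sigma> permutes {..<n::nat} \<Longrightarrow> permutation \<sigma>"
  by (auto simp: permutation_permutes)

lemma sign_lift_perm:
  assumes "\<sigma> permutes {..<n}"
  shows "sign (lift_perm \<sigma>) = sign \<sigma>"
proof -
  from assms finite_lessThan show ?thesis
  proof (induction rule: permutes_induct)
    case id
    show ?case by (simp add: lift_perm_id[unfolded id_def] id_def[symmetric] lift_perm_id)
  next
    case (swap a b p)
    note p = \<open>p permutes {..<n}\<close>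
    have lt: "lift_perm (transpose a b) = transpose (Suc a) (Suc b)"
      by (auto simp: fun_eq_iff lift_perm_def transpose_def split: nat.splits)
    have "permutation p" "permutation (lift_perm p)"
      using permutation_of_permutes[OF p] permutation_of_permutes[OF permutes_lift[OF p]] by auto
    then show ?case
      using swap by (simp add: lift_perm_comp lt sign_compose permutation_swap_id sign_swap_id del: o_apply)
  qed
qed

text \<open>The cycle that brings position \<open>p\<close> to the front and keeps the order of all
  other positions.\<close>

definition rot :: "nat \<Rightarrow> nat \<Rightarrow> nat" where
  "rot p i = (if i < p then Suc i else if i = p then 0 else i)"

text \<open>One adjacent transposition per step, whence the sign (-1)^p.\<close>

lemma rot_Suc: "rot (Suc p) = rot p \<circ> transpose p (Suc p)"
  by (auto simp: fun_eq_iff rot_def transpose_def)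

lemma rot_0: "rot 0 = id"
  by (auto simp: fun_eq_iff rot_def)

lemma permutes_rot: "p < n \<Longrightarrow> rot p permutes {..<n}"
proof (induction p)
  case (Suc p)
  then show ?case
    unfolding rot_Suc by (intro permutes_compose permutes_swap_id) auto
qed (simp add: rot_0 permutes_id)

lemma sign_rot: "sign (rot p) = (- 1) ^ p"
proof (induction p)
  case (Suc p)
  have "permutation (rot p)"
    using permutes_rot[of p "Suc p"] permutation_of_permutes by blast
  with Suc show ?case
    unfolding rot_Suc by (simp add: sign_compose permutation_swap_id sign_swap_id del: o_apply)
qed (simp add: rot_0)

lemma act_comp:
  assumes "\<sigma> permutes {..<length xs}" "\<tau> permutes {..<length xs}"
  shows "act (\<sigma> \<circ> \<tau>) xs = act \<sigma> (act \<tau> xs)"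
  unfolding act_def
  using assms by (simp add: o_inv_distrib permutes_bij permutes_inv permute_list_compose)

lemma length_act [simp]: "length (act \<sigma> xs) = length xs"
  by (simp add: act_def)

lemma act_map: "\<sigma> permutes {..<length xs} \<Longrightarrow> act \<sigma> (map f xs) = map f (act \<sigma> xs)"
  by (simp add: act_def permute_list_map permutes_inv)

lemma act_lift_perm:
  assumes "\<sigma> permutes {..<length xs}"
  shows "act (lift_perm \<sigma>) (x # xs) = x # act \<sigma> xs"
  unfolding act_def inv_lift_perm[OF assms] permute_list_def
  by (simp add: map_upt_Suc del: upt_Suc)

lemma act_rot: "act (rot (length u)) (u @ b # v) = b # u @ v"
proof -
  have "rot (length u) permutes {..<length (u @ b # v)}"
    by (rule permutes_rot) simp
  note rot = permutes_inv[OF this] permutes_inverses[OF this]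
  show ?thesis
  proof (rule nth_equalityI)
    fix i assume "i < length (act (rot (length u)) (u @ b # v))"
    then have i: "i < length (u @ b # v)" by simp
    define j where "j = inv (rot (length u)) i"
    have "i = rot (length u) j"
      using rot(2) by (simp add: j_def)
    moreover have "act (rot (length u)) (u @ b # v) ! i = (u @ b # v) ! j"
      unfolding act_def j_def using permute_list_nth[OF rot(1) i] .
    ultimately show "act (rot (length u)) (u @ b # v) ! i = (b # u @ v) ! i"
      by (cases "j < length u") (auto simp: rot_def nth_append nth_Cons Suc_diff_le split: nat.splits)
  qed simp
qed

section \<open>Shuffles sorted by the first letter of the result\<close>

lemma Sh_0_0: "Sh 0 0 = {id}"
  by (auto simp: Sh_def permutes_empty)

lemma strict_mono_on_lift_perm:
  "strict_mono_on {..<Suc p} (lift_perm \<sigma>) \<longleftrightarrow> strict_mono_on {..<p} \<sigma>"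
proof
  assume *: "strict_mono_on {..<Suc p} (lift_perm \<sigma>)"
  show "strict_mono_on {..<p} \<sigma>"
  proof (rule strict_mono_onI)
    fix i j assume "i \<in> {..<p}" "j \<in> {..<p}" "i < j"
    then show "\<sigma> i < \<sigma> j"
      using strict_mono_onD[OF *, of "Suc i" "Suc j"] by simp
  qed
next
  assume *: "strict_mono_on {..<p} \<sigma>"
  show "strict_mono_on {..<Suc p} (lift_perm \<sigma>)"
    by (rule strict_mono_onI) (use strict_mono_onD[OF *] in \<open>auto simp: lift_perm_def split: nat.splits\<close>)
qed

lemma strict_mono_on_lift_perm_upper:
  "strict_mono_on {Suc p..<Suc n} (lift_perm \<sigma>) \<longleftrightarrow> strict_mono_on {p..<n} \<sigma>"
proof
  assume *: "strict_mono_on {Suc p..<Suc n} (lift_perm \<sigma>)"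
  show "strict_mono_on {p..<n} \<sigma>"
  proof (rule strict_mono_onI)
    fix i j assume "i \<in> {p..<n}" "j \<in> {p..<n}" "i < j"
    then show "\<sigma> i < \<sigma> j"
      using strict_mono_onD[OF *, of "Suc i" "Suc j"] by simp
  qed
next
  assume *: "strict_mono_on {p..<n} \<sigma>"
  show "strict_mono_on {Suc p..<Suc n} (lift_perm \<sigma>)"
    by (rule strict_mono_onI) (use strict_mono_onD[OF *] in \<open>auto simp: lift_perm_def split: nat.splits\<close>)
qed

lemma lift_perm_in_Sh: "lift_perm \<sigma> \<in> Sh (Suc p) q \<longleftrightarrow> \<sigma> \<in> Sh p q" if "\<sigma> permutes {..<p + q}"
  using that permutes_lift[OF that]
  by (simp add: Sh_def strict_mono_on_lift_perm strict_mono_on_lift_perm_upper)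

text \<open>These are the shuffles that put the first letter of the second block in front.
  Monotonicity on that block is preserved because its other values are all at least 1.\<close>

lemma lift_perm_rot_in_Sh:
  assumes "\<sigma> permutes {..<p + q}"
  shows "lift_perm \<sigma> \<circ> rot p \<in> Sh p (Suc q) \<longleftrightarrow> \<sigma> \<in> Sh p q"
proof -
  let ?\<tau> = "lift_perm \<sigma> \<circ> rot p"
  have low: "?\<tau> i = Suc (\<sigma> i)" if "i < p" for i
    using that by (simp add: rot_def)
  have mid: "?\<tau> p = 0"
    by (simp add: rot_def)
  have high: "?\<tau> (Suc i) = Suc (\<sigma> i)" if "p \<le> i" for i
    using that by (simp add: rot_def)
  have perm: "?\<tau> permutes {..<p + Suc q}"
    using assms permutes_rot[of p "p + Suc q"] permutes_lift[OF assms] by (auto intro: permutes_compose)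
  have 1: "strict_mono_on {..<p} ?\<tau> \<longleftrightarrow> strict_mono_on {..<p} \<sigma>"
    by (auto simp: strict_mono_on_def low simp del: o_apply)
  have 2: "strict_mono_on {p..<p + Suc q} ?\<tau> \<longleftrightarrow> strict_mono_on {p..<p + q} \<sigma>"
  proof
    assume *: "strict_mono_on {p..<p + Suc q} ?\<tau>"
    show "strict_mono_on {p..<p + q} \<sigma>"
    proof (rule strict_mono_onI)
      fix i j assume "i \<in> {p..<p + q}" "j \<in> {p..<p + q}" "i < j"
      then show "\<sigma> i < \<sigma> j"
        using strict_mono_onD[OF *, of "Suc i" "Suc j"] high[of i] high[of j] by simp
    qed
  next
    assume *: "strict_mono_on {p..<p + q} \<sigma>"
    show "strict_mono_on {p..<p + Suc q} ?\<tau>"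
    proof (rule strict_mono_onI)
      fix i j assume ij: "i \<in> {p..<p + Suc q}" "j \<in> {p..<p + Suc q}" "i < j"
      then obtain j' where j': "j = Suc j'" "p \<le> j'" "j' < p + q"
        by (cases j) auto
      show "?\<tau> i < ?\<tau> j"
      proof (cases "i = p")
        case True
        then show ?thesis
          using mid high[of j'] j' by simp
      next
        case False
        then obtain i' where "i = Suc i'" "p \<le> i'"
          using ij by (cases i) auto
        then show ?thesis
          using high[of j'] high[of i'] j' ij strict_mono_onD[OF *, of i' j'] by simp
      qed
    qed
  qed
  show ?thesis
    using assms perm 1 2 by (simp add: Sh_def)
qed

lemma Sh_permutes: "\<sigma> \<in> Sh p q \<Longrightarrow> \<sigma> permutes {..<p + q}"
  by (simp add: Sh_def)

lemma finite_Sh: "finite (Sh p q)"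
  by (rule finite_subset[OF _ finite_permutations[of "{..<p + q}"]]) (auto simp: Sh_def)

text \<open>The index sent to 0 must be the least of its block, since a smaller one would be sent
  below 0 by monotonicity.\<close>

lemma Sh_first_cases:
  assumes "\<sigma> \<in> Sh p q" "0 < p + q"
  shows "\<sigma> 0 = 0 \<and> 0 < p \<or> \<sigma> p = 0 \<and> 0 < q"
proof -
  have perm: "\<sigma> permutes {..<p + q}"
    using assms by (simp add: Sh_def)
  define i where "i = inv \<sigma> 0"
  have i: "\<sigma> i = 0" "i < p + q"
    using permutes_inverses(1)[OF perm] permutes_in_image[OF permutes_inv[OF perm], of 0] assms(2)
    by (simp_all add: i_def)
  show ?thesis
  proof (cases "i < p")
    case True
    then have "\<not> 0 < i"
      using assms(1) i strict_mono_onD[of "{..<p}" \<sigma> 0 i] by (auto simp: Sh_def)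
    with True i show ?thesis by auto
  next
    case False
    then have "\<not> p < i"
      using assms(1) i strict_mono_onD[of "{p..<p + q}" \<sigma> p i] by (fastforce simp: Sh_def)
    with False have "i = p" by linarith
    with i show ?thesis by auto
  qed
qed

lemma Sh_split:
  assumes "0 < p + q"
  shows "Sh p q = (if p = 0 then {} else lift_perm ` Sh (p - 1) q) \<union>
     (if q = 0 then {} else (\<lambda>\<sigma>. lift_perm \<sigma> \<circ> rot p) ` Sh p (q - 1))" (is "_ = ?A \<union> ?B")
proof
  show "Sh p q \<subseteq> ?A \<union> ?B"
  proof
    fix \<sigma> assume \<sigma>: "\<sigma> \<in> Sh p q"
    note perm = Sh_permutes[OF \<sigma>]
    from Sh_first_cases[OF \<sigma> assms] show "\<sigma> \<in> ?A \<union> ?B"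
    proof (elim disjE conjE)
      assume "\<sigma> 0 = 0" "0 < p"
      then obtain p' where p': "p = Suc p'" by (cases p) auto
      with perm \<open>\<sigma> 0 = 0\<close> obtain \<tau> where "\<tau> permutes {..<p' + q}" "\<sigma> = lift_perm \<tau>"
        by (metis permutes_fix_0E add_Suc)
      with \<sigma> p' show ?thesis
        by (auto simp: lift_perm_in_Sh)
    next
      assume "\<sigma> p = 0" "0 < q"
      then obtain q' where q': "q = Suc q'" by (cases q) auto
      have rot: "rot p permutes {..<p + q}"
        using q' by (intro permutes_rot) simp
      have "inv (rot p) 0 = p"
        using permutes_inv_eq[OF rot] by (simp add: rot_def)
      then have "(\<sigma> \<circ> inv (rot p)) 0 = 0"
        using \<open>\<sigma> p = 0\<close> by simp
      moreover have "\<sigma> \<circ> inv (rot p) permutes {..<Suc (p + q')}"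
        using permutes_compose[OF permutes_inv[OF rot] perm] q' by simp
      ultimately obtain \<tau> where \<tau>: "\<tau> permutes {..<p + q'}" "\<sigma> \<circ> inv (rot p) = lift_perm \<tau>"
        by (metis permutes_fix_0E)
      then have "\<sigma> = lift_perm \<tau> \<circ> rot p"
        using permutes_inv_o(2)[OF rot] by (metis comp_assoc comp_id)
      with \<tau> \<sigma> q' show ?thesis
        by (auto simp: lift_perm_rot_in_Sh)
    qed
  qed
  show "?A \<union> ?B \<subseteq> Sh p q"
  proof -
    have "lift_perm \<sigma> \<in> Sh p q" if "\<sigma> \<in> Sh (p - 1) q" "p \<noteq> 0" for \<sigma>
      using that lift_perm_in_Sh[OF Sh_permutes[OF that(1)]] by simp
    moreover have "lift_perm \<sigma> \<circ> rot p \<in> Sh p q" if "\<sigma> \<in> Sh p (q - 1)" "q \<noteq> 0" for \<sigma>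
      using that lift_perm_rot_in_Sh[OF Sh_permutes[OF that(1)]] by simp
    ultimately show ?thesis
      by (auto split: if_splits)
  qed
qed

section \<open>The recursion for the shuffle product\<close>

definition shuffle_sum :: "'v list \<Rightarrow> 'v list \<Rightarrow> ('k::comm_ring_1, 'v) words" where
  "shuffle_sum u v =
    (\<Sum>\<sigma>\<in>Sh (length u) (length v). pscale (of_int (sign \<sigma>)) (word (act \<sigma> (u @ v))))"

text \<open>The sign of the second term is \<open>sign_rot\<close>: the head of \<open>v\<close>
  passes every letter of \<open>u\<close>.\<close>

lemma shuffle_sum_split:
  assumes "u \<noteq> [] \<or> v \<noteq> []"
  shows "shuffle_sum u v = (if u = [] then 0 else cons (hd u) (shuffle_sum (tl u) v)) +
     (if v = [] then 0 else pscale ((- 1) ^ length u) (cons (hd v) (shuffle_sum u (tl v))))"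
proof -
  let ?t = "\<lambda>\<sigma>. pscale (of_int (sign \<sigma>)) (word (act \<sigma> (u @ v)))"
  let ?p = "length u" and ?q = "length v"
  let ?A = "if ?p = 0 then {} else lift_perm ` Sh (?p - 1) ?q"
  let ?B = "if ?q = 0 then {} else (\<lambda>\<sigma>. lift_perm \<sigma> \<circ> rot ?p) ` Sh ?p (?q - 1)"
  have "shuffle_sum u v = sum ?t (?A \<union> ?B)"
    unfolding shuffle_sum_def using assms by (subst Sh_split) auto
  also have "\<dots> = sum ?t ?A + sum ?t ?B"
  proof (rule sum.union_disjoint)
    \<comment> \<open>The value at 0 separates the two families. For empty \<open>u\<close> it does
      not, but then the first family is empty.\<close>
    have "\<sigma> 0 = 0" if "\<sigma> \<in> ?A" for \<sigma>
      using that by (auto split: if_splits)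
    moreover have "\<sigma> 0 \<noteq> 0" if "\<sigma> \<in> ?B" "?p \<noteq> 0" for \<sigma>
      using that by (auto simp: rot_def split: if_splits)
    ultimately show "?A \<inter> ?B = {}"
      by (cases "?p = 0") (simp, blast)
  qed (auto simp: finite_Sh)
  also have "sum ?t ?A = (if u = [] then 0 else cons (hd u) (shuffle_sum (tl u) v))"
  proof (cases u)
    case (Cons a u')
    have "?t (lift_perm \<sigma>) = cons a (pscale (of_int (sign \<sigma>)) (word (act \<sigma> (u' @ v))))"
      if "\<sigma> \<in> Sh (length u') ?q" for \<sigma>
      using Cons Sh_permutes[OF that] by (simp add: sign_lift_perm act_lift_perm)
    note t = sum.cong[OF refl this]
    have "sum ?t (lift_perm ` Sh (length u') ?q) = cons a (shuffle_sum u' v)"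
      unfolding shuffle_sum_def
      by (subst sum.reindex) (auto intro: inj_onI simp: lift_perm_inj o_def t)
    with Cons show ?thesis by simp
  qed simp
  also have "sum ?t ?B =
      (if v = [] then 0 else pscale ((- 1) ^ length u) (cons (hd v) (shuffle_sum u (tl v))))"
  proof (cases v)
    case (Cons b v')
    have t: "?t (lift_perm \<sigma> \<circ> rot ?p) =
        pscale ((- 1) ^ ?p) (cons b (pscale (of_int (sign \<sigma>)) (word (act \<sigma> (u @ v')))))"
      if "\<sigma> \<in> Sh ?p (length v')" for \<sigma>
    proof -
      have perm: "\<sigma> permutes {..<?p + length v'}"
        using Sh_permutes[OF that] .
      have rot: "rot ?p permutes {..<Suc (?p + length v')}"
        by (rule permutes_rot) simp
      have "act (lift_perm \<sigma> \<circ> rot ?p) (u @ v) = act (lift_perm \<sigma>) (b # u @ v')"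
        using permutes_lift[OF perm] rot Cons by (simp add: act_comp act_rot)
      also have "\<dots> = b # act \<sigma> (u @ v')"
        using perm by (simp add: act_lift_perm)
      finally show ?thesis
        using permutes_lift[OF perm] perm rot
        by (simp add: sign_compose[OF permutation_of_permutes permutation_of_permutes]
            sign_lift_perm sign_rot mult.commute)
    qed
    have "inj_on (\<lambda>\<sigma>. lift_perm \<sigma> \<circ> rot ?p) (Sh ?p (length v'))"
    proof (rule inj_onI)
      fix \<sigma> \<tau> assume "lift_perm \<sigma> \<circ> rot ?p = lift_perm \<tau> \<circ> rot ?p"
      then have "lift_perm \<sigma> \<circ> (rot ?p \<circ> inv (rot ?p)) = lift_perm \<tau> \<circ> (rot ?p \<circ> inv (rot ?p))"
        by (metis comp_assoc)
      then show "\<sigma> = \<tau>"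
        using permutes_inv_o(1)[OF permutes_rot[of ?p "Suc ?p"]] by (simp add: lift_perm_inj)
    qed
    then have "sum ?t ((\<lambda>\<sigma>. lift_perm \<sigma> \<circ> rot ?p) ` Sh ?p (length v')) =
        (\<Sum>\<sigma>\<in>Sh ?p (length v'). ?t (lift_perm \<sigma> \<circ> rot ?p))"
      by (rule sum.reindex_cong) auto
    then have "sum ?t ((\<lambda>\<sigma>. lift_perm \<sigma> \<circ> rot ?p) ` Sh ?p (length v')) =
        pscale ((- 1) ^ ?p) (cons b (shuffle_sum u v'))"
      by (simp only: shuffle_sum_def pscale_sum_right t lin_ext_distribs cong: sum.cong)
    with Cons show ?thesis by simp
  qed simp
  finally show ?thesis .
qed

text \<open>Recursive form of the shuffle product of two words, suited to induction. The minus sign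
  arises because \<open>b\<close> passes all \<open>length u + 1\<close> letters of
  \<open>a # u\<close>.\<close>

fun shl :: "'v list \<Rightarrow> 'v list \<Rightarrow> ('k::comm_ring_1, 'v) words" where
  "shl [] v = word v"
| "shl (a # u) [] = word (a # u)"
| "shl (a # u) (b # v) =
    cons a (shl u (b # v)) - pscale ((- 1) ^ length u) (cons b (shl (a # u) v))"

lemma shl_Nil_right [simp]: "shl u [] = word u"
  by (cases u) auto

lemma shuffle_sum_eq_shl: "shuffle_sum u v = shl u v"
proof (induction u v rule: shl.induct)
  case (1 v)
  show ?case
  proof (induction v)
    case Nil
    show ?case by (simp add: shuffle_sum_def Sh_0_0 act_def inv_id)
  next
    case (Cons b v)
    then show ?case by (subst shuffle_sum_split) auto
  qed
next
  case (2 a u)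
  have "shuffle_sum u [] = word u" for u :: "'v list"
  proof (induction u)
    case Nil
    show ?case by (simp add: shuffle_sum_def Sh_0_0 act_def inv_id)
  next
    case (Cons b v)
    then show ?case by (subst shuffle_sum_split) auto
  qed
  then show ?case by simp
next
  case (3 a u b v)
  then show ?case by (subst shuffle_sum_split) auto
qed

abbreviation shp :: "('k::comm_ring_1, 'v) words \<Rightarrow> ('k, 'v) words \<Rightarrow> ('k, 'v) words" where
  "shp \<equiv> bilin_ext shl"

lemma shuffle_product_eq: "shuffle_product = shp"
  unfolding shuffle_product_def shuffle_sum_def[symmetric] shuffle_sum_eq_shl ..

section \<open>Supports: lengths and letters of the words in an element\<close>

definition supported :: "('x \<Rightarrow> bool) \<Rightarrow> ('x \<Rightarrow>\<^sub>0 'k::zero) \<Rightarrow> bool" where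
  "supported P p \<longleftrightarrow> (\<forall>x\<in>Poly_Mapping.keys p. P x)"

lemma supported_zero: "supported P 0"
  by (simp add: supported_def)

lemma supported_word: "P w \<Longrightarrow> supported P (word w)"
  by (simp add: supported_def)

lemma supported_add: "supported P p \<Longrightarrow> supported P q \<Longrightarrow> supported P (p + q)"
  by (auto simp: supported_def dest!: keys_add[THEN subsetD])

lemma supported_diff:
  fixes p q :: "'x \<Rightarrow>\<^sub>0 'k::ab_group_add"
  shows "supported P p \<Longrightarrow> supported P q \<Longrightarrow> supported P (p - q)"
  by (auto simp: supported_def in_keys_iff lookup_minus)

lemma supported_minus:
  fixes p :: "'x \<Rightarrow>\<^sub>0 'k::ab_group_add"
  shows "supported P p \<Longrightarrow> supported P (- p)"
  by (auto simp: supported_def in_keys_iff)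

lemma supported_pscale: "supported P p \<Longrightarrow> supported P (pscale c p)"
  by (auto simp: supported_def dest!: keys_pscale[THEN subsetD])

lemma supported_sum: "(\<And>i. i \<in> I \<Longrightarrow> supported P (p i)) \<Longrightarrow> supported P (\<Sum>i\<in>I. p i)"
  by (induction I rule: infinite_finite_induct) (auto intro: supported_zero supported_add)

lemma supported_lin_ext:
  "supported P p \<Longrightarrow> (\<And>x. P x \<Longrightarrow> supported Q (f x)) \<Longrightarrow> supported Q (lin_ext f p)"
  unfolding lin_ext_def by (intro supported_sum supported_pscale) (auto simp: supported_def)

lemma supported_bilin_ext:
  assumes "supported P p" "supported P' q" "\<And>x y. P x \<Longrightarrow> P' y \<Longrightarrow> supported Q (g x y)"
  shows "supported Q (bilin_ext g p q)"
  unfolding bilin_ext_def using assms by (intro supported_lin_ext[of P] supported_lin_ext[of P']) auto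

lemma supported_mono: "supported P p \<Longrightarrow> (\<And>x. P x \<Longrightarrow> Q x) \<Longrightarrow> supported Q p"
  by (auto simp: supported_def)

lemmas supported_intros = supported_zero supported_add supported_diff supported_minus
  supported_pscale supported_sum

lemma lin_eq_on_supported:
  assumes "supported P p" "lin f" "lin g" "\<And>w. P w \<Longrightarrow> f (word w) = g (word w)"
  shows "f p = g p"
  using assms(1,4) by (auto simp: supported_def intro: lin_eq_on[OF assms(2,3)])

lemma bilin_eqI:
  assumes "\<And>q. lin (\<lambda>p. f p q)" "\<And>p. lin (f p)" "\<And>q. lin (\<lambda>p. g p q)" "\<And>p. lin (g p)"
    and "\<And>u v. f (word u) (word v) = g (word u) (word v)"
  shows "f p q = g p q"
  by (rule lin_eqI[of "\<lambda>p. f p q" "\<lambda>p. g p q"], use assms in simp_all)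
    (rule lin_eqI, use assms in simp_all)

lemma bilin_ext_eq:
  assumes "\<And>q. lin (\<lambda>p. f p q)" "\<And>p. lin (f p)"
  shows "bilin_ext (\<lambda>u v. f (word u) (word v)) p q = f p q"
  by (rule bilin_eqI) (use assms in \<open>auto intro: lin_intros\<close>)

text \<open>The multiset, not just the length, is tracked because it later shows that the logarithm
  of a word is a combination of its rearrangements.\<close>

lemma mset_shl: "supported (\<lambda>w. mset w = mset u + mset v) (shl u v)"
proof (induction u v rule: shl.induct)
  case (3 a u b v)
  show ?case
    unfolding shl.simps
    by (intro supported_intros supported_lin_ext[OF "3.IH"(1)] supported_lin_ext[OF "3.IH"(2)])
      (auto intro: supported_word)
qed (auto intro: supported_word)

lemma length_shl: "supported (\<lambda>w. length w = length u + length v) (shl u v)"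
  by (rule supported_mono[OF mset_shl]) (metis size_mset size_union)

text \<open>The grading sign as a linear map; it carries Koszul signs from words to arbitrary
  elements.\<close>

abbreviation alternate :: "('k::comm_ring_1, 'v) words \<Rightarrow> ('k, 'v) words" where
  "alternate \<equiv> lin_ext (\<lambda>w. pscale ((- 1) ^ length w) (word w))"

lemma alternate_supported:
  assumes "supported (\<lambda>w. length w = n) p"
  shows "alternate p = pscale ((- 1) ^ n) p"
  by (rule lin_eq_on_supported[OF assms]) (auto intro: lin_intros)

lemma shp_unit_left [simp]: "shp (word []) p = p"
  by (rule lin_eqI[of "\<lambda>p. shp (word []) p"]) (auto intro: lin_intros)

lemma shp_unit_right [simp]: "shp p (word []) = p"
  by (rule lin_eqI[of "\<lambda>p. shp p (word [])"]) (auto intro: lin_intros)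

text \<open>The recursion of \<open>shl\<close> extended bilinearly. Its sign depends on the length
  of each word of \<open>p\<close>, hence \<open>alternate\<close>.\<close>

lemma shp_cons_cons:
  "shp (cons a p) (cons b q) = cons a (shp p (cons b q)) - cons b (shp (cons a (alternate p)) q)"
  by (rule bilin_eqI[of "\<lambda>p q. shp (cons a p) (cons b q)"
        "\<lambda>p q. cons a (shp p (cons b q)) - cons b (shp (cons a (alternate p)) q)"])
    (auto intro!: lin_intros)

lemma shl_commute: "shl u v = pscale ((- 1) ^ (length u * length v)) (shl v u)"
proof (induction u v rule: shl.induct)
  case (3 a u b v)
  show ?case
    unfolding shl.simps(3)[of a u b v] "3.IH" shl.simps(3)[of b v a u]
    by (auto simp: minus_one_power_iff pscale_distribs)
qed auto

lemma shp_commute_word: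
  assumes "supported (\<lambda>w. length w = n) p"
  shows "shp (word v) p = pscale ((- 1) ^ (n * length v)) (shp p (word v))"
  by (rule lin_eq_on_supported[OF assms])
    (auto intro!: lin_intros simp: shl_commute[of v] mult.commute)

text \<open>Both sides expand into three terms, according to which of the three words supplies the
  first letter.\<close>

lemma shl_assoc:
  fixes u v w :: "'v list"
  shows "(shp (shl u v) (word w) :: ('k::comm_ring_1, 'v) words) = shp (word u) (shl v w)"
proof (induction "length u + length v + length w" arbitrary: u v w rule: less_induct)
  case less
  show ?case
  proof (cases "u = [] \<or> v = [] \<or> w = []")
    case True
    then show ?thesis by auto
  next
    case False
    then obtain a u' b v' c w' where uvw: "u = a # u'" "v = b # v'" "w = c # w'"
      by (auto simp: neq_Nil_conv)
    define s t :: 'k where "s = (- 1) ^ length u'" and "t = (- 1) ^ length v'"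
    define P Q P' Q' :: "('k, 'v) words" where "P = shl u' v" and "Q = shl u v'" and "P' = shl v' w" and "Q' = shl v w'"
    note PQ = P_def Q_def P'_def Q'_def
    have IH: "shp P (word w) = shp (word u') (shl v w)" "shp Q (word w) = shp (word u) P'"
      "shp (shl u v) (word w') = shp (word u) Q'"
      using less[of u' v w] less[of u v' w] less[of u v w'] uvw by (simp_all add: PQ)
    have uv: "shl u v = cons a P - pscale s (cons b Q)"
      by (simp add: uvw PQ s_def)
    have vw: "shl v w = cons b P' - pscale t (cons c Q')"
      by (simp add: uvw PQ t_def)
    have words: "word w = cons c (word w')" "word u = cons a (word u')"
      by (simp_all add: uvw)
    \<comment> \<open>Both \<open>P\<close> and \<open>Q\<close> have length
      \<open>length u' + length v' + 1\<close>. The common sign lets their contributions be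
      reassembled into \<open>shl u v\<close>.\<close>
    have alt: "alternate P = pscale (- s * t) P" "alternate Q = pscale (- s * t) Q"
      using alternate_supported[OF length_shl[of u' v]] alternate_supported[OF length_shl[of u v']]
      by (simp_all add: PQ s_def t_def uvw power_add)
    have left: "shp (cons x R) (word w) =
        cons x (shp R (word w)) - cons c (shp (cons x (alternate R)) (word w'))" for x R
      unfolding words by (rule shp_cons_cons)
    have right: "shp (word u) (cons x R) =
        cons a (shp (word u') (cons x R)) - pscale s (cons x (shp (word u) R))" for x R
      unfolding words shp_cons_cons by (simp add: s_def)
    have "shp (shl u v) (word w) =
        cons a (shp P (word w)) - pscale s (cons b (shp Q (word w)))
        + pscale (s * t) (cons c (shp (cons a P - pscale s (cons b Q)) (word w')))"
      unfolding uv by (simp add: left alt pscale_distribs ac_simps)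
    also have "\<dots> = cons a (shp (word u') (shl v w)) - pscale s (cons b (shp (word u) P'))
        + pscale (s * t) (cons c (shp (word u) Q'))"
      unfolding IH uv[symmetric] ..
    also have "\<dots> = shp (word u) (shl v w)"
      unfolding vw by (simp add: right pscale_distribs ac_simps)
    finally show ?thesis .
  qed
qed

lemma shp_assoc: "shp (shp p q) r = shp p (shp q r)"
proof -
  have 1: "shp (shp (word u) (word v)) r = shp (word u) (shp (word v) r)" for u v r
    by (rule lin_eqI[of "\<lambda>r. shp (shp (word u) (word v)) r"]) (auto intro!: lin_intros simp: shl_assoc)
  show ?thesis
    by (rule bilin_eqI[of "\<lambda>p q. shp (shp p q) r" "\<lambda>p q. shp p (shp q r)"])
      (auto intro!: lin_intros simp: 1[simplified])
qed

section \<open>Deconcatenation\<close>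

text \<open>The coproduct in Sweedler form: a sum over all splittings of \<open>w\<close>.
  Evaluating \<open>G\<close> on both factors directly replaces a tensor square of the free
  space.\<close>

definition cut :: "('v list \<Rightarrow> 'v list \<Rightarrow> 'b::comm_monoid_add) \<Rightarrow> 'v list \<Rightarrow> 'b" where
  "cut G w = (\<Sum>i\<le>length w. G (take i w) (drop i w))"

lemma cut_Nil [simp]: "cut G [] = G [] []"
  by (simp add: cut_def)

lemma cut_Cons: "cut G (x # w) = G [] (x # w) + cut (\<lambda>u. G (x # u)) w"
  by (simp add: cut_def sum.atMost_Suc_shift del: sum.atMost_Suc)

lemma cut_cong: "(\<And>u v. u @ v = w \<Longrightarrow> G u v = G' u v) \<Longrightarrow> cut G w = cut G' w"
  by (simp add: cut_def)

lemma cut_add: "cut (\<lambda>u v. G u v + G' u v) w = cut G w + cut G' w"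
  by (simp add: cut_def sum.distrib)

lemma cut_diff:
  fixes G G' :: "'v list \<Rightarrow> 'v list \<Rightarrow> 'b::ab_group_add"
  shows "cut (\<lambda>u v. G u v - G' u v) w = cut G w - cut G' w"
  by (simp add: cut_def sum_subtractf)

lemma cut_lin: "lin f \<Longrightarrow> cut (\<lambda>u v. f (G u v)) w = f (cut G w)"
  by (simp add: cut_def lin_sum)

lemma cut_pscale: "cut (\<lambda>u v. pscale c (G u v)) w = pscale c (cut G w)"
  by (rule cut_lin) (intro lin_intros)

lemma cut_zero [simp]: "cut (\<lambda>u v. 0) w = 0"
  by (simp add: cut_def)

lemma supported_cut: "(\<And>u v. u @ v = w \<Longrightarrow> supported P (G u v)) \<Longrightarrow> supported P (cut G w)"
  unfolding cut_def by (intro supported_sum) auto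

lemma lin_ext_cut_cons:
  "lin_ext (cut G) (cons a p) = lin_ext (G []) (cons a p) + lin_ext (cut (\<lambda>u. G (a # u))) p"
  by (rule lin_eqI[of "\<lambda>p. lin_ext (cut G) (cons a p)"]) (auto intro!: lin_intros simp: cut_Cons)

lemma bilin_ext_cons:
  fixes G :: "'v list \<Rightarrow> 'v list \<Rightarrow> _"
  shows "bilin_ext (\<lambda>u. G (a # u)) p q = bilin_ext G (cons a p) q"
  by (rule bilin_eqI[of "bilin_ext (\<lambda>u. G (a # u))" "\<lambda>p. bilin_ext G (cons a p)"])
    (auto intro!: lin_intros)

text \<open>The sign is the Koszul sign of the product on the tensor square.\<close>

lemma cut_shl:
  "lin_ext (cut G) (shl u v) = cut (\<lambda>u1 u2. cut (\<lambda>v1 v2.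
     pscale ((- 1) ^ (length u2 * length v1)) (bilin_ext G (shl u1 v1) (shl u2 v2))) v) u"
proof (induction u v arbitrary: G rule: shl.induct)
  case (3 a u b v)
  let ?s = "(- 1) ^ length u"
  \<comment> \<open>In \<open>?A\<close> and \<open>?B\<close> the nonempty left factor takes
    letters from one word only; in \<open>?C\<close> and \<open>?D\<close> from both, and its
    shuffle starts with \<open>a\<close> or with \<open>b\<close>.\<close>
  let ?A = "\<lambda>u1 u2. bilin_ext G (word (a # u1)) (shl u2 (b # v))"
  let ?B = "\<lambda>v1 v2. pscale ((- 1) ^ (Suc (length u) * length v1))
    (bilin_ext G (word (b # v1)) (shl (a # u) v2))"
  let ?C = "\<lambda>u1 u2 v1 v2. pscale ((- 1) ^ (length u2 * Suc (length v1)))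
    (bilin_ext G (cons a (shl u1 (b # v1))) (shl u2 v2))"
  let ?D = "\<lambda>u1 u2 v1 v2. pscale ((- 1) ^ (length u2 * length v1))
    (bilin_ext G (cons b (shl (a # u1) v1)) (shl u2 v2))"
  have CD: "pscale ((- 1) ^ (length u2 * Suc (length v1)))
      (bilin_ext G (shl (a # u1) (b # v1)) (shl u2 v2)) =
      ?C u1 u2 v1 v2 - pscale ?s (?D u1 u2 v1 v2)"
    if "u1 @ u2 = u" for u1 u2 v1 v2
    using that by (auto simp: pscale_distribs minus_one_power_iff)
  have "lin_ext (cut G) (shl (a # u) (b # v)) = lin_ext (G []) (shl (a # u) (b # v))
     + lin_ext (cut (\<lambda>x. G (a # x))) (shl u (b # v))
     - pscale ?s (lin_ext (cut (\<lambda>x. G (b # x))) (shl (a # u) v))"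
    by (simp add: lin_ext_cut_cons pscale_distribs algebra_simps)
  also have "lin_ext (cut (\<lambda>x. G (a # x))) (shl u (b # v)) =
      cut ?A u + cut (\<lambda>u1 u2. cut (?C u1 u2) v) u"
    unfolding "3.IH"(1) by (simp add: cut_Cons cut_add bilin_ext_cons)
  also have "lin_ext (cut (\<lambda>x. G (b # x))) (shl (a # u) v) =
      cut ?B v + cut (\<lambda>u1 u2. cut (?D u1 u2) v) u"
    unfolding "3.IH"(2) by (simp add: cut_Cons cut_add bilin_ext_cons)
  also have "lin_ext (G []) (shl (a # u) (b # v)) +
      (cut ?A u + cut (\<lambda>u1 u2. cut (?C u1 u2) v) u) -
      pscale ?s (cut ?B v + cut (\<lambda>u1 u2. cut (?D u1 u2) v) u) =
      lin_ext (G []) (shl (a # u) (b # v)) + pscale (- ?s) (cut ?B v) + cut ?A u +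
      cut (\<lambda>u1 u2. cut (\<lambda>v1 v2. ?C u1 u2 v1 v2 - pscale ?s (?D u1 u2 v1 v2)) v) u"
    by (simp only: cut_diff cut_pscale pscale_minus_left pscale_add_right) (simp add: algebra_simps)
  also have "cut (\<lambda>u1 u2. cut (\<lambda>v1 v2. ?C u1 u2 v1 v2 - pscale ?s (?D u1 u2 v1 v2)) v) u =
      cut (\<lambda>u1 u2. cut (\<lambda>v1 v2. pscale ((- 1) ^ (length u2 * Suc (length v1)))
        (bilin_ext G (shl (a # u1) (b # v1)) (shl u2 v2))) v) u"
    by (intro cut_cong) (simp only: CD)
  also have "pscale (- ?s) (cut ?B v) = cut (\<lambda>v1 v2. pscale ((- 1) ^ (Suc (length u) * Suc (length v1)))
    (bilin_ext G (word (b # v1)) (shl (a # u) v2))) v"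
    unfolding cut_pscale[symmetric] pscale_pscale by (simp add: power_add algebra_simps)
  finally show ?case
    by (simp add: cut_Cons cut_add bilin_ext_def algebra_simps)
qed (simp_all add: bilin_ext_def)

section \<open>Convolution powers of the identity\<close>

lemma convolution_eq:
  "convolution f g = lin_ext (cut (\<lambda>u v. shp (f (word u)) (g (word v))))"
  by (simp add: convolution_def cut_def[abs_def] shuffle_product_eq)

lemma lin_conv_unit: "lin conv_unit"
  unfolding conv_unit_def by (rule lin_lin_ext_id)

lemma lin_conv_power: "lin (conv_power f n)"
  by (cases n) (auto simp: lin_conv_unit convolution_eq lin_lin_ext_id)

lemma conv_unit_word: "conv_unit (word w) = (if w = [] then word [] else 0)"
  by (simp add: conv_unit_def)

lemma conv_unit_cons: "conv_unit (cons a p) = 0"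
  by (rule lin_eqI[of "\<lambda>p. conv_unit (cons a p)"])
    (auto simp: conv_unit_def intro!: lin_intros)

lemma J_word: "J (word w) = (if w = [] then 0 else word w)"
  by (simp add: J_def conv_unit_word)

lemma conv_power_Suc_word:
  "conv_power f (Suc n) (word w) = cut (\<lambda>u v. shp (f (word u)) (conv_power f n (word v))) w"
  by (simp add: convolution_eq)

lemma mset_conv_power:
  assumes "\<And>u. supported (\<lambda>w. mset w = mset u) (f (word u))"
  shows "supported (\<lambda>w. mset w = mset v) (conv_power f n (word v))"
proof (induction n arbitrary: v)
  case 0
  show ?case by (auto simp: conv_unit_word intro: supported_zero supported_word)
next
  case (Suc n)
  show ?case
    unfolding conv_power_Suc_word
    by (intro supported_cut supported_bilin_ext[OF assms Suc])
      (auto intro!: supported_mono[OF mset_shl])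
qed

lemma mset_conv_power_J: "supported (\<lambda>w. mset w = mset v) (conv_power J n (word v))"
  by (rule mset_conv_power) (auto simp: J_word intro: supported_zero supported_word)

text \<open>The psi_n of the overview, known as Adams operations.\<close>

abbreviation adams :: "nat \<Rightarrow> ('k::comm_ring_1, 'v) words \<Rightarrow> ('k, 'v) words" where
  "adams \<equiv> conv_power (\<lambda>p. p)"

lemma length_adams: "supported (\<lambda>w. length w = length v) (adams n (word v))"
  by (rule supported_mono[OF mset_conv_power]) (auto intro: supported_word dest: mset_eq_length)

text \<open>Graded commutativity moves \<open>v1\<close> past \<open>A\<close> at the cost of the
  very sign that the coproduct of a shuffle produces, so the two signs cancel.\<close>

lemma shp_swap_middle:
  assumes "supported (\<lambda>w. length w = n) A"
  shows "pscale ((- 1) ^ (n * length v1)) (shp (shl u1 v1) (shp A B)) =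
    shp (shp (word u1) A) (shp (word v1) B)"
proof -
  have "shp (shl u1 v1) (shp A B) = shp (shp (word u1) (word v1)) (shp A B)"
    by simp
  also have "\<dots> = shp (word u1) (shp (shp (word v1) A) B)"
    unfolding shp_assoc ..
  also have "shp (word v1) A = pscale ((- 1) ^ (n * length v1)) (shp A (word v1))"
    by (rule shp_commute_word[OF assms])
  finally have "shp (shl u1 v1) (shp A B) =
      pscale ((- 1) ^ (n * length v1)) (shp (shp (word u1) A) (shp (word v1) B))"
    by (simp add: shp_assoc)
  then show ?thesis
    by (simp add: minus_one_power_iff)
qed

text \<open>Convolution products of algebra maps are algebra maps, since the coproduct is
  multiplicative (\<open>cut_shl\<close>) and the product is graded commutative
  (\<open>shp_swap_middle\<close>).\<close>

lemma adams_shl: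
  fixes u v :: "'v list"
  shows "(adams n (shl u v) :: ('k::comm_ring_1, 'v) words) =
    shp (adams n (word u)) (adams n (word v))"
proof (induction n arbitrary: u v)
  case 0
  show ?case
    by (cases "(u, v)" rule: shl.cases)
      (auto simp: conv_unit_word conv_unit_cons lin_distribs[OF lin_conv_unit])
next
  case (Suc n)
  let ?G = "\<lambda>u v. shp (word u) (adams n (word v))"
  have G: "bilin_ext ?G p q = shp p (adams n q)" for p q :: "('k, 'v) words"
    by (rule bilin_ext_eq[of "\<lambda>p q. shp p (adams n q)"])
      (auto intro!: lin_intros simp: lin_distribs[OF lin_conv_power] lin_def)
  have "(adams (Suc n) (shl u v) :: ('k, 'v) words) = cut (\<lambda>u1 u2. cut (\<lambda>v1 v2.
     pscale ((- 1) ^ (length u2 * length v1)) (shp (shl u1 v1) (adams n (shl u2 v2)))) v) u"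
    by (simp add: convolution_eq cut_shl G)
  also have "\<dots> = cut (\<lambda>u1 u2. cut (\<lambda>v1 v2. shp (?G u1 u2) (?G v1 v2)) v) u"
    by (simp add: Suc shp_swap_middle[OF length_adams])
  also have "\<dots> = shp (cut ?G u) (cut ?G v)"
    by (simp add: cut_lin[OF lin_bilin_ext_left[OF lin_id]] cut_lin[OF lin_bilin_ext_right[OF lin_id]])
  finally show ?case
    by (simp add: convolution_eq)
qed

lemma cut_conv_unit_left: "cut (\<lambda>u v. shp (conv_unit (word u)) (F v)) w = F w"
  by (cases w) (auto simp: cut_Cons conv_unit_word)

text \<open>Binomial theorem for id = \<open>conv_unit\<close> + \<open>J\<close>. Splitting off one
  factor, left neutrality of \<open>conv_unit\<close> and Pascal's rule give the induction.\<close>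

lemma adams_binomial:
  fixes w :: "'v list"
  shows "(adams n (word w) :: ('k::comm_ring_1, 'v) words) = (\<Sum>j\<le>n. pscale (of_nat (n choose j)) (conv_power J j (word w)))"
proof (induction n arbitrary: w)
  case 0
  show ?case by simp
next
  case (Suc n)
  let ?P = "\<lambda>j. conv_power J j (word w) :: ('k, 'v) words"
  have "(adams (Suc n) (word w) :: ('k, 'v) words) =
      cut (\<lambda>u v. shp (conv_unit (word u)) (adams n (word v)) + shp (J (word u)) (adams n (word v))) w"
    by (simp add: convolution_eq J_def)
  also have "\<dots> = adams n (word w) + cut (\<lambda>u v. shp (J (word u)) (adams n (word v))) w"
    by (simp add: cut_add cut_conv_unit_left)
  also have "(cut (\<lambda>u v. shp (J (word u)) (adams n (word v))) w :: ('k, 'v) words) =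
      (\<Sum>j\<le>n. pscale (of_nat (n choose j)) (?P (Suc j)))"
    unfolding Suc conv_power_Suc_word
    by (simp add: cut_def sum.swap[of _ "{..length w}"] pscale_sum_right)
  also have "(adams n (word w) :: ('k, 'v) words) = (\<Sum>j\<le>Suc n. pscale (of_nat (n choose j)) (?P j))"
    by (simp add: Suc binomial_eq_0)
  also have "\<dots> = ?P 0 + (\<Sum>j\<le>n. pscale (of_nat (n choose Suc j)) (?P (Suc j)))"
    by (simp add: sum.atMost_Suc_shift del: sum.atMost_Suc conv_power.simps(2))
  also have "\<dots> + (\<Sum>j\<le>n. pscale (of_nat (n choose j)) (?P (Suc j))) =
      ?P 0 + (\<Sum>j\<le>n. pscale (of_nat (Suc n choose Suc j)) (?P (Suc j)))"
    by (simp add: sum.distrib pscale_add_left add.assoc add.commute del: conv_power.simps(2))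
  also have "\<dots> = (\<Sum>j\<le>Suc n. pscale (of_nat (Suc n choose j)) (?P j))"
    by (simp add: sum.atMost_Suc_shift del: sum.atMost_Suc conv_power.simps(2) binomial_Suc_Suc)
  finally show ?case .
qed

text \<open>Each of the \<open>n\<close> factors \<open>J\<close> needs a nonempty piece of the
  word.\<close>

lemma conv_power_J_eq_0: "length w < n \<Longrightarrow> conv_power J n (word w :: ('k::comm_ring_1, 'v) words) = 0"
proof (induction n arbitrary: w)
  case (Suc n)
  have "(shp (J (word u)) (conv_power J n (word v)) :: ('k, 'v) words) = 0" if "u @ v = w" for u v
  proof (cases "u = []")
    case False
    then have "length v < n"
      using Suc.prems that by (cases u) auto
    then show ?thesis
      by (simp add: Suc.IH)
  qed (simp add: J_word)
  then have "cut (\<lambda>u v. shp (J (word u)) (conv_power J n (word v)) :: ('k, 'v) words) w =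
      cut (\<lambda>u v. 0) w"
    by (rule cut_cong)
  then show ?case
    unfolding conv_power_Suc_word by simp
qed simp

text \<open>A summation range independent of \<open>n\<close> exhibits the right-hand side as a
  polynomial in \<open>n\<close>.\<close>

lemma adams_binomial_bounded:
  assumes "length w \<le> N"
  shows "adams n (word w) = (\<Sum>j\<le>N. pscale (of_nat (n choose j)) (conv_power J j (word w)))"
proof -
  have "(\<Sum>j\<le>n. pscale (of_nat (n choose j)) (conv_power J j (word w))) =
      (\<Sum>j\<le>max n N. pscale (of_nat (n choose j)) (conv_power J j (word w)))"
    by (rule sum.mono_neutral_left) (auto, metis binomial_eq_0 not_le of_nat_0 pscale_zero_left)
  also have "\<dots> = (\<Sum>j\<le>N. pscale (of_nat (n choose j)) (conv_power J j (word w)))"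
    by (rule sum.mono_neutral_right)
      (use assms in \<open>auto, metis conv_power_J_eq_0 not_le order_le_less_trans pscale_zero_right\<close>)
  finally show ?thesis
    by (simp add: adams_binomial)
qed

section \<open>The logarithm\<close>

text \<open>The bound \<open>N\<close> may exceed the actual lengths, so that several arguments can
  share one finite sum.\<close>

lemma eulerian_eq:
  assumes "supported (\<lambda>w. length w \<le> N) p"
  shows "eulerian p = (\<Sum>n<N. pscale ((- 1) ^ n / of_nat (Suc n)) (conv_power J (Suc n) p))"
  unfolding eulerian_def
proof (rule Sum_any.expand_superset)
  have zero: "conv_power J (Suc n) p = 0" if "\<not> n < N" for n
    by (rule lin_eq_on_supported[OF assms lin_conv_power lin_const_zero])
      (use that in \<open>simp add: conv_power_J_eq_0 del: conv_power.simps\<close>)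
  then show "{n. pscale ((- 1) ^ n / of_nat (Suc n)) (conv_power J (Suc n) p) \<noteq> 0} \<subseteq> {..<N}"
    using zero by (metis (mono_tags, lifting) lessThan_iff mem_Collect_eq pscale_zero_right subsetI)
qed simp

lemma supported_length_bound: "\<exists>N. supported (\<lambda>w. length w \<le> N) p"
  by (rule exI[of _ "Max (length ` Poly_Mapping.keys p)"]) (auto simp: supported_def)

lemma lin_eulerian: "lin (eulerian :: ('k::field_char_0, 'v) words \<Rightarrow> _)"
  unfolding lin_def
proof safe
  fix p q :: "('k, 'v) words" and c :: 'k
  obtain M where M: "supported (\<lambda>w. length w \<le> M) p"
    using supported_length_bound by blast
  obtain N where N: "supported (\<lambda>w. length w \<le> N) q"
    using supported_length_bound by blast
  have pq: "supported (\<lambda>w. length w \<le> M + N) p" "supported (\<lambda>w. length w \<le> M + N) q"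
    by (rule supported_mono[OF M] supported_mono[OF N]; simp)+
  show "eulerian (p + q) = eulerian p + eulerian q"
    unfolding eulerian_eq[OF pq(1)] eulerian_eq[OF pq(2)] eulerian_eq[OF supported_add[OF pq]]
    by (simp add: lin_plus[OF lin_conv_power] pscale_distribs sum.distrib del: conv_power.simps)
  show "eulerian (pscale c p) = pscale c (eulerian p)"
    unfolding eulerian_eq[OF pq(1)] eulerian_eq[OF supported_pscale[OF pq(1)]]
    by (simp add: lin_scale[OF lin_conv_power] pscale_distribs ac_simps del: conv_power.simps)
qed

lemma mset_eulerian: "supported (\<lambda>w. mset w = mset v) (eulerian (word v))"
  unfolding eulerian_eq[OF supported_word[of "\<lambda>w. length w \<le> length v", OF order.refl]]
  by (intro supported_intros mset_conv_power_J)

lemma eulerian_Nil: "eulerian (word []) = 0"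
  using eulerian_eq[of 0 "word []"] by (simp add: supported_word)

section \<open>Binomial coefficients as polynomials, so that coefficients can be compared\<close>

fun binomial_poly :: "nat \<Rightarrow> 'k::field_char_0 poly" where
  "binomial_poly 0 = 1"
| "binomial_poly (Suc n) = smult (1 / of_nat (Suc n)) (binomial_poly n * [:- of_nat n, 1:])"

lemma poly_binomial_poly: "poly (binomial_poly n) x = x gchoose n"
proof (induction n)
  case (Suc n)
  have "(x gchoose n) * (x - of_nat n) = of_nat (Suc n) * (x gchoose Suc n)"
    using gbinomial_mult_1[of x n] by (simp add: algebra_simps)
  with Suc show ?case
    by (simp add: algebra_simps del: of_nat_Suc)
qed simp

lemma coeff_binomial_poly_0: "coeff (binomial_poly (Suc n)) 0 = 0"
  by (simp add: poly_0_coeff_0[symmetric] poly_binomial_poly gbinomial_prod_rev prod.atLeast0_lessThan_Suc_shift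
      del: binomial_poly.simps prod.op_ivl_Suc)

text \<open>These are the coefficients of the logarithm series, so \<open>eulerian\<close> is the
  part of psi_k that is linear in k.\<close>

lemma coeff_binomial_poly_1: "coeff (binomial_poly (Suc n)) 1 = (- 1) ^ n / of_nat (Suc n)"
proof (induction n)
  case (Suc n)
  have "coeff (binomial_poly (Suc (Suc n)) :: 'a poly) 1 =
      (coeff (binomial_poly (Suc n)) 0 - of_nat (Suc n) * coeff (binomial_poly (Suc n)) 1)
        / of_nat (Suc (Suc n))"
    by (subst binomial_poly.simps(2)) (simp del: binomial_poly.simps of_nat_Suc)
  also have "\<dots> = (- 1) ^ Suc n / of_nat (Suc (Suc n))"
    unfolding Suc coeff_binomial_poly_0 by (simp add: field_simps del: of_nat_Suc)
  finally show ?case .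
qed (simp add: coeff_mult)

lemma poly_eqI_of_nat:
  fixes P Q :: "'k::field_char_0 poly"
  assumes "\<And>n. poly P (of_nat n) = poly Q (of_nat n)"
  shows "P = Q"
proof (rule ccontr)
  assume "P \<noteq> Q"
  then have "finite {x. poly (P - Q) x = 0}"
    by (intro poly_roots_finite) simp
  moreover have "range (of_nat :: nat \<Rightarrow> 'k) \<subseteq> {x. poly (P - Q) x = 0}"
    using assms by auto
  ultimately have "finite (range (of_nat :: nat \<Rightarrow> 'k))"
    by (rule finite_subset[rotated])
  then show False
    using finite_imageD[OF _ inj_of_nat] by auto
qed

text \<open>Both sides of \<open>adams k (u \<cdot> v) = adams k u \<cdot> adams k v\<close> are polynomial in \<open>k\<close>. The linear
  coefficient of the left-hand side is \<open>eulerian (u \<cdot> v)\<close>, and the right-hand side is divisible by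
  the square of \<open>k\<close>.\<close>

lemma eulerian_shl:
  fixes u v :: "'v list"
  assumes "u \<noteq> []" "v \<noteq> []"
  shows "eulerian (shl u v :: ('k::field_char_0, 'v) words) = 0"
proof (rule poly_mapping_eqI)
  fix x
  define N where "N = length u + length v"
  have z: "supported (\<lambda>w. length w \<le> N) (shl u v :: ('k, 'v) words)"
    by (rule supported_mono[OF length_shl]) (simp add: N_def)
  \<comment> \<open>Taking the coordinate at a fixed word \<open>x\<close> turns both sides into
    scalar polynomials.\<close>
  define c :: "nat \<Rightarrow> 'k" where "c j = Poly_Mapping.lookup (conv_power J j (shl u v)) x" for j
  define d :: "nat \<Rightarrow> nat \<Rightarrow> 'k" where
    "d i j = Poly_Mapping.lookup (shp (conv_power J i (word u)) (conv_power J j (word v))) x" for i j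
  define P where "P = (\<Sum>j\<le>N. smult (c j) (binomial_poly j))"
  define Q where "Q = (\<Sum>i\<le>N. \<Sum>j\<le>N. smult (d i j) (binomial_poly i * binomial_poly j))"
  have "poly P (of_nat n) = poly Q (of_nat n)" for n
  proof -
    have "adams n (shl u v) = (\<Sum>j\<le>N. pscale (of_nat (n choose j)) (conv_power J j (shl u v)) :: ('k, 'v) words)"
      by (rule lin_eq_on_supported[OF z lin_conv_power])
        (auto intro!: lin_intros lin_conv_power simp: adams_binomial_bounded)
    then have "poly P (of_nat n) = Poly_Mapping.lookup (adams n (shl u v)) x"
      by (simp add: P_def poly_sum poly_binomial_poly lookup_sum c_def binomial_gbinomial ac_simps)
    also have "adams n (shl u v) = shp (adams n (word u)) (adams n (word v))"
      by (rule adams_shl)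
    also have "Poly_Mapping.lookup \<dots> x = (\<Sum>i\<le>N. \<Sum>j\<le>N. of_nat (n choose i) * of_nat (n choose j) * d i j)"
      by (simp add: adams_binomial_bounded[of _ N] N_def lookup_sum d_def ac_simps sum_distrib_left)
        (subst sum.swap, simp add: mult.left_commute)
    also have "\<dots> = poly Q (of_nat n)"
      by (simp add: Q_def poly_sum poly_binomial_poly binomial_gbinomial ac_simps)
    finally show ?thesis .
  qed
  then have "coeff P 1 = coeff Q 1"
    by (metis poly_eqI_of_nat)
  moreover have "coeff Q 1 = 0"
  proof -
    have "coeff (smult (d i j) (binomial_poly i * binomial_poly j)) 1 = 0" for i j
    \<comment> \<open>The power \<open>J\<close>^0 kills the nonempty words \<open>u\<close> and
      \<open>v\<close>. For positive \<open>i\<close> and \<open>j\<close> both polynomials lack a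
      constant term, so their product has no linear term.\<close>
    proof (cases "i = 0 \<or> j = 0")
      case True
      then show ?thesis
        using assms by (auto simp: d_def conv_unit_word)
    next
      case False
      then obtain i' j' where "i = Suc i'" "j = Suc j'"
        by (metis not0_implies_Suc)
      then show ?thesis
        by (simp add: coeff_mult coeff_binomial_poly_0 del: binomial_poly.simps)
    qed
    then show ?thesis
      by (simp add: Q_def coeff_sum del: coeff_smult)
  qed
  moreover have "coeff P 1 = Poly_Mapping.lookup (eulerian (shl u v) :: ('k, 'v) words) x"
  proof -
    have "0 < N"
      using assms by (simp add: N_def)
    then obtain M where M: "N = Suc M"
      by (cases N) auto
    \<comment> \<open>The summand for j = 0 is a constant polynomial; dropping it shifts the index
      to that of \<open>eulerian\<close>.\<close>
    have "coeff P 1 = (\<Sum>j\<le>M. c (Suc j) * coeff (binomial_poly (Suc j)) 1)"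
      by (simp add: P_def coeff_sum M sum.atMost_Suc_shift del: sum.atMost_Suc binomial_poly.simps(2))
    also have "\<dots> = Poly_Mapping.lookup (eulerian (shl u v) :: ('k, 'v) words) x"
      unfolding eulerian_eq[OF z] M lessThan_Suc_atMost coeff_binomial_poly_1
      by (simp add: lookup_sum c_def ac_simps del: of_nat_Suc conv_power.simps)
    finally show ?thesis .
  qed
  ultimately show "Poly_Mapping.lookup (eulerian (shl u v) :: ('k, 'v) words) x = Poly_Mapping.lookup 0 x"
    by simp
qed

text \<open>The logarithm starts with \<open>J\<close>, the identity on nonempty words. All higher
  powers of \<open>J\<close> are sums of products of two nonempty pieces.\<close>

lemma eulerian_decomposable:
  fixes w :: "'a list"
  assumes "w \<noteq> []"
  shows "word w - eulerian (word w :: ('k::field_char_0, 'a) words) \<in>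
    lin_span word_space {shl u v | u v. u \<noteq> [] \<and> v \<noteq> []}" (is "_ \<in> lin_span _ ?B")
proof -
  let ?D = "lin_span (word_space :: ('k, ('k, 'a) words) lin_space) ?B"
  have add: "p + q \<in> ?D" if "p \<in> ?D" "q \<in> ?D" for p q
    using lin_span.add[OF that] by (simp add: word_space_def)
  have scale: "pscale c p \<in> ?D" if "p \<in> ?D" for c p
    using lin_span.scale[OF that, of c] by (simp add: word_space_def)
  have zero: "0 \<in> ?D"
    using lin_span.zero[of word_space ?B] by (simp add: word_space_def)
  have sum: "(\<Sum>i\<in>I. f i) \<in> ?D" if "\<And>i. i \<in> I \<Longrightarrow> f i \<in> ?D" for I :: "'i set" and f
    using that by (induction I rule: infinite_finite_induct) (auto intro: add zero)
  have shp: "shp (word u) p \<in> ?D" if "u \<noteq> []" "supported (\<lambda>w. w \<noteq> []) p" for u p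
  proof -
    have "shp (word u) p = (\<Sum>v\<in>Poly_Mapping.keys p. pscale (Poly_Mapping.lookup p v) (shl u v))"
      by (subst sum_keys_word) simp
    also have "\<dots> \<in> ?D"
      using that by (intro sum scale lin_span.base) (force simp: supported_def)
    finally show ?thesis .
  qed
  have power: "conv_power J (Suc (Suc n)) (word w) \<in> ?D" for n
  proof -
    have "supported (\<lambda>w. w \<noteq> []) (conv_power J (Suc n) (word v))" for v :: "'a list"
    proof (cases "v = []")
      case True
      then show ?thesis by (simp add: conv_power_J_eq_0 supported_zero del: conv_power.simps)
    next
      case False
      then show ?thesis
        by (intro supported_mono[OF mset_conv_power_J]) auto
    qed
    then show ?thesis
      unfolding conv_power_Suc_word[of _ "Suc n"] cut_def
      by (intro sum) (auto simp: J_word zero intro!: shp simp del: conv_power.simps)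
  qed
  \<comment> \<open>A bound of the form \<open>Suc\<close> lets the leading term \<open>J\<close>
    split off the sum.\<close>
  have "supported (\<lambda>v. length v \<le> Suc (length w)) (word w)"
    by (simp add: supported_word)
  from eulerian_eq[OF this] have "eulerian (word w :: ('k, 'a) words) =
      conv_power J 1 (word w) + (\<Sum>n<length w. pscale ((- 1) ^ Suc n / of_nat (Suc (Suc n)))
        (conv_power J (Suc (Suc n)) (word w)))"
    by (simp add: sum.lessThan_Suc_shift of_nat_1[unfolded One_nat_def] del: sum.lessThan_Suc conv_power.simps of_nat_Suc)
  also have "conv_power J 1 (word w) = (word w :: ('k, 'a) words)"
  proof -
    \<comment> \<open>Right neutrality of the convolution unit.\<close>
    have "cut (\<lambda>u v. shp (F u) (conv_unit (word v))) w = F w" for F :: "'a list \<Rightarrow> ('k, 'a) words"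
    proof (induction w arbitrary: F)
      case (Cons x w)
      then show ?case by (simp add: cut_Cons conv_unit_word)
    qed (simp add: conv_unit_word)
    then have "conv_power J 1 (word w) = (J (word w) :: ('k, 'a) words)"
      by (simp add: convolution_eq)
    with assms show ?thesis
      by (simp add: J_word)
  qed
  finally have "word w - eulerian (word w :: ('k, 'a) words) =
      (\<Sum>n<length w. pscale (- ((- 1) ^ Suc n / of_nat (Suc (Suc n))))
        (conv_power J (Suc (Suc n)) (word w)))"
    by (simp add: sum_negf del: conv_power.simps of_nat_Suc power_Suc)
  also have "\<dots> \<in> ?D"
    by (intro sum scale power)
  finally show ?thesis .
qed

section \<open>The eulerian element\<close>

text \<open>The logarithm is natural in the letters and in the field of coefficients, so it is determined by
  its values on the words \<open>[0, \<dots>, n - 1]\<close> over the rationals.\<close>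

definition transport :: "('v \<Rightarrow> 'w) \<Rightarrow> (rat, 'v) words \<Rightarrow> ('k::field_char_0, 'w) words" where
  "transport f p = (\<Sum>w\<in>Poly_Mapping.keys p. pscale (of_rat (Poly_Mapping.lookup p w)) (word (map f w)))"

lemma transport_add [simp]: "transport f (p + q) = transport f p + transport f q"
  unfolding transport_def
  by (rule sum_keys_add[of "\<lambda>c w. pscale (of_rat c) (word (map f w))"])
    (simp add: of_rat_add pscale_add_left)

lemma transport_pscale [simp]: "transport f (pscale c p) = pscale (of_rat c) (transport f p)"
proof -
  have "transport f (pscale c p) = (\<Sum>w\<in>Poly_Mapping.keys p.
      pscale (of_rat (Poly_Mapping.lookup (pscale c p) w)) (word (map f w)))"
    unfolding transport_def
    by (rule sum_keys_superset[of "\<lambda>c w. pscale (of_rat c) (word (map f w))"])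
      (auto dest: keys_pscale[THEN subsetD])
  then show ?thesis
    by (simp add: transport_def pscale_sum_right of_rat_mult)
qed

lemma transport_zero [simp]: "transport f 0 = 0"
  by (simp add: transport_def)

lemma transport_minus [simp]: "transport f (- p) = - transport f p"
  using transport_pscale[of f "- 1" p] by simp

lemma transport_diff [simp]: "transport f (p - q) = transport f p - transport f q"
  using transport_add[of f p "- q"] by simp

lemma transport_sum [simp]: "transport f (\<Sum>i\<in>I. p i) = (\<Sum>i\<in>I. transport f (p i))"
  by (induction I rule: infinite_finite_induct) auto

lemma transport_word [simp]: "transport f (word w) = word (map f w)"
  by (simp add: transport_def)

lemma transport_lin_ext:
  assumes "\<And>w. transport f (g w) = g' (map f w)"
  shows "transport f (lin_ext g p) = lin_ext g' (transport f p)"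
  by (subst (1 2) sum_keys_word) (simp add: assms)

lemma transport_bilin_ext:
  assumes "\<And>u v. transport f (g u v) = g' (map f u) (map f v)"
  shows "transport f (bilin_ext g p q) = bilin_ext g' (transport f p) (transport f q)"
  unfolding bilin_ext_def by (intro transport_lin_ext assms)

lemma transport_shl:
  "transport f (shl u v) = (shl (map f u) (map f v) :: ('k::field_char_0, 'w) words)"
proof (induction u v rule: shl.induct)
  case (3 a u b v)
  have "transport f (cons x p) = cons (f x) (transport f p :: ('k, 'w) words)" for x p
    by (rule transport_lin_ext) simp
  with 3 show ?case by (simp add: of_rat_power)
qed simp_all

lemma transport_shp: "transport f (shp p q) = shp (transport f p) (transport f q)"
  by (rule transport_bilin_ext) (rule transport_shl)

lemma transport_conv_unit: "transport f (conv_unit p) = conv_unit (transport f p)"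
  unfolding conv_unit_def by (rule transport_lin_ext) simp

lemma transport_J: "transport f (J p) = J (transport f p)"
  by (simp add: J_def transport_conv_unit)

lemma cut_map: "cut G (map f w) = cut (\<lambda>u v. G (map f u) (map f v)) w"
  by (simp add: cut_def take_map drop_map)

lemma transport_conv_power:
  "transport f (conv_power J n p) = (conv_power J n (transport f p) :: ('k::field_char_0, 'w) words)"
proof (induction n arbitrary: p)
  case 0
  show ?case by (simp add: transport_conv_unit)
next
  case (Suc n)
  have "transport f (cut (\<lambda>u v. shp (J (word u)) (conv_power J n (word v))) w) =
      (cut (\<lambda>u v. shp (J (word u)) (conv_power J n (word v))) (map f w) :: ('k, 'w) words)" for w
    unfolding cut_map by (simp add: cut_def transport_shp transport_J Suc)
  then show ?case
    unfolding conv_power.simps convolution_eq by (rule transport_lin_ext)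
qed

lemma transport_eulerian:
  fixes w :: "'v list"
  shows  "transport f (eulerian (word w)) = (eulerian (word (map f w)) :: ('k::field_char_0, 'w) words)"
proof -
  have "supported (\<lambda>v. length v \<le> length w) (word w :: (rat, 'v) words)"
    "supported (\<lambda>v. length v \<le> length w) (word (map f w) :: ('k, 'w) words)"
    by (simp_all add: supported_word)
  then show ?thesis
    by (simp add: eulerian_eq transport_conv_power of_rat_power of_rat_divide
        del: conv_power.simps of_nat_Suc)
qed

lemma act_upt: "\<sigma> permutes {..<n} \<Longrightarrow> act \<sigma> [0..<n] = map (inv \<sigma>) [0..<n]"
  using permutes_in_image[OF permutes_inv, of \<sigma> "{..<n}"]
  by (auto simp: act_def permute_list_def)

lemma act_upt_inj: "inj_on (\<lambda>\<sigma>. act \<sigma> [0..<n]) {\<sigma>. \<sigma> permutes {..<n}}"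
proof (rule inj_onI, clarify)
  fix \<sigma> \<tau> assume *: "\<sigma> permutes {..<n}" "\<tau> permutes {..<n}" "act \<sigma> [0..<n] = act \<tau> [0..<n]"
  have "inv \<sigma> i = inv \<tau> i" for i
  proof (cases "i < n")
    case True
    then show ?thesis using * by (simp add: act_upt)
  next
    case False
    then show ?thesis
      using permutes_not_in[OF permutes_inv[OF *(1)], of i] permutes_not_in[OF permutes_inv[OF *(2)], of i]
      by simp
  qed
  then have "inv (inv \<sigma>) = inv (inv \<tau>)"
    by presburger
  then show "\<sigma> = \<tau>"
    using * by (simp add: permutes_inv_inv)
qed

text \<open>The letters of \<open>[0..<n]\<close> are distinct, so a coefficient of the free
  expansion belongs to a single permutation. \<open>represents_eulerian\<close> demands the value 0
  off the permutations.\<close>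

definition log_coeff :: "nat \<Rightarrow> (nat \<Rightarrow> nat) \<Rightarrow> rat" where
  "log_coeff n \<sigma> = (if \<sigma> permutes {..<n}
     then Poly_Mapping.lookup (eulerian (word [0..<n])) (act \<sigma> [0..<n]) else 0)"

text \<open>The word \<open>w\<close> is the image of \<open>[0..<length w]\<close> under indexing,
  so naturality reduces to that word, whose logarithm is supported on its rearrangements.\<close>

lemma eulerian_log_coeff:
  fixes w :: "'v list"
  shows "(eulerian (word w) :: ('k::field_char_0, 'v) words) =
    (\<Sum>\<sigma> | \<sigma> permutes {..<length w}. pscale (of_rat (log_coeff (length w) \<sigma>)) (word (act \<sigma> w)))"
proof -
  define n where "n = length w"
  define E :: "(rat, nat) words" where "E = eulerian (word [0..<n])"
  let ?A = "\<lambda>\<sigma>. act \<sigma> [0..<n]"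
  let ?S = "{\<sigma>. \<sigma> permutes {..<n}}"
  have keys: "Poly_Mapping.keys E \<subseteq> ?A ` ?S"
  proof
    fix s assume "s \<in> Poly_Mapping.keys E"
    then have "mset s = mset [0..<n]"
      using mset_eulerian[of "[0..<n]"] by (auto simp: supported_def E_def)
    then obtain \<tau> where \<tau>: "\<tau> permutes {..<n}" "permute_list \<tau> [0..<n] = s"
      using mset_eq_permutation[of s "[0..<n]"] by auto
    then have "s = ?A (inv \<tau>)"
      by (simp add: act_def permutes_inv_inv)
    with \<tau>(1) show "s \<in> ?A ` ?S"
      using permutes_inv by blast
  qed
  have nth: "map ((!) w) (?A \<sigma>) = act \<sigma> w" if "\<sigma> \<in> ?S" for \<sigma>
    using that act_map[of \<sigma> "[0..<n]" "(!) w"] by (simp add: n_def map_nth)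
  have "(eulerian (word w) :: ('k, 'v) words) = eulerian (word (map ((!) w) [0..<n]))"
    by (simp add: n_def map_nth)
  also have "\<dots> = transport ((!) w) E"
    by (simp add: transport_eulerian E_def)
  also have "\<dots> = (\<Sum>s\<in>?A ` ?S. pscale (of_rat (Poly_Mapping.lookup E s)) (word (map ((!) w) s)))"
    unfolding transport_def
    by (rule sum.mono_neutral_left) (use keys finite_permutations in \<open>auto simp: in_keys_iff\<close>)
  also have "\<dots> = (\<Sum>\<sigma>\<in>?S. pscale (of_rat (Poly_Mapping.lookup E (?A \<sigma>))) (word (map ((!) w) (?A \<sigma>))))"
    by (subst sum.reindex[OF act_upt_inj]) simp
  also have "\<dots> = (\<Sum>\<sigma>\<in>?S. pscale (of_rat (log_coeff n \<sigma>)) (word (act \<sigma> w)))"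
    by (rule sum.cong) (simp_all add: nth[simplified] log_coeff_def E_def)
  finally show ?thesis
    by (simp add: n_def)
qed

text \<open>The dual basis of a tensor power: on x_1 ... x_n it is the product of the coordinates of
  x_i at t_i. The value 0 for unequal lengths extends it to all words.\<close>

fun multi_coord :: "'x list \<Rightarrow> ('x \<Rightarrow>\<^sub>0 'k::comm_ring_1) list \<Rightarrow> 'k" where
  "multi_coord [] [] = 1"
| "multi_coord (t # ts) (x # xs) = Poly_Mapping.lookup x t * multi_coord ts xs"
| "multi_coord _ _ = 0"

lemma multi_coord_add:
  "multi_coord ts (u @ (x + y) # v) = multi_coord ts (u @ x # v) + multi_coord ts (u @ y # v)"
  by (induction ts "u @ x # v" arbitrary: u rule: multi_coord.induct)
    (auto simp: Cons_eq_append_conv append_eq_Cons_conv lookup_add algebra_simps)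

lemma multi_coord_pscale:
  "multi_coord ts (u @ pscale c x # v) = c * multi_coord ts (u @ x # v)"
  by (induction ts "u @ x # v" arbitrary: u rule: multi_coord.induct)
    (auto simp: Cons_eq_append_conv append_eq_Cons_conv algebra_simps)

lemma multi_coord_single:
  "multi_coord ts (map (\<lambda>i. Poly_Mapping.single i 1) js) = (if ts = js then 1 else 0)"
  by (induction ts js rule: list_induct2') (auto simp: lookup_single when_def)

lemma lin_span_induct_lin:
  assumes "p \<in> lin_span word_space B" "lin f" "\<And>b. b \<in> B \<Longrightarrow> f b = 0"
  shows "f p = 0"
  using assms by (induction) (auto simp: word_space_def lin_distribs)

lemma tensor_class_eqD:
  assumes "tensor_class scale p = tensor_class scale q"
  shows "p - q \<in> tensor_relations scale"
proof -
  let ?R = "tensor_relations scale"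
  have "0 \<in> ?R"
    unfolding tensor_relations_def using lin_span.zero[of word_space] by (simp add: word_space_def)
  then have "p \<in> tensor_class scale p"
    by (auto simp: tensor_class_def coset_def word_space_def intro: exI[of _ 0])
  with assms have "p \<in> tensor_class scale q"
    by simp
  then obtain s where "s \<in> ?R" "p = q + s"
    by (auto simp: tensor_class_def coset_def word_space_def)
  then show ?thesis by simp
qed

text \<open>Holds for any \<open>scale\<close>, because \<open>eulerian_log_coeff\<close> is an
  equality of words before any tensor relation is imposed.\<close>

lemma represents_eulerian_log_coeff:
  "represents_eulerian (scale :: 'k::field_char_0 \<Rightarrow> 'v::ab_group_add \<Rightarrow> 'v) n (log_coeff n)"
  unfolding represents_eulerian_def
proof (intro conjI allI impI)
  show "\<sigma> permutes {..<n}" if "log_coeff n \<sigma> \<noteq> 0" for \<sigma>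
    using that by (simp add: log_coeff_def split: if_splits)
  show "tensor_class scale (eulerian (word w)) = tensor_class scale
      (\<Sum>\<sigma> | \<sigma> permutes {..<n}. pscale (of_rat (log_coeff n \<sigma>)) (word (act \<sigma> w)))"
    if "length w = n" for w :: "'v list"
    using that by (subst eulerian_log_coeff) simp
qed

text \<open>On a word of distinct basis vectors the coefficients are read off by the multilinear coordinate
  functionals, which vanish on the tensor relations.\<close>

lemma represents_eulerian_unique:
  assumes c: "represents_eulerian (pscale :: 'k::field_char_0 \<Rightarrow> (nat \<Rightarrow>\<^sub>0 'k) \<Rightarrow> (nat \<Rightarrow>\<^sub>0 'k)) n c"
  shows "c = log_coeff n"
proof
  fix \<tau>
  let ?s = "pscale :: 'k \<Rightarrow> (nat \<Rightarrow>\<^sub>0 'k) \<Rightarrow> (nat \<Rightarrow>\<^sub>0 'k)"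
  let ?S = "{\<sigma>. \<sigma> permutes {..<n}}"
  define basis :: "nat list \<Rightarrow> (nat \<Rightarrow>\<^sub>0 'k) list" where "basis = map (\<lambda>i. Poly_Mapping.single i (1 :: 'k))"
  show "c \<tau> = log_coeff n \<tau>"
  proof (cases "\<tau> permutes {..<n}")
    case False
    then show ?thesis
      using c represents_eulerian_log_coeff[of ?s n] unfolding represents_eulerian_def by metis
  next
    case True
    \<comment> \<open>A scalar functional, with values in the free space on one point so that
      \<open>lin\<close> applies to it.\<close>
    define F :: "('k, nat \<Rightarrow>\<^sub>0 'k) words \<Rightarrow> (unit \<Rightarrow>\<^sub>0 'k)" where
      "F = lin_ext (\<lambda>w. Poly_Mapping.single () (multi_coord (act \<tau> [0..<n]) w))"
    have F: "lin F" unfolding F_def by (rule lin_lin_ext_id)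
    have F_rel: "F p = 0" if "p \<in> tensor_relations ?s" for p
      by (rule lin_span_induct_lin[OF that[unfolded tensor_relations_def] F])
        (auto simp: lin_distribs[OF F], auto simp: F_def multi_coord_add multi_coord_pscale
          single_add pscale_single)
    have F_basis: "F (\<Sum>\<sigma>\<in>?S. pscale (of_rat (d \<sigma>)) (word (act \<sigma> (basis [0..<n])))) =
        Poly_Mapping.single () (of_rat (d \<tau>))" for d
    proof -
      have "F (word (act \<sigma> (basis [0..<n]))) = Poly_Mapping.single () (if \<sigma> = \<tau> then 1 else 0)"
        if "\<sigma> \<in> ?S" for \<sigma>
      proof -
        have "act \<sigma> (basis [0..<n]) = basis (act \<sigma> [0..<n])"
          unfolding basis_def using that by (intro act_map) simp
        moreover have "act \<tau> [0..<n] = act \<sigma> [0..<n] \<longleftrightarrow> \<sigma> = \<tau>"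
          using act_upt_inj[of n] that True by (auto dest: inj_onD)
        ultimately show ?thesis
          by (simp add: F_def basis_def multi_coord_single)
      qed
      then have "F (\<Sum>\<sigma>\<in>?S. pscale (of_rat (d \<sigma>)) (word (act \<sigma> (basis [0..<n])))) =
          (\<Sum>\<sigma>\<in>?S. if \<sigma> = \<tau> then Poly_Mapping.single () (of_rat (d \<sigma>)) else 0)"
        unfolding lin_sum[OF F] lin_scale[OF F] by (intro sum.cong) (auto simp: pscale_single)
      also have "\<dots> = Poly_Mapping.single () (of_rat (d \<tau>))"
        using True finite_permutations[of "{..<n}"] by (simp add: sum.delta)
      finally show ?thesis .
    qed
    have "length (basis [0..<n]) = n"
      by (simp add: basis_def)
    then have "tensor_class ?s (eulerian (word (basis [0..<n]))) =
        tensor_class ?s (\<Sum>\<sigma>\<in>?S. pscale (of_rat (d \<sigma>)) (word (act \<sigma> (basis [0..<n]))))"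
      if "represents_eulerian ?s n d" for d
      using that by (simp add: represents_eulerian_def)
    from this[OF c] this[OF represents_eulerian_log_coeff]
    have "tensor_class ?s (\<Sum>\<sigma>\<in>?S. pscale (of_rat (c \<sigma>)) (word (act \<sigma> (basis [0..<n])))) =
      tensor_class ?s (\<Sum>\<sigma>\<in>?S. pscale (of_rat (log_coeff n \<sigma>)) (word (act \<sigma> (basis [0..<n]))))"
      by simp
    from F_rel[OF tensor_class_eqD[OF this]]
    have "Poly_Mapping.single () (of_rat (c \<tau>) :: 'k) = Poly_Mapping.single () (of_rat (log_coeff n \<tau>))"
      by (simp add: lin_diff[OF F] F_basis)
    from arg_cong[OF this, of "\<lambda>p. Poly_Mapping.lookup p ()"] show ?thesis
      by simp
  qed
qed

lemma eulerian_element_eq: "eulerian_element TYPE('k::field_char_0) n = log_coeff n"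
  unfolding eulerian_element_def
  by (rule the_equality) (rule represents_eulerian_log_coeff, rule represents_eulerian_unique)

text \<open>This eliminates \<open>eulerian_element\<close>: on chains e1 is the logarithm of the
  tail, with the coefficient inert.\<close>

lemma word_e1_word:
  "word_e1 (word (a # w) :: ('k::field_char_0, 'a) words) = cons a (eulerian (word w))"
  unfolding word_e1_def lin_ext_word eulerian_element_eq
  by (subst eulerian_log_coeff) (simp add: act_chain_def Let_def)

lemma lin_word_e1: "lin word_e1"
  unfolding word_e1_def by (rule lin_lin_ext_id)

lemma word_e1_cons: "word_e1 (cons a p) = cons a (eulerian p)"
  by (rule lin_eqI[of "\<lambda>p. word_e1 (cons a p)"])
    (auto simp: word_e1_word intro!: lin_intros simp: lin_def lin_distribs[OF lin_word_e1] lin_distribs[OF lin_eulerian])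

section \<open>The Hochschild boundary\<close>

fun mul_hd :: "'a::comm_ring \<Rightarrow> 'a list \<Rightarrow> ('k::comm_ring_1, 'a) words" where
  "mul_hd a [] = 0"
| "mul_hd a (x # w) = word (a * x # w)"

text \<open>The differential of the bar construction, made of the faces that multiply neighbouring
  letters.\<close>

fun bar :: "'a::comm_ring list \<Rightarrow> ('k::comm_ring_1, 'a) words" where
  "bar [] = 0"
| "bar (a # w) = mul_hd a w - cons a (bar w)"

text \<open>The last Hochschild face, up to sign. By commutativity the coefficient is written on the
  left.\<close>

definition wrap :: "'a::comm_ring \<Rightarrow> 'a list \<Rightarrow> ('k::comm_ring_1, 'a) words" where
  "wrap a w = (if w = [] then 0 else word (a * last w # butlast w))"

text \<open>The sum of the two faces of \<open>(a, w)\<close> that involve the coefficient \<open>a\<close>.\<close>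

definition outer :: "'a::comm_ring \<Rightarrow> 'a list \<Rightarrow> ('k::comm_ring_1, 'a) words" where
  "outer a w = mul_hd a w + pscale ((- 1) ^ length w) (wrap a w)"

lemma bar_eq_sum:
  fixes w :: "'a::comm_ring list"
  shows "(bar w :: ('k::comm_ring_1, 'a) words) = (\<Sum>i<length w - 1. pscale ((- 1) ^ i)
     (word (take i w @ (w ! i * w ! Suc i) # drop (i + 2) w)))"
proof (induction w)
  case (Cons a w)
  show ?case
  proof (cases w)
    case Nil
    then show ?thesis by simp
  next
    case (Cons x r)
    have "(bar (a # w) :: ('k, 'a) words) = word (a * x # r) - cons a (bar w)"
      by (simp add: Cons)
    also have "\<dots> = (\<Sum>i<Suc (length r). pscale ((- 1) ^ i)
      (word (take i (a # w) @ ((a # w) ! i * (a # w) ! Suc i) # drop (i + 2) (a # w))))"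
      unfolding Cons.IH by (simp add: sum.lessThan_Suc_shift sum_negf Cons del: sum.lessThan_Suc)
    finally show ?thesis
      by (simp add: Cons del: sum.lessThan_Suc)
  qed
qed simp

text \<open>Separates the faces that change the coefficient from those inside the tail. The Adams
  operations commute with each group on its own.\<close>

lemma word_boundary_word:
  "(word_boundary (word (a # w)) :: ('k::comm_ring_1, 'a::comm_ring) words) = outer a w - cons a (bar w)"
proof (cases "w = []")
  case True
  then show ?thesis by (simp add: word_boundary_def outer_def wrap_def)
next
  case False
  then have "butlast w = drop 1 (take (length w) (a # w))" "last w = (a # w) ! length w"
    by (simp_all add: butlast_conv_take take_Cons' last_conv_nth nth_Cons')
  with False have "(word_boundary (word (a # w)) :: ('k, 'a) words) =
      bar (a # w) + pscale ((- 1) ^ length w) (wrap a w)"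
    unfolding bar_eq_sum by (simp add: word_boundary_def wrap_def Let_def mult.commute)
  then show ?thesis
    by (simp add: outer_def)
qed

lemma lin_word_boundary: "lin word_boundary"
  unfolding word_boundary_def by (rule lin_lin_ext_id)

lemmas word_boundary_distribs = lin_distribs[OF lin_word_boundary]

lemma word_boundary_cons:
  "word_boundary (cons a p) = lin_ext (outer a) p - cons a (lin_ext bar p)"
  by (rule lin_eqI[of "\<lambda>p. word_boundary (cons a p)"])
    (auto intro!: lin_intros simp: word_boundary_word word_boundary_distribs lin_def pscale_diff_right)

lemma lin_ext_outer:
  "lin_ext (outer a) p = lin_ext (mul_hd a) p + lin_ext (wrap a) (alternate p)"
  by (rule lin_eqI[of "lin_ext (outer a)"]) (auto intro!: lin_intros simp: outer_def)

lemma lin_ext_bar_cons: "lin_ext bar (cons a p) = lin_ext (mul_hd a) p - cons a (lin_ext bar p)"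
  by (rule lin_eqI[of "\<lambda>p. lin_ext bar (cons a p)"]) (auto intro!: lin_intros)

lemma mul_hd_cons: "lin_ext (mul_hd a) (cons x p) = cons (a * x) p"
  by (rule lin_eqI[of "\<lambda>p. lin_ext (mul_hd a) (cons x p)"]) (auto intro!: lin_intros)

lemma mul_hd_mul_hd: "lin_ext (mul_hd a) (mul_hd x w) = mul_hd (a * x) w"
  by (cases w) (auto simp: mult.assoc)

lemma bar_mul_hd: "lin_ext bar (mul_hd a w) = lin_ext (mul_hd a) (bar w)"
  by (cases w) (auto simp: mul_hd_mul_hd mul_hd_cons)

text \<open>Associativity makes \<open>bar\<close> commute with \<open>mul_hd\<close>, which cancels
  the mixed terms of the recursion.\<close>

lemma bar_bar: "lin_ext bar (bar w) = 0"
  by (induction w) (auto simp: lin_ext_bar_cons bar_mul_hd)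

lemma length_bar: "supported (\<lambda>v. Suc (length v) = length w) (bar w)"
proof (induction w)
  case (Cons a w)
  have "supported (\<lambda>v. Suc (length v) = length (a # w)) (mul_hd a w)"
    by (cases w) (auto intro: supported_zero supported_word)
  with Cons show ?case
    by (auto intro!: supported_diff supported_word elim!: supported_lin_ext)
qed (simp add: supported_zero)

lemma alternate_bar: "alternate (bar w) = pscale (- ((- 1) ^ length w)) (bar w)"
proof (cases w)
  case (Cons a r)
  then have "supported (\<lambda>v. length v = length r) (bar w)"
    using length_bar[of w] by (auto elim: supported_mono)
  from alternate_supported[OF this] show ?thesis
    by (simp add: Cons)
qed simp

lemma length_outer: "supported (\<lambda>v. length v = length w \<and> v \<noteq> []) (outer a w)"
  by (cases w) (auto simp: outer_def wrap_def
      intro!: supported_add supported_diff supported_pscale supported_zero supported_word)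

lemma length_word_boundary:
  "supported (\<lambda>v. length v = length w \<and> v \<noteq> []) (word_boundary (word (a # w)))"
  unfolding word_boundary_word
  by (intro supported_diff length_outer supported_lin_ext[OF length_bar]) (auto intro: supported_word)

section \<open>Operations on the last letter, and the square of the boundary\<close>

abbreviation snoc :: "'v \<Rightarrow> ('k::comm_ring_1, 'v) words \<Rightarrow> ('k, 'v) words" where
  "snoc z \<equiv> lin_ext (\<lambda>w. word (w @ [z]))"

definition mul_last :: "'a::comm_ring \<Rightarrow> 'a list \<Rightarrow> ('k::comm_ring_1, 'a) words" where
  "mul_last z w = (if w = [] then 0 else word (butlast w @ [last w * z]))"

lemma snoc_cons: "snoc z (cons a p) = cons a (snoc z p)"
  by (rule lin_eqI[of "\<lambda>p. snoc z (cons a p)"]) (auto intro!: lin_intros)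

lemma wrap_snoc: "lin_ext (wrap a) (snoc z p) = cons (a * z) p"
  by (rule lin_eqI[of "\<lambda>p. lin_ext (wrap a) (snoc z p)"]) (auto intro!: lin_intros simp: wrap_def)

lemma bar_snoc:
  fixes w :: "'a::comm_ring list"
  shows "(bar (w @ [z]) :: ('k::comm_ring_1, 'a) words) = snoc z (bar w) - pscale ((- 1) ^ length w) (mul_last z w)"
proof (induction w)
  case (Cons a w)
  show ?case
  proof (cases "w = []")
    case False
    then have "mul_last z (a # w) = (cons a (mul_last z w) :: ('k, 'a) words)"
      and "mul_hd a (w @ [z]) = (snoc z (mul_hd a w) :: ('k, 'a) words)"
      by (auto simp: mul_last_def neq_Nil_conv)
    then show ?thesis
      by (simp add: Cons.IH snoc_cons)
  qed (simp add: mul_last_def)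
qed (simp add: mul_last_def)

lemma wrap_bar_snoc:
  "lin_ext (wrap a) (bar (w @ [z])) =
    cons (a * z) (bar w) - pscale ((- 1) ^ length w) (wrap (a * z) w)"
  by (simp add: bar_snoc wrap_snoc) (simp add: mul_last_def wrap_def ac_simps)

lemma wrap_Cons_snoc: "x # r = s @ [z] \<Longrightarrow> wrap (a * x) r = mul_hd (a * z) s"
  by (cases s) (auto simp: wrap_def ac_simps)

lemma word_boundary_boundary_word:
  fixes w :: "'a::comm_ring list"
  shows "word_boundary (word_boundary (word (a # w) :: ('k::comm_ring_1, 'a) words)) = 0"
proof (cases w rule: rev_cases)
  case Nil
  then show ?thesis
    by (simp add: word_boundary_word outer_def wrap_def word_boundary_distribs)
next
  case (snoc s z)
  then obtain x r where r: "w = x # r"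
    by (metis neq_Nil_conv snoc_eq_iff_butlast)
  have len: "length r = length s"
    using r snoc by (metis length_Cons length_append_singleton nat.inject)
  define \<epsilon> :: 'k where "\<epsilon> = (- 1) ^ length s"
  have \<epsilon>: "\<epsilon> * \<epsilon> = 1"
    by (simp add: \<epsilon>_def minus_one_power_iff)
  \<comment> \<open>The argument is \<open>bar (a # w)\<close>, whose \<open>bar\<close> vanishes,
    so only terms with \<open>wrap\<close> survive; these are compared by means of the last letter
    \<open>z\<close>. The full boundary of \<open>a # w\<close> is this argument minus
    \<open>\<epsilon>\<close> times \<open>wrap a w\<close>.\<close>
  have "word_boundary (mul_hd a w - cons a (bar w) :: ('k, 'a) words) =
      pscale \<epsilon> (wrap (a * x) r) + lin_ext bar (bar (a # w)) - lin_ext (wrap a) (alternate (bar w))"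
    by (simp add: r word_boundary_distribs word_boundary_word word_boundary_cons lin_ext_outer outer_def
        len \<epsilon>_def lin_ext_bar_cons mul_hd_mul_hd mul_hd_cons bar_bar)
  also have "\<dots> = pscale \<epsilon> (mul_hd (a * z) s)
      - pscale \<epsilon> (cons (a * z) (bar s) - pscale \<epsilon> (wrap (a * z) s))"
  proof -
    have "wrap (a * x) r = (mul_hd (a * z) s :: ('k, 'a) words)"
      by (rule wrap_Cons_snoc) (use r snoc in simp)
    moreover have "lin_ext (wrap a) (bar w) =
        (cons (a * z) (bar s) - pscale \<epsilon> (wrap (a * z) s) :: ('k, 'a) words)"
      by (simp add: snoc wrap_bar_snoc \<epsilon>_def)
    moreover have "length w = Suc (length s)"
      by (simp add: snoc)
    ultimately show ?thesis
      by (simp add: bar_bar alternate_bar \<epsilon>_def del: bar.simps)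
  qed
  also have "\<dots> = pscale \<epsilon> (word_boundary (wrap a w))"
    by (simp add: snoc wrap_def word_boundary_word outer_def \<epsilon> \<epsilon>_def[symmetric] pscale_distribs)
  finally have *: "word_boundary (mul_hd a w - cons a (bar w) :: ('k, 'a) words) = pscale \<epsilon> (word_boundary (wrap a w))" .
  have "(word_boundary (word (a # w)) :: ('k, 'a) words) = mul_hd a w - cons a (bar w) + pscale (- \<epsilon>) (wrap a w)"
    by (simp add: word_boundary_word outer_def snoc \<epsilon>_def)
  then have "word_boundary (word_boundary (word (a # w) :: ('k, 'a) words)) =
      word_boundary (mul_hd a w - cons a (bar w)) + pscale (- \<epsilon>) (word_boundary (wrap a w))"
    by (simp only: lin_plus[OF lin_word_boundary] lin_scale[OF lin_word_boundary])
  then show ?thesis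
    unfolding * by simp
qed

section \<open>The boundary and the shuffle product\<close>

lemma mul_hd_shl_Cons_right:
  "lin_ext (mul_hd a) (shl u (b # v)) =
    (case u of [] \<Rightarrow> 0 | x # u' \<Rightarrow> cons (a * x) (shl u' (b # v))) +
    pscale ((- 1) ^ length u) (cons (a * b) (shl u v))"
  by (cases u) (auto simp: mul_hd_cons)

lemma mul_hd_shl_Cons_left:
  "lin_ext (mul_hd b) (shl (a # u) v) = cons (b * a) (shl u v) -
    pscale ((- 1) ^ length u) (case v of [] \<Rightarrow> 0 | y # v' \<Rightarrow> cons (b * y) (shl (a # u) v'))"
  by (cases v) (auto simp: mul_hd_cons)

text \<open>A product of a letter of \<open>u\<close> with a letter of \<open>v\<close> arises from
  two shuffles that differ by a transposition and have opposite signs. As the algebra is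
  commutative, such products cancel and only faces inside \<open>u\<close> or inside
  \<open>v\<close> remain.\<close>

lemma bar_shl:
  fixes u v :: "'a::comm_ring list"
  shows "(lin_ext bar (shl u v) :: ('k::comm_ring_1, 'a) words) =
    shp (bar u) (word v) + pscale ((- 1) ^ length u) (shp (word u) (bar v))"
proof (induction u v rule: shl.induct)
  case (3 a u b v)
  define s :: 'k where "s = (- 1) ^ length u"
  have s: "s * s = 1"
    by (simp add: s_def minus_one_power_iff)
  \<comment> \<open>In \<open>X\<close> and \<open>Y\<close> the leading letter is multiplied by its
    successor in the same word. \<open>R\<close> is the cross term \<open>a * b\<close>, which
    occurs twice and cancels.\<close>
  define X Y R :: "('k, 'a) words"
    where "X = (case u of [] \<Rightarrow> 0 | x # u' \<Rightarrow> cons (a * x) (shl u' (b # v)))"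
      and "Y = (case v of [] \<Rightarrow> 0 | y # v' \<Rightarrow> cons (b * y) (shl (a # u) v'))"
      and "R = cons (a * b) (shl u v)"
  have words: "word (b # v) = (cons b (word v) :: ('k, 'a) words)"
    "word (a # u) = (cons a (word u) :: ('k, 'a) words)"
    by simp_all
  have mul: "lin_ext (mul_hd a) (shl u (b # v)) = X + pscale s R"
    "lin_ext (mul_hd b) (shl (a # u) v) = R - pscale s Y"
    unfolding mul_hd_shl_Cons_left mul_hd_shl_Cons_right
    by (simp_all add: X_def Y_def R_def s_def mult.commute)
  have left: "(shp (bar (a # u)) (word (b # v)) :: ('k, 'a) words) =
      X - cons a (shp (bar u) (word (b # v))) + pscale s (cons b (shp (bar (a # u)) (word v)))"
  proof -
    have "shp (mul_hd a u) (word (b # v)) = X + pscale s (cons b (shp (mul_hd a u) (word v)))"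
      by (cases u) (simp_all add: X_def s_def)
    moreover have "shp (cons a (bar u)) (word (b # v)) =
        cons a (shp (bar u) (word (b # v))) + pscale s (cons b (shp (cons a (bar u)) (word v)))"
      unfolding words shp_cons_cons by (simp add: alternate_bar s_def)
    ultimately show ?thesis
      by (simp add: pscale_distribs)
  qed
  have right: "(shp (word (a # u)) (bar (b # v)) :: ('k, 'a) words) =
      cons a (shp (word u) (bar (b # v))) - pscale s Y + pscale s (cons b (shp (word (a # u)) (bar v)))"
  proof -
    have "shp (word (a # u)) (mul_hd b v) = cons a (shp (word u) (mul_hd b v)) - pscale s Y"
      by (cases v) (simp_all add: Y_def s_def)
    moreover have "shp (word (a # u)) (cons b (bar v)) =
        cons a (shp (word u) (cons b (bar v))) - pscale s (cons b (shp (word (a # u)) (bar v)))"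
      unfolding words shp_cons_cons by (simp add: s_def)
    ultimately show ?thesis
      by simp
  qed
  have "(lin_ext bar (shl (a # u) (b # v)) :: ('k, 'a) words) =
      X + Y - cons a (lin_ext bar (shl u (b # v))) + pscale s (cons b (lin_ext bar (shl (a # u) v)))"
    by (simp add: lin_ext_bar_cons s_def[symmetric] mul pscale_distribs s)
  also have "\<dots> = X + Y - cons a (shp (bar u) (word (b # v)))
      - pscale s (cons a (shp (word u) (bar (b # v))))
      + pscale s (cons b (shp (bar (a # u)) (word v))) - cons b (shp (word (a # u)) (bar v))"
    unfolding "3.IH" by (simp add: s_def[symmetric] pscale_distribs s del: bar.simps)
  also have "\<dots> = shp (bar (a # u)) (word (b # v)) - pscale s (shp (word (a # u)) (bar (b # v)))"
    unfolding left right by (simp add: pscale_distribs s del: bar.simps)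
  finally show ?case
    by (simp add: s_def del: bar.simps)
qed simp_all

section \<open>Inner faces, deconcatenation and the Adams operations\<close>

lemma cut_mul_hd:
  "lin_ext (cut G) (mul_hd a w) =
    lin_ext (G []) (mul_hd a w) + cut (\<lambda>u v. lin_ext (\<lambda>u. G u v) (mul_hd a u)) w"
  by (cases w) (auto simp: cut_Cons)

text \<open>A cut of a word with two merged neighbours is a cut of the original word that keeps both
  on the same side.\<close>

lemma cut_bar:
  "lin_ext (cut G) (bar w) = cut (\<lambda>u v. lin_ext (\<lambda>u. G u v) (bar u)
     + pscale ((- 1) ^ length u) (lin_ext (G u) (bar v))) w"
proof (induction w arbitrary: G)
  case (Cons a w)
  have eq: "lin_ext (\<lambda>u. G u v) (cons a p) = lin_ext (\<lambda>u. G (a # u) v) p" for v p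
    by (rule lin_eqI[of "\<lambda>p. lin_ext (\<lambda>u. G u v) (cons a p)"]) (auto intro!: lin_intros)
  show ?case
    by (simp add: lin_ext_cut_cons cut_mul_hd Cons.IH cut_Cons cut_add cut_diff eq algebra_simps
        cut_lin[OF lin_neg[OF lin_id]])
qed simp

lemma bar_adams:
  fixes w :: "'a::comm_ring list"
  shows "(lin_ext bar (adams n (word w)) :: ('k::comm_ring_1, 'a) words) = adams n (bar w)"
proof (induction n arbitrary: w)
  case 0
  \<comment> \<open>No face in \<open>bar\<close> is the empty word, so the counit vanishes on all
    of them.\<close>
  have "conv_unit (mul_hd a v) = 0" for a v
    by (cases v) (auto simp: conv_unit_word lin_zero[OF lin_conv_unit])
  then have "conv_unit (bar w :: ('k, 'a) words) = 0"
    by (cases w) (auto simp: lin_distribs[OF lin_conv_unit] conv_unit_cons)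
  then show ?case
    by (simp add: conv_unit_word)
next
  case (Suc n)
  let ?G = "\<lambda>u v. shp (word u) (adams n (word v)) :: ('k, 'a) words"
  have derivation: "lin_ext bar (shp (word u) p) =
      shp (bar u) p + pscale ((- 1) ^ length u) (shp (word u) (lin_ext bar p))" for u and p :: "('k, 'a) words"
    by (rule lin_eqI[of "\<lambda>p. lin_ext bar (shp (word u) p)"]) (auto intro!: lin_intros simp: bar_shl)
  have 1: "lin_ext (\<lambda>u. ?G u v) p = shp p (adams n (word v))" for p v
    by (rule lin_lin_ext_family) (intro lin_intros)
  have 2: "lin_ext (?G u) p = shp (word u) (adams n p)" for p u
    by (rule lin_lin_ext_family) (simp add: lin_def lin_distribs[OF lin_conv_power])
  have "lin_ext bar (adams (Suc n) (word w)) = cut (\<lambda>u v. lin_ext bar (?G u v)) w"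
    by (simp add: convolution_eq cut_lin[OF lin_lin_ext_id])
  also have "\<dots> = lin_ext (cut ?G) (bar w)"
    unfolding cut_bar derivation Suc 1 2 ..
  also have "\<dots> = adams (Suc n) (bar w)"
    by (simp add: convolution_eq)
  finally show ?case .
qed

text \<open>The shuffle recursion read from the right end, for the face that wraps the last letter.
  If \<open>x\<close> comes last, it has passed the \<open>length v + 1\<close> letters of
  \<open>v @ [y]\<close>.\<close>

lemma shl_snoc:
  fixes u v :: "'v list"
  shows "(shl (u @ [x]) (v @ [y]) :: ('k::comm_ring_1, 'v) words) =
    snoc y (shl (u @ [x]) v) - pscale ((- 1) ^ length v) (snoc x (shl u (v @ [y])))"
proof (induction "length u + length v" arbitrary: u v rule: less_induct)
  case less
  show ?case
  proof (cases u)
    case Nil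
    show ?thesis
    proof (cases v)
      case (Cons b v')
      then show ?thesis
        using less[of "[]" v'] Nil by (simp add: snoc_cons)
    qed (simp add: Nil)
  next
    case u: (Cons a u')
    show ?thesis
    proof (cases v)
      case Nil
      have "(shl (u' @ [x]) [y] :: ('k, 'v) words) = word (u' @ [x, y]) - snoc x (shl u' [y])"
        using less[of u' "[]"] u Nil by simp
      with Nil show ?thesis
        by (simp add: u snoc_cons)
    next
      case (Cons b v')
      have IH: "(shl (u' @ [x]) (b # v' @ [y]) :: ('k, 'v) words) =
          snoc y (shl (u' @ [x]) (b # v')) + pscale ((- 1) ^ length v') (snoc x (shl u' (b # v' @ [y])))"
        "(shl (a # u' @ [x]) (v' @ [y]) :: ('k, 'v) words) =
          snoc y (shl (a # u' @ [x]) v') - pscale ((- 1) ^ length v') (snoc x (shl (a # u') (v' @ [y])))"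
        using less[of u' v] less[of u v'] u Cons by simp_all
      show ?thesis
        by (simp add: u Cons IH snoc_cons pscale_distribs algebra_simps)
    qed
  qed
qed

text \<open>The product of chains on two words; \<open>word_bullet_eq\<close> identifies its
  bilinear extension with \<open>word_bullet\<close>.\<close>

definition chain_shl :: "'a::comm_ring list \<Rightarrow> 'a list \<Rightarrow> ('k::comm_ring_1, 'a) words" where
  "chain_shl v w = cons (hd v * hd w) (shl (tl v) (tl w))"

text \<open>A shuffle begins with the head of \<open>u\<close> or of \<open>v\<close> and ends with
  the last letter of \<open>u\<close> or of \<open>v\<close>. The outer faces absorb that letter
  into the coefficient, so every term belongs to one factor.\<close>

lemma outer_shl:
  fixes u v :: "'a::comm_ring list"
  shows "(lin_ext (outer (a * b)) (shl u v) :: ('k::comm_ring_1, 'a) words) =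
    bilin_ext chain_shl (outer a u) (word (b # v)) +
    pscale ((- 1) ^ length u) (bilin_ext chain_shl (word (a # u)) (outer b v))"
proof -
  have hd: "(lin_ext (mul_hd (a * b)) (shl u v) :: ('k, 'a) words) =
      bilin_ext chain_shl (mul_hd a u) (word (b # v)) +
      pscale ((- 1) ^ length u) (bilin_ext chain_shl (word (a # u)) (mul_hd b v))"
    by (cases u; cases v) (auto simp: mul_hd_cons chain_shl_def ac_simps)
  have "(lin_ext (wrap (a * b)) (shl u v) :: ('k, 'a) words) =
      pscale ((- 1) ^ length v) (bilin_ext chain_shl (wrap a u) (word (b # v))) +
      bilin_ext chain_shl (word (a # u)) (wrap b v)"
    by (cases u rule: rev_cases; cases v rule: rev_cases)
      (auto simp: wrap_snoc shl_snoc, auto simp: wrap_def chain_shl_def ac_simps)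
  moreover have "alternate (shl u v) = (pscale ((- 1) ^ (length u + length v)) (shl u v) :: ('k, 'a) words)"
    by (rule alternate_supported[OF length_shl])
  ultimately show ?thesis
    unfolding lin_ext_outer hd outer_def
    by (simp add: pscale_distribs power_add minus_one_power_iff)
qed

text \<open>Extends a map on tails to chains, leaving the coefficient fixed.\<close>

abbreviation chainwise :: "(('k::comm_ring_1, 'v) words \<Rightarrow> ('k, 'v) words) \<Rightarrow> ('k, 'v) words \<Rightarrow> ('k, 'v) words"
  where "chainwise f \<equiv> lin_ext (\<lambda>v. cons (hd v) (f (word (tl v))))"

lemma chainwise_cons: "chainwise f (cons a p) = cons a (f p)" if "lin f"
  by (rule lin_eqI[of "\<lambda>p. chainwise f (cons a p)"])
    (auto intro!: lin_intros simp: lin_def lin_distribs[OF that])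

lemma cut_if_left:
  "cut (\<lambda>u v. if u = [] then F v else G u v) w = F w + cut (\<lambda>u v. if u = [] then 0 else G u v) w"
  by (cases w) (auto simp: cut_Cons)

lemma cut_hd_left:
  "cut (\<lambda>u v. if u = [] then 0 else H (hd u) (tl u) v) w = (if w = [] then 0 else cut (H (hd w)) (tl w))"
  by (cases w) (auto simp: cut_Cons)

text \<open>Moving the cut one letter to the left turns the last letter of the left part into the
  head of the right part.\<close>

lemma cut_shift:
  "cut (\<lambda>u v. if u = [] then 0 else H (butlast u) (last u) v) w =
    cut (\<lambda>u v. if v = [] then 0 else H u (hd v) (tl v)) w"
proof (induction w arbitrary: H)
  case (Cons x r)
  have "cut (\<lambda>u v. if u = [] then 0 else H (butlast u) (last u) v) (x # r) =
      cut (\<lambda>u v. if u = [] then H [] x v else H (x # butlast u) (last u) v) r"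
    by (auto simp: cut_Cons intro: cut_cong)
  also have "\<dots> = H [] x r + cut (\<lambda>u v. if v = [] then 0 else H (x # u) (hd v) (tl v)) r"
    by (subst cut_if_left) (simp add: Cons.IH[of "\<lambda>u. H (x # u)"])
  finally show ?case
    by (simp add: cut_Cons)
qed simp

lemma cut_snoc: "cut G (w @ [z]) = cut (\<lambda>u v. G u (v @ [z])) w + G (w @ [z]) []"
  by (induction w arbitrary: G) (auto simp: cut_Cons add.assoc)

lemma cut_last_right:
  "cut (\<lambda>u v. if v = [] then 0 else H u (last v) (butlast v)) w =
    (if w = [] then 0 else cut (\<lambda>u. H u (last w)) (butlast w))"
  by (cases w rule: rev_cases) (auto simp: cut_snoc)

text \<open>On u . psi_n(v) the outer faces absorb an end letter of \<open>u\<close> or of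
  \<open>v\<close>. The head of \<open>u\<close> and the last letter of \<open>v\<close> are those
  of \<open>w\<close> and give the result. The last letter of \<open>u\<close> and the head of
  \<open>v\<close> are the same letter seen from cuts just after and just before it; by
  \<open>cut_shift\<close> these terms cancel.\<close>

lemma outer_adams:
  fixes w :: "'a::comm_ring list"
  assumes unit: "\<And>x :: 'a. e * x = x"
  shows "(lin_ext (outer a) (adams n (word w)) :: ('k::comm_ring_1, 'a) words) =
    chainwise (adams n) (outer a w)"
proof (induction n arbitrary: a w)
  case 0
  \<comment> \<open>Only a one-letter word has outer faces with empty tail, and its two outer faces
    cancel.\<close>
  show ?case
    by (cases w; cases "tl w") (auto simp: conv_unit_word outer_def wrap_def)
next
  case (Suc n)
  define K :: "'a \<Rightarrow> 'a list \<Rightarrow> 'a list \<Rightarrow> ('k, 'a) words"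
    where "K c u v = cons c (shp (word u) (adams n (word v)))" for c u v
  have unit': "x * e = x" for x
    using unit[of x] by (simp add: mult.commute)
  \<comment> \<open>The unit leaves the coefficient with \<open>u\<close>: (a, u . p) = (a, u) . (e,
    p), to which \<open>outer_shl\<close> applies.\<close>
  have derivation: "lin_ext (outer a) (shp (word u) p) =
      bilin_ext chain_shl (outer a u) (cons e p) +
      pscale ((- 1) ^ length u) (bilin_ext chain_shl (word (a # u)) (lin_ext (outer e) p))"
    for u and p :: "('k, 'a) words"
    by (rule lin_eqI[of "\<lambda>p. lin_ext (outer a) (shp (word u) p)"])
      (auto intro!: lin_intros simp: outer_shl[of a e, unfolded unit'])
  have bul1: "bilin_ext chain_shl (word (x # u)) (cons e p) = cons x (shp (word u) p)"
    for x u and p :: "('k, 'a) words"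
    by (rule lin_eqI[of "\<lambda>p. bilin_ext chain_shl (word (x # u)) (cons e p)"])
      (auto intro!: lin_intros simp: chain_shl_def unit')
  have bul2: "bilin_ext chain_shl (word (x # u)) (cons c p) = cons (x * c) (shp (word u) p)"
    for x c u and p :: "('k, 'a) words"
    by (rule lin_eqI[of "\<lambda>p. bilin_ext chain_shl (word (x # u)) (cons c p)"])
      (auto intro!: lin_intros simp: chain_shl_def)
  \<comment> \<open>For nonempty \<open>u\<close> the sign of the wrapping face is minus that of
    \<open>butlast u\<close>, which makes it opposite to the first term of \<open>part2\<close>
    after the shift.\<close>
  have part1: "bilin_ext chain_shl (outer a u) (cons e (adams n (word v))) =
      (if u = [] then 0 else K (a * hd u) (tl u) v) -
      (if u = [] then 0 else pscale ((- 1) ^ length (butlast u)) (K (a * last u) (butlast u) v))" for u v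
    by (cases u) (simp_all add: outer_def wrap_def bul1 K_def)
  have part2: "pscale ((- 1) ^ length u) (bilin_ext chain_shl (word (a # u)) (lin_ext (outer e) (adams n (word v)))) =
      (if v = [] then 0 else pscale ((- 1) ^ length u) (K (a * hd v) u (tl v))) +
      (if v = [] then 0 else pscale ((- 1) ^ (length u + length v)) (K (a * last v) u (butlast v)))" for u v
    unfolding Suc by (cases v) (simp_all add: outer_def wrap_def bul2 K_def unit pscale_distribs power_add)
  have "lin_ext (outer a) (adams (Suc n) (word w)) =
      cut (\<lambda>u v. lin_ext (outer a) (shp (word u) (adams n (word v)))) w"
    by (simp add: convolution_eq cut_lin[OF lin_lin_ext_id])
  also have "\<dots> = cut (\<lambda>u v. if u = [] then 0 else K (a * hd u) (tl u) v) w
      - cut (\<lambda>u v. if u = [] then 0 else pscale ((- 1) ^ length (butlast u)) (K (a * last u) (butlast u) v)) w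
      + (cut (\<lambda>u v. if v = [] then 0 else pscale ((- 1) ^ length u) (K (a * hd v) u (tl v))) w
      + cut (\<lambda>u v. if v = [] then 0 else pscale ((- 1) ^ (length u + length v)) (K (a * last v) u (butlast v))) w)"
    unfolding derivation part1 part2 cut_add cut_diff ..
  also have "cut (\<lambda>u v. if u = [] then 0 else K (a * hd u) (tl u) v) w =
      (if w = [] then 0 else cut (K (a * hd w)) (tl w))"
    by (rule cut_hd_left[of "\<lambda>x. K (a * x)"])
  also have "cut (\<lambda>u v. if u = [] then 0 else pscale ((- 1) ^ length (butlast u)) (K (a * last u) (butlast u) v)) w =
      cut (\<lambda>u v. if v = [] then 0 else pscale ((- 1) ^ length u) (K (a * hd v) u (tl v))) w"
    by (rule cut_shift[of "\<lambda>u x v. pscale ((- 1) ^ length u) (K (a * x) u v)"])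
  also have "cut (\<lambda>u v. if v = [] then 0 else pscale ((- 1) ^ (length u + length v)) (K (a * last v) u (butlast v))) w =
      cut (\<lambda>u v. if v = [] then 0 else pscale ((- 1) ^ length w) (K (a * last v) u (butlast v))) w"
    by (rule cut_cong) auto
  also have "\<dots> = (if w = [] then 0 else cut (\<lambda>u v. pscale ((- 1) ^ length w) (K (a * last w) u v)) (butlast w))"
    by (rule cut_last_right[of "\<lambda>u x v. pscale ((- 1) ^ length w) (K (a * x) u v)"])
  finally have *: "lin_ext (outer a) (adams (Suc n) (word w)) =
      (if w = [] then 0 else cut (K (a * hd w)) (tl w)) +
      (if w = [] then 0 else pscale ((- 1) ^ length w) (cut (K (a * last w)) (butlast w)))"
    by (simp add: cut_pscale)
  have K: "cut (K c) v = cons c (adams (Suc n) (word v))" for c v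
    unfolding K_def[abs_def] by (simp add: convolution_eq cut_lin[OF lin_lin_ext_id])
  show ?case
    unfolding * K by (cases w) (simp_all add: outer_def wrap_def del: conv_power.simps)
qed

lemma word_boundary_chainwise_adams:
  fixes w :: "'a::comm_ring list"
  assumes "\<And>x :: 'a. e * x = x"
  shows "word_boundary (chainwise (adams n) (word (a # w) :: ('k::comm_ring_1, 'a) words)) =
    chainwise (adams n) (word_boundary (word (a # w)))"
  by (simp add: word_boundary_cons word_boundary_word outer_adams[OF assms] bar_adams
      chainwise_cons[OF lin_conv_power])

text \<open>Solving the binomial formula for its top term J^n writes it as psi_n minus lower powers
  of J, which commute with the boundary by induction.\<close>

lemma word_boundary_chainwise_conv_power:
  fixes w :: "'a::comm_ring list"
  assumes unit: "\<And>x :: 'a. e * x = x"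
  shows "word_boundary (chainwise (conv_power J n) (word (a # w) :: ('k::comm_ring_1, 'a) words)) =
    chainwise (conv_power J n) (word_boundary (word (a # w)))"
proof (induction n rule: less_induct)
  case (less n)
  let ?S = "\<lambda>p :: ('k, 'a) words. \<Sum>j<n. pscale (of_nat (n choose j)) (chainwise (conv_power J j) p)"
  have eq: "chainwise (conv_power J n) p = chainwise (adams n) p - ?S p" for p :: "('k, 'a) words"
  proof (rule lin_eqI[of "chainwise (conv_power J n)"])
    fix v :: "'a list"
    have "chainwise (adams n) (word v :: ('k, 'a) words) =
        (\<Sum>j\<le>n. pscale (of_nat (n choose j)) (chainwise (conv_power J j) (word v)))"
      by (simp add: adams_binomial)
    then show "chainwise (conv_power J n) (word v :: ('k, 'a) words) =
        chainwise (adams n) (word v) - ?S (word v)"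
      by (simp add: lessThan_Suc_atMost[symmetric])
  qed (intro lin_intros)+
  have "word_boundary (?S (word (a # w))) = ?S (word_boundary (word (a # w)))"
    using less by (simp add: word_boundary_distribs del: lin_ext_word)
  then show ?case
    unfolding eq by (simp add: word_boundary_distribs word_boundary_chainwise_adams[OF unit] del: lin_ext_word)
qed

lemma word_e1_eq_sum:
  fixes p :: "('k::field_char_0, 'b) words"
  assumes "supported (\<lambda>v. v \<noteq> [] \<and> length v \<le> Suc N) p"
  shows "word_e1 p = (\<Sum>n<N. pscale ((- 1) ^ n / of_nat (Suc n)) (chainwise (conv_power J (Suc n)) p))"
proof (rule lin_eq_on_supported[OF assms lin_word_e1])
  fix v :: "'b list" assume v: "v \<noteq> [] \<and> length v \<le> Suc N"
  then obtain a w where w: "v = a # w" "length w \<le> N"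
    by (cases v) auto
  have "supported (\<lambda>v. length v \<le> N) (word w :: ('k, 'b) words)"
    using w by (simp add: supported_word)
  then show "word_e1 (word v :: ('k, 'b) words) = (\<Sum>n<N. pscale ((- 1) ^ n / of_nat (Suc n))
      (chainwise (conv_power J (Suc n)) (word v)))"
    by (simp add: w(1) word_e1_word eulerian_eq[of N] del: conv_power.simps of_nat_Suc)
qed (intro lin_intros)

lemma word_boundary_e1:
  fixes p :: "('k::field_char_0, 'a::comm_ring) words"
  assumes unit: "\<And>x :: 'a. e * x = x" and "supported (\<lambda>v. v \<noteq> []) p"
  shows "word_boundary (word_e1 p) = word_e1 (word_boundary p)"
proof (rule lin_eq_on_supported[OF assms(2)])
  fix v :: "'a list" assume "v \<noteq> []"
  then obtain a w where v: "v = a # w"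
    by (cases v) auto
  have 1: "supported (\<lambda>v. v \<noteq> [] \<and> length v \<le> Suc (length w)) (word v :: ('k, 'a) words)"
    by (simp add: supported_word v)
  \<comment> \<open>The boundary does not lengthen words, so the truncation at
    \<open>length w\<close> serves both sides.\<close>
  have 2: "supported (\<lambda>v. v \<noteq> [] \<and> length v \<le> Suc (length w)) (word_boundary (word v :: ('k, 'a) words))"
    unfolding v by (rule supported_mono[OF length_word_boundary]) auto
  show "word_boundary (word_e1 (word v :: ('k, 'a) words)) = word_e1 (word_boundary (word v))"
    unfolding word_e1_eq_sum[OF 1] word_e1_eq_sum[OF 2]
    by (simp add: word_boundary_distribs v word_boundary_chainwise_conv_power[OF unit]
        del: conv_power.simps of_nat_Suc lin_ext_word)
qed (simp_all add: lin_def word_boundary_distribs lin_distribs[OF lin_word_e1])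

section \<open>Compatibility with the tensor relations\<close>

definition degree_part :: "nat \<Rightarrow> ('k::comm_ring_1, 'v) words \<Rightarrow> ('k, 'v) words" where
  "degree_part n = lin_ext (\<lambda>w. if length w = Suc n then word w else 0)"

lemma lin_degree_part: "lin (degree_part n)"
  unfolding degree_part_def by (rule lin_lin_ext_id)

lemma degree_part_word: "degree_part n (word w) = (if length w = Suc n then word w else 0)"
  by (simp add: degree_part_def)

lemma word_bullet_eq:
  "(word_bullet :: ('k::comm_ring_1, 'a::comm_ring) words \<Rightarrow> _) = bilin_ext chain_shl"
proof -
  have "(\<Sum>\<sigma>\<in>Sh (length (tl v)) (length (tl w)). pscale (of_int (sign \<sigma>))
      (word (act_chain \<sigma> ((hd v * hd w) # tl v @ tl w)))) = (chain_shl v w :: ('k, 'a) words)" for v w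
    unfolding chain_shl_def shuffle_sum_eq_shl[symmetric] shuffle_sum_def
    by (simp add: act_chain_def)
  then show ?thesis
    by (simp only: word_bullet_def)
qed

text \<open>The distinguished letter moves to position \<open>\<sigma> (length u)\<close>, and the
  rest of the permuted word does not depend on it.\<close>

lemma act_update:
  assumes "\<sigma> permutes {..<length (u @ x # v)}"
  shows "\<exists>s t. \<forall>z. act \<sigma> (u @ z # v) = s @ z # t"
proof -
  let ?w = "act \<sigma> (u @ x # v)" and ?i = "\<sigma> (length u)"
  have i: "?i < length ?w"
    using permutes_in_image[OF assms, of "length u"] by simp
  have "act \<sigma> (u @ z # v) = ?w[?i := z]" for z
  proof (rule nth_equalityI)
    fix k assume "k < length (act \<sigma> (u @ z # v))"
    then have k: "k < length (u @ x # v)" by simp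
    have inv: "inv \<sigma> permutes {..<length (u @ y # v)}" for y
      using permutes_inv[OF assms] by simp
    have "act \<sigma> (u @ z # v) ! k = (u @ z # v) ! inv \<sigma> k" "?w ! k = (u @ x # v) ! inv \<sigma> k"
      unfolding act_def using k by (auto intro!: permute_list_nth[OF inv])
    moreover have "inv \<sigma> k = length u \<longleftrightarrow> k = ?i"
      using permutes_inv_eq[OF assms] by auto
    ultimately show "act \<sigma> (u @ z # v) ! k = ?w[?i := z] ! k"
      using k by (auto simp: nth_list_update nth_append nth_Cons split: nat.splits)
  qed simp
  then show ?thesis
    using i by (metis upd_conv_take_nth_drop)
qed

section \<open>Maps that are multilinear modulo the tensor relations\<close>

context comm_unital_algebra
begin

abbreviation "R \<equiv> tensor_relations scale"

lemma rel_zero: "0 \<in> R"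
  unfolding tensor_relations_def using lin_span.zero[of word_space] by (simp add: word_space_def)

lemma rel_add: "p \<in> R \<Longrightarrow> q \<in> R \<Longrightarrow> p + q \<in> R"
  unfolding tensor_relations_def using lin_span.add[of p word_space] by (simp add: word_space_def)

lemma rel_pscale: "p \<in> R \<Longrightarrow> pscale c p \<in> R"
  unfolding tensor_relations_def using lin_span.scale[of p word_space] by (simp add: word_space_def)

lemma rel_diff: "p \<in> R \<Longrightarrow> q \<in> R \<Longrightarrow> p - q \<in> R"
  using rel_add[of p "pscale (- 1) q"] rel_pscale[of q "- 1"] by simp

text \<open>Linearity in a single letter modulo the relations. Checking it for each letter, with the
  others fixed, is enough for a map to pass to tensor powers.\<close>

definition slot :: "('a \<Rightarrow> ('k, 'a) words) \<Rightarrow> bool" where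
  "slot h \<longleftrightarrow> (\<forall>x y. h (x + y) - h x - h y \<in> R) \<and> (\<forall>c x. h (scale c x) - pscale c (h x) \<in> R)"

definition multi :: "('a list \<Rightarrow> ('k, 'a) words) \<Rightarrow> bool" where
  "multi f \<longleftrightarrow> (\<forall>u v. slot (\<lambda>z. f (u @ z # v)))"

definition descends :: "(('k, 'a) words \<Rightarrow> ('k, 'a) words) \<Rightarrow> bool" where
  "descends f \<longleftrightarrow> lin f \<and> f ` R \<subseteq> R"

lemma descendsD: "descends f \<Longrightarrow> p \<in> R \<Longrightarrow> f p \<in> R"
  by (auto simp: descends_def)

lemma slot_word: "slot (\<lambda>z. word (u @ z # v))"
  unfolding slot_def tensor_relations_def by (intro conjI allI; rule lin_span.base; blast)

lemma slot_word_Cons: "slot (\<lambda>z. word (z # v))"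
  using slot_word[of "[]"] by simp

lemma slot_zero: "slot (\<lambda>z. 0)"
  by (simp add: slot_def rel_zero)

lemma slot_add: "slot f \<Longrightarrow> slot g \<Longrightarrow> slot (\<lambda>z. f z + g z)"
  unfolding slot_def
  by (auto simp: pscale_distribs add_diff_add[symmetric] intro: rel_add)
    (metis (no_types, lifting) add_diff_add rel_add)+

lemma slot_pscale:
  assumes "slot f"
  shows "slot (\<lambda>z. pscale c (f z))"
  unfolding slot_def
proof safe
  fix x y d
  have "pscale c (f (x + y)) - pscale c (f x) - pscale c (f y) = pscale c (f (x + y) - f x - f y)"
    "pscale c (f (scale d x)) - pscale d (pscale c (f x)) = pscale c (f (scale d x) - pscale d (f x))"
    by (simp_all add: pscale_distribs mult.commute)
  with assms show "pscale c (f (x + y)) - pscale c (f x) - pscale c (f y) \<in> R"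
    "pscale c (f (scale d x)) - pscale d (pscale c (f x)) \<in> R"
    by (simp_all add: slot_def rel_pscale)
qed

lemma slot_diff: "slot f \<Longrightarrow> slot g \<Longrightarrow> slot (\<lambda>z. f z - g z)"
  using slot_add[of f "\<lambda>z. pscale (- 1) (g z)"] slot_pscale[of g "- 1"] by simp

lemma slot_sum: "(\<And>i. i \<in> I \<Longrightarrow> slot (f i)) \<Longrightarrow> slot (\<lambda>z. \<Sum>i\<in>I. f i z)"
  by (induction I rule: infinite_finite_induct) (auto intro: slot_zero slot_add)

lemma slot_descends: "descends g \<Longrightarrow> slot f \<Longrightarrow> slot (\<lambda>z. g (f z))"
  unfolding slot_def descends_def
  by (auto simp: lin_diff[symmetric] lin_scale[symmetric])

lemma slot_mult_right: "slot h \<Longrightarrow> slot (\<lambda>z. h (a * z))"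
  and slot_mult_left: "slot h \<Longrightarrow> slot (\<lambda>z. h (z * a))"
  unfolding slot_def by (simp_all add: distrib_left distrib_right scale_mult mult.commute[of a])

lemma slot_cons: "slot (\<lambda>z. cons z p)"
proof -
  have "cons z p = (\<Sum>w\<in>Poly_Mapping.keys p. pscale (Poly_Mapping.lookup p w) (word (z # w)))" for z
    by (simp add: lin_ext_def)
  then show ?thesis
    by (auto intro!: slot_sum slot_pscale slot_word_Cons)
qed

lemma slot_if: "(b \<Longrightarrow> slot f) \<Longrightarrow> (\<not> b \<Longrightarrow> slot g) \<Longrightarrow> slot (\<lambda>z. if b then f z else g z)"
  by (cases b) simp_all

lemmas slot_intros = slot_word slot_word_Cons slot_zero slot_add slot_pscale slot_diff slot_sum slot_cons

lemma multiI: "(\<And>u v. slot (\<lambda>z. f (u @ z # v))) \<Longrightarrow> multi f"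
  by (simp add: multi_def)

lemma multiD: "multi f \<Longrightarrow> slot (\<lambda>z. f (u @ z # v))"
  by (simp add: multi_def)

text \<open>The universal property of the tensor powers, checked on the generators of the
  relations.\<close>

lemma descends_of_multi:
  assumes "lin f" "multi (\<lambda>w. f (word w))"
  shows "descends f"
  unfolding descends_def
proof safe
  fix p assume "p \<in> R"
  then show "f p \<in> R"
    unfolding tensor_relations_def
  proof induction
    case zero
    then show ?case
      using rel_zero assms(1) by (simp add: word_space_def lin_zero tensor_relations_def)
  next
    case (base b)
    then consider u x y v where "b = word (u @ (x + y) # v) - word (u @ x # v) - word (u @ y # v)"
      | c u x v where "b = word (u @ scale c x # v) - pscale c (word (u @ x # v))"
      by blast
    then have "f b \<in> R"
      by cases (use multiD[OF assms(2)] in \<open>auto simp: slot_def lin_distribs[OF assms(1)]\<close>)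
    then show ?case
      by (simp add: tensor_relations_def)
  next
    case (add p q)
    then show ?case
      using rel_add assms(1) by (simp add: word_space_def lin_plus tensor_relations_def)
  next
    case (scale p c)
    then show ?case
      using rel_pscale assms(1) by (simp add: word_space_def lin_scale tensor_relations_def)
  qed
qed (rule assms)

lemma descends_cons: "descends (cons a)"
  by (rule descends_of_multi[OF lin_lin_ext_id], rule multiI)
    (use slot_word[of "a # _"] in simp)

lemma descends_degree_part: "descends (degree_part n)"
  by (rule descends_of_multi[OF lin_degree_part], rule multiI)
    (auto simp: degree_part_word intro!: slot_if slot_zero slot_word)

lemma slot_act:
  assumes "\<sigma> permutes {..<Suc (length u + length v)}"
  shows "slot (\<lambda>z. word (act \<sigma> (u @ z # v)))"
proof -
  obtain s t where "\<And>z. act \<sigma> (u @ z # v) = s @ z # t"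
    using act_update[of \<sigma> u undefined v] assms by auto
  then show ?thesis
    by (simp add: slot_word)
qed

lemma multi_mul_hd: "multi (mul_hd a)"
proof (rule multiI)
  fix u v show "slot (\<lambda>z. mul_hd a (u @ z # v))"
  proof (cases u)
    case Nil
    then show ?thesis
      using slot_mult_right[OF slot_word_Cons] by simp
  next
    case (Cons b u')
    then show ?thesis
      using slot_word[of "a * b # u'"] by simp
  qed
qed

lemma slot_mul_hd: "slot (\<lambda>z. mul_hd z w)"
  by (cases w) (use slot_mult_left[OF slot_word_Cons] slot_zero in auto)

lemma multi_wrap: "multi (wrap a)"
proof (rule multiI)
  fix u v show "slot (\<lambda>z. wrap a (u @ z # v))"
  proof (cases "v = []")
    case True
    then show ?thesis
      using slot_mult_right[OF slot_word_Cons] by (simp add: wrap_def butlast_append)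
  next
    case False
    then show ?thesis
      using slot_word[of "a * last v # u"] by (simp add: wrap_def butlast_append)
  qed
qed

lemma slot_wrap: "slot (\<lambda>z. wrap z w)"
  unfolding wrap_def by (intro slot_if slot_zero slot_mult_left[OF slot_word_Cons])

lemma multi_outer: "multi (outer a)"
  unfolding outer_def[abs_def]
  by (rule multiI) (use multiD[OF multi_mul_hd] multiD[OF multi_wrap] in \<open>auto intro!: slot_intros\<close>)

lemma slot_outer: "slot (\<lambda>z. outer z w)"
  unfolding outer_def by (intro slot_add slot_pscale slot_mul_hd slot_wrap)

lemma multi_bar: "multi bar"
proof (rule multiI)
  fix u v show "slot (\<lambda>z. bar (u @ z # v))"
  proof (induction u)
    case Nil
    show ?case
      by (auto intro!: slot_diff slot_mul_hd slot_cons)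
  next
    case (Cons a u)
    then show ?case
      by (auto intro!: slot_diff multiD[OF multi_mul_hd] slot_descends[OF descends_cons])
  qed
qed

lemma descends_word_boundary: "descends word_boundary"
proof (rule descends_of_multi[OF lin_word_boundary], rule multiI)
  fix u v show "slot (\<lambda>z. word_boundary (word (u @ z # v)))"
  proof (cases u)
    case Nil
    then show ?thesis
      by (auto simp: word_boundary_word intro!: slot_diff slot_outer slot_cons)
  next
    case (Cons a u')
    then show ?thesis
      by (auto simp: word_boundary_word
          intro!: slot_diff multiD[OF multi_outer] slot_descends[OF descends_cons] multiD[OF multi_bar])
  qed
qed

lemma descends_eulerian: "descends eulerian"
  by (rule descends_of_multi[OF lin_eulerian], rule multiI, subst eulerian_log_coeff)
    (auto intro!: slot_sum slot_pscale slot_act)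

lemma descends_word_e1: "descends word_e1"
proof (rule descends_of_multi[OF lin_word_e1], rule multiI)
  fix u v show "slot (\<lambda>z. word_e1 (word (u @ z # v)))"
  proof (cases u)
    case Nil
    then show ?thesis
      by (auto simp: word_e1_word intro: slot_cons)
  next
    case (Cons a u')
    then show ?thesis
      by (auto simp: word_e1_word
          intro!: slot_descends[OF descends_cons] slot_descends[OF descends_eulerian] slot_word)
  qed
qed

text \<open>The sum over permutations serves better than the recursion here, since each summand is a
  permuted word and \<open>slot_act\<close> applies.\<close>

lemma slot_shl_left: "slot (\<lambda>z. shl (u @ z # v) w)"
  unfolding shuffle_sum_eq_shl[symmetric] shuffle_sum_def
  by (auto intro!: slot_sum slot_pscale slot_act dest!: Sh_permutes simp: ac_simps)

lemma slot_shl_right: "slot (\<lambda>z. shl w (u @ z # v))"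
proof -
  have "slot (\<lambda>z. word (act \<sigma> (w @ u @ z # v)))" if "\<sigma> \<in> Sh (length w) (length (u @ z # v))" for \<sigma> z
    using slot_act[of \<sigma> "w @ u" v] Sh_permutes[OF that] by (simp add: ac_simps)
  then show ?thesis
    unfolding shuffle_sum_eq_shl[symmetric] shuffle_sum_def
    by (auto intro!: slot_sum slot_pscale)
qed

lemma descends_word_bullet_left: "descends (\<lambda>p. word_bullet p q)"
proof -
  have "slot (\<lambda>z. chain_shl (u @ z # v) w)" for u v w
    by (cases u) (auto simp: chain_shl_def
        intro: slot_mult_left[OF slot_cons] slot_descends[OF descends_cons slot_shl_left])
  then have "multi (\<lambda>v. lin_ext (chain_shl v) q)"
    by (intro multiI) (simp add: lin_ext_def slot_sum slot_pscale)
  then show ?thesis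
    unfolding word_bullet_eq by (intro descends_of_multi lin_intros) (simp add: bilin_ext_def)
qed

lemma descends_word_bullet_right: "descends (\<lambda>q. word_bullet p q)"
proof -
  have "slot (\<lambda>z. chain_shl w (u @ z # v))" for u v w
    by (cases u) (auto simp: chain_shl_def
        intro: slot_mult_right[OF slot_cons] slot_descends[OF descends_cons slot_shl_right])
  then have "multi (\<lambda>v. lin_ext (\<lambda>w. chain_shl w v) p)"
    by (intro multiI) (simp add: lin_ext_def slot_sum slot_pscale)
  then show ?thesis
    unfolding word_bullet_eq by (intro descends_of_multi lin_intros) (simp add: bilin_ext_def)
qed

end

section \<open>Complexes presented by words\<close>

definition chains :: "('k::comm_ring_1, 'a) words set" where
  "chains = Collect (supported (\<lambda>w. w \<noteq> []))"

definition chains_of_degree :: "nat \<Rightarrow> ('k::comm_ring_1, 'a) words set" where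
  "chains_of_degree n = Collect (supported (\<lambda>w. length w = Suc n))"

definition positive_chains :: "('k::comm_ring_1, 'a) words set" where
  "positive_chains = Collect (supported (\<lambda>w. 2 \<le> length w))"

lemmas chains_defs = chains_def chains_of_degree_def positive_chains_def

text \<open>\<open>presents C \<pi> K\<close>: the complex \<open>C\<close> is the quotient by \<open>K\<close> of the complex of words, and \<open>\<pi>\<close> is the
  projection. The Hochschild and the Harrison complex (a quotient of a quotient) are both handled
  in this form.\<close>

definition presents ::
  "('k::comm_ring_1, 'v) chain_complex \<Rightarrow> (('k, 'a::comm_ring) words \<Rightarrow> 'v) \<Rightarrow> ('k, 'a) words set \<Rightarrow> bool" where
  "presents C \<pi> K \<longleftrightarrow>
     carrier C = \<pi> ` chains \<and> K \<subseteq> chains \<and>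
     (\<forall>p\<in>chains. \<forall>q\<in>chains. \<pi> p = \<pi> q \<longleftrightarrow> p - q \<in> K) \<and>
     (\<forall>p\<in>chains. \<forall>q\<in>chains. vadd C (\<pi> p) (\<pi> q) = \<pi> (p + q)) \<and>
     (\<forall>c. \<forall>p\<in>chains. vscale C c (\<pi> p) = \<pi> (pscale c p)) \<and>
     vzero C = \<pi> 0 \<and>
     (\<forall>n. component C n = \<pi> ` chains_of_degree n) \<and>
     (\<forall>p\<in>chains. bd C (\<pi> p) = \<pi> (word_boundary p))"

lemma chains_zero: "0 \<in> chains"
  and chains_add: "p \<in> chains \<Longrightarrow> q \<in> chains \<Longrightarrow> p + q \<in> chains"
  and chains_diff: "p \<in> chains \<Longrightarrow> q \<in> chains \<Longrightarrow> p - q \<in> chains"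
  and chains_pscale: "p \<in> chains \<Longrightarrow> pscale c p \<in> chains"
  by (auto simp: chains_def intro: supported_intros)

lemma supported_lin:
  assumes "lin f" "supported P p" "\<And>w. P w \<Longrightarrow> supported Q (f (word w))"
  shows "supported Q (f p)"
  using supported_lin_ext[OF assms(2), of Q "\<lambda>w. f (word w)"] assms by (simp add: lin_lin_ext_family)

lemma chains_of_degree_subset: "p \<in> chains_of_degree n \<Longrightarrow> p \<in> chains"
  by (auto simp: chains_defs elim!: supported_mono)

lemma positive_chains_subset: "p \<in> positive_chains \<Longrightarrow> p \<in> chains"
  by (auto simp: chains_defs elim!: supported_mono)

lemma degree_part_in: "degree_part n p \<in> chains_of_degree n"
  unfolding degree_part_def chains_defs
  by (auto intro!: supported_lin_ext[of "\<lambda>_. True"] supported_word supported_zero simp: supported_def[of "\<lambda>_. True"])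

lemma degree_part_id: "p \<in> chains_of_degree n \<Longrightarrow> degree_part n p = p"
  by (rule lin_eq_on_supported[OF _ lin_degree_part lin_id, of "\<lambda>w. length w = Suc n"])
    (auto simp: chains_defs degree_part_word)

lemma word_boundary_degree_0: "p \<in> chains_of_degree 0 \<Longrightarrow> word_boundary p = 0"
proof (rule lin_eq_on_supported[OF _ lin_word_boundary lin_const_zero, of "\<lambda>w. length w = Suc 0"])
  show "word_boundary (word w) = 0" if "length w = Suc 0" for w
    using that by (cases w) (auto simp: word_boundary_word outer_def wrap_def)
qed (simp add: chains_defs)

lemma word_boundary_degree_Suc:
  fixes p :: "('k::comm_ring_1, 'a::comm_ring) words"
  assumes "p \<in> chains_of_degree (Suc n)"
  shows "word_boundary p \<in> chains_of_degree n"
proof -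
  have "supported (\<lambda>v. length v = Suc n) (word_boundary (word w :: ('k, 'a) words))"
    if w0: "length w = Suc (Suc n)" for w
  proof -
    obtain a w' where "w = a # w'"
      using w0 by (cases w) simp_all
    then show ?thesis
      using w0 by (auto intro: supported_mono[OF length_word_boundary])
  qed
  then show ?thesis
    using assms by (auto simp: chains_defs intro: supported_lin[OF lin_word_boundary])
qed

text \<open>A boundary of degree 0 could only come from a chain (a, x), where it is a x - x a = 0.
  Hence the positive part is a subcomplex and degree 0 splits off.\<close>

lemma word_boundary_positive:
  fixes p :: "('k::comm_ring_1, 'a::comm_ring) words"
  assumes "p \<in> chains"
  shows "word_boundary p \<in> positive_chains"
proof -
  have "supported (\<lambda>v. 2 \<le> length v) (word_boundary (word w) :: ('k, 'a) words)" if w0: "w \<noteq> []" for w :: "'a list"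
  proof -
    obtain a w' where w: "w = a # w'"
      using w0 by (cases w) simp_all
    show ?thesis
    proof (cases "length w' \<le> 1")
      case True
      then have "word_boundary (word w :: ('k, 'a) words) = 0"
        unfolding w by (cases w') (auto simp: word_boundary_word outer_def wrap_def mult.commute)
      then show ?thesis
        by (simp add: supported_zero)
    next
      case False
      then show ?thesis
        unfolding w by (auto intro: supported_mono[OF length_word_boundary])
    qed
  qed
  then show ?thesis
    using assms by (auto simp: chains_defs intro: supported_lin[OF lin_word_boundary])
qed

lemma word_boundary_chains: "p \<in> chains \<Longrightarrow> word_boundary p \<in> chains"
  using word_boundary_positive positive_chains_subset by blast

lemma word_boundary_boundary:
  fixes p :: "('k::comm_ring_1, 'a::comm_ring) words"
  assumes "p \<in> chains"
  shows "word_boundary (word_boundary p) = 0"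
proof (rule lin_eq_on_supported[of "\<lambda>w. w \<noteq> []" p "\<lambda>p. word_boundary (word_boundary p)" "\<lambda>p. 0"])
  show "supported (\<lambda>w. w \<noteq> []) p"
    using assms by (simp add: chains_def)
  show "word_boundary (word_boundary (word w :: ('k, 'a) words)) = 0" if "w \<noteq> []" for w
    using that by (cases w) (auto simp: word_boundary_boundary_word)
qed (simp_all add: lin_def word_boundary_distribs)

section \<open>Subcomplexes and quotients of a presented complex\<close>

context
  fixes C :: "('k::comm_ring_1, 'v) chain_complex" and \<pi> :: "('k, 'a::comm_ring) words \<Rightarrow> 'v" and K
  assumes presents: "presents C \<pi> K"
begin

lemma presents_carrier: "carrier C = \<pi> ` chains"
  and presents_subset: "K \<subseteq> chains"
  and presents_eq_iff: "p \<in> chains \<Longrightarrow> q \<in> chains \<Longrightarrow> \<pi> p = \<pi> q \<longleftrightarrow> p - q \<in> K"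
  and presents_add: "p \<in> chains \<Longrightarrow> q \<in> chains \<Longrightarrow> vadd C (\<pi> p) (\<pi> q) = \<pi> (p + q)"
  and presents_scale: "p \<in> chains \<Longrightarrow> vscale C c (\<pi> p) = \<pi> (pscale c p)"
  and presents_zero: "vzero C = \<pi> 0"
  and presents_component: "component C n = \<pi> ` chains_of_degree n"
  and presents_bd: "p \<in> chains \<Longrightarrow> bd C (\<pi> p) = \<pi> (word_boundary p)"
  using presents by (simp_all add: presents_def)

lemma presents_sum_in_span:
  assumes "\<And>i. i \<in> I \<Longrightarrow> p i \<in> chains \<and> \<pi> (p i) \<in> lin_span C B"
  shows "\<pi> (\<Sum>i\<in>I. p i) \<in> lin_span C B"
proof -
  have "(\<Sum>i\<in>I. p i) \<in> chains \<and> \<pi> (\<Sum>i\<in>I. p i) \<in> lin_span C B"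
    using assms
  proof (induction I rule: infinite_finite_induct)
    case (insert i I)
    then have "p i \<in> chains" "\<pi> (p i) \<in> lin_span C B"
      "(\<Sum>i\<in>I. p i) \<in> chains" "\<pi> (\<Sum>i\<in>I. p i) \<in> lin_span C B"
      by blast+
    then show ?case
      using insert.hyps lin_span.add[of "\<pi> (p i)" C B "\<pi> (\<Sum>i\<in>I. p i)"]
      by (simp add: chains_add presents_add)
  qed (auto simp: presents_zero[symmetric] chains_zero intro: lin_span.zero)
  then show ?thesis ..
qed

lemma lin_span_subset_image:
  assumes "B \<subseteq> \<pi> ` V" "V \<subseteq> chains" "0 \<in> V"
    and "\<And>p q. p \<in> V \<Longrightarrow> q \<in> V \<Longrightarrow> p + q \<in> V" "\<And>c p. p \<in> V \<Longrightarrow> pscale c p \<in> V"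
  shows "lin_span C B \<subseteq> \<pi> ` V"
proof
  fix x assume "x \<in> lin_span C B"
  then show "x \<in> \<pi> ` V"
  proof induction
    case (add x y)
    then obtain p q where "p \<in> V" "q \<in> V" "x = \<pi> p" "y = \<pi> q"
      by blast
    then show ?case
      using assms(2,4) presents_add[of p q] by blast
  next
    case (scale x c)
    then obtain p where "p \<in> V" "x = \<pi> p"
      by blast
    then show ?case
      using assms(2,5) presents_scale[of p c] by blast
  qed (use assms presents_zero in auto)
qed

lemma presents_positive_part: "positive_part C = \<pi> ` positive_chains"
proof
  show "positive_part C \<subseteq> \<pi> ` positive_chains"
    unfolding positive_part_def
  proof (rule lin_span_subset_image)
    show "(\<Union>n\<in>{1..}. component C n) \<subseteq> \<pi> ` positive_chains"
      by (auto simp: presents_component chains_defs intro!: imageI elim: supported_mono)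
  qed (auto simp: chains_defs intro: supported_intros elim: supported_mono)
  show "\<pi> ` positive_chains \<subseteq> positive_part C"
    unfolding positive_part_def
  proof safe
    fix p :: "('k, 'a) words" assume p: "p \<in> positive_chains"
    show "\<pi> p \<in> lin_span C (\<Union>n\<in>{1..}. component C n)"
    proof (subst sum_keys_word, rule presents_sum_in_span)
      fix w assume "w \<in> Poly_Mapping.keys p"
      then have w: "2 \<le> length w"
        using p by (simp add: positive_chains_def supported_def)
      let ?q = "pscale (Poly_Mapping.lookup p w) (word w)"
      have q: "?q \<in> chains_of_degree (length w - 1)"
        using w by (auto simp: chains_of_degree_def intro!: supported_pscale supported_word)
      then have "\<pi> ?q \<in> component C (length w - 1)"
        by (simp only: presents_component imageI)
      with q w show "?q \<in> chains \<and> \<pi> ?q \<in> lin_span C (\<Union>n\<in>{1..}. component C n)"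
        using chains_of_degree_subset[OF q] by (auto intro!: lin_span.base bexI[of _ "length w - 1"])
    qed
  qed
qed

lemma presents_zero_mem: "0 \<in> K"
  using presents_eq_iff[of 0 0] chains_zero by auto

text \<open>An element of the intersection has a homogeneous representative \<open>p\<close> and a
  representative \<open>q\<close> in \<open>V\<close>. Projecting \<open>p - q\<close> to degree
  \<open>n\<close> stays in \<open>K\<close>, so the degree part of \<open>q\<close> represents it
  too.\<close>

lemma component_Int_image:
  assumes "degree_part n ` K \<subseteq> K" "V \<subseteq> chains" "degree_part n ` V \<subseteq> V"
  shows "component C n \<inter> \<pi> ` V = \<pi> ` degree_part n ` V"
proof
  show "component C n \<inter> \<pi> ` V \<subseteq> \<pi> ` degree_part n ` V"
  proof
    fix x assume "x \<in> component C n \<inter> \<pi> ` V"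
    then obtain p q where *: "x = \<pi> p" "p \<in> chains_of_degree n" "x = \<pi> q" "q \<in> V"
      unfolding presents_component by blast
    then have "p - q \<in> K"
      using presents_eq_iff[of p q] chains_of_degree_subset[of p n] assms(2) by auto
    then have "degree_part n (p - q) \<in> K"
      using assms(1) by blast
    then have "p - degree_part n q \<in> K"
      using degree_part_id[OF *(2)] by (simp add: lin_diff[OF lin_degree_part])
    then have "\<pi> p = \<pi> (degree_part n q)"
      using presents_eq_iff chains_of_degree_subset *(2) degree_part_in by blast
    with * show "x \<in> \<pi> ` degree_part n ` V"
      by blast
  qed
  show "\<pi> ` degree_part n ` V \<subseteq> component C n \<inter> \<pi> ` V"
    using assms(3) degree_part_in by (force simp: presents_component)
qed

lemma has_boundary_subcomplex:
  assumes "\<And>n. degree_part n ` K \<subseteq> K" "V \<subseteq> chains" "\<And>n. degree_part n ` V \<subseteq> V"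
    and "word_boundary ` V \<subseteq> V"
  shows "has_boundary (subcomplex C (\<pi> ` V))"
proof -
  have comp: "component (subcomplex C (\<pi> ` V)) n = \<pi> ` degree_part n ` V" for n
    using component_Int_image[OF assms(1-3)] by (simp add: subcomplex_def)
  have bd: "bd C (\<pi> p) = \<pi> (word_boundary p)" "word_boundary p \<in> V" "p \<in> chains" if "p \<in> V" for p
    using that assms(2,4) presents_bd by blast+
  have "linear_between (subcomplex C (\<pi> ` V)) (subcomplex C (\<pi> ` V)) (bd C)"
    unfolding linear_between_def
    by (auto simp: subcomplex_def bd presents_add presents_scale presents_bd chains_add chains_pscale
        word_boundary_chains word_boundary_distribs)
  moreover have "bd C x = vzero C" if "x \<in> \<pi> ` degree_part 0 ` V" for x
    using that by (auto simp: presents_bd[OF chains_of_degree_subset[OF degree_part_in]]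
        word_boundary_degree_0[OF degree_part_in] presents_zero)
  moreover have "bd C ` \<pi> ` degree_part (Suc n) ` V \<subseteq> \<pi> ` degree_part n ` V" for n
  proof safe
    fix p assume "p \<in> V"
    define q where "q = word_boundary (degree_part (Suc n) p)"
    have "degree_part (Suc n) p \<in> V"
      using assms(3) \<open>p \<in> V\<close> by blast
    then have "bd C (\<pi> (degree_part (Suc n) p)) = \<pi> q" "q \<in> V"
      using bd by (auto simp: q_def)
    moreover have "degree_part n q = q"
      unfolding q_def by (intro degree_part_id word_boundary_degree_Suc degree_part_in)
    ultimately show "bd C (\<pi> (degree_part (Suc n) p)) \<in> \<pi> ` degree_part n ` V"
      by (metis imageI)
  qed
  moreover have "bd C (bd C x) = vzero C" if "x \<in> \<pi> ` V" for x
    using that bd by (auto simp: presents_zero word_boundary_boundary)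
  ultimately show ?thesis
    unfolding has_boundary_def comp by (simp add: subcomplex_def)
qed

text \<open>Presents the whole complex as a subcomplex, so that one isomorphism lemma serves both
  claims of the theorem.\<close>

lemma subcomplex_carrier: "subcomplex C (\<pi> ` chains) = C"
proof -
  have "component C n \<inter> \<pi> ` chains = component C n" for n
    using chains_of_degree_subset by (auto simp: presents_component)
  then show ?thesis
    by (simp add: subcomplex_def presents_carrier[symmetric])
qed

lemma coset_presents:
  assumes "K' \<subseteq> chains" "p \<in> chains"
  shows "coset C (\<pi> ` K') (\<pi> p) = \<pi> ` (\<lambda>r. p + r) ` K'"
proof -
  have "vadd C (\<pi> p) (\<pi> r) = \<pi> (p + r)" if "r \<in> K'" for r
    using that assms presents_add by blast
  then show ?thesis
    by (auto simp: coset_def) (metis imageI)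
qed

lemma coset_eq_iff:
  assumes K': "K \<subseteq> K'" "K' \<subseteq> chains" "\<And>p q. p \<in> K' \<Longrightarrow> q \<in> K' \<Longrightarrow> p + q \<in> K'"
    "\<And>c p. p \<in> K' \<Longrightarrow> pscale c p \<in> K'"
    and pq: "p \<in> chains" "q \<in> chains"
  shows "coset C (\<pi> ` K') (\<pi> p) = coset C (\<pi> ` K') (\<pi> q) \<longleftrightarrow> p - q \<in> K'"
proof
  assume eq: "coset C (\<pi> ` K') (\<pi> p) = coset C (\<pi> ` K') (\<pi> q)"
  have "0 \<in> K'"
    using presents_zero_mem K' by blast
  then have "\<pi> (p + 0) \<in> coset C (\<pi> ` K') (\<pi> p)"
    unfolding coset_presents[OF K'(2) pq(1)] by blast
  then obtain r where r: "r \<in> K'" "\<pi> p = \<pi> (q + r)"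
    unfolding eq coset_presents[OF K'(2) pq(2)] by auto
  moreover have "q + r \<in> chains"
    using r pq K' chains_add by blast
  ultimately have "p - (q + r) \<in> K'"
    using presents_eq_iff pq K' by blast
  then have "p - (q + r) + r \<in> K'"
    using K' r by blast
  then show "p - q \<in> K'"
    by simp
next
  assume d: "p - q \<in> K'"
  have "(\<lambda>r. p + r) ` K' = (\<lambda>r. q + r) ` K'"
  proof (intro equalityI subsetI; elim imageE)
    fix x r assume "r \<in> K'" "x = p + r"
    with K'(3)[OF d, of r] show "x \<in> (\<lambda>r. q + r) ` K'"
      by (intro image_eqI[of _ _ "p - q + r"]) auto
  next
    fix x r assume "r \<in> K'" "x = q + r"
    with K'(3)[OF K'(4)[OF d, of "- 1"], of r] show "x \<in> (\<lambda>r. p + r) ` K'"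
      by (intro image_eqI[of _ _ "q - p + r"]) auto
  qed
  then show "coset C (\<pi> ` K') (\<pi> p) = coset C (\<pi> ` K') (\<pi> q)"
    using K' pq by (simp add: coset_presents)
qed

text \<open>Used twice: from words to the Hochschild complex, and from there to the Harrison
  complex. A coset of cosets is thus again described by words, modulo a larger subspace.\<close>

lemma presents_quotient:
  assumes K': "K \<subseteq> K'" "K' \<subseteq> chains" "\<And>p q. p \<in> K' \<Longrightarrow> q \<in> K' \<Longrightarrow> p + q \<in> K'"
    "\<And>c p. p \<in> K' \<Longrightarrow> pscale c p \<in> K'" "\<And>p. p \<in> K' \<Longrightarrow> word_boundary p \<in> K'"
  shows "presents (quotient_complex C (\<pi> ` K')) (\<lambda>p. coset C (\<pi> ` K') (\<pi> p)) K'"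
proof -
  let ?S = "\<pi> ` K'" and ?\<rho> = "\<lambda>p. coset C (\<pi> ` K') (\<pi> p)"
  have eq_iff: "?\<rho> p = ?\<rho> q \<longleftrightarrow> p - q \<in> K'" if "p \<in> chains" "q \<in> chains" for p q
    by (rule coset_eq_iff) (use K' that in auto)
  have zero: "0 \<in> K'"
    using presents_zero_mem K' by blast
  have members: "x \<in> ?\<rho> p \<longleftrightarrow> (\<exists>r\<in>K'. x = \<pi> (p + r))" if "p \<in> chains" for x p
    unfolding coset_presents[OF K'(2) that] by auto
  have nonempty: "\<pi> p \<in> ?\<rho> p" if "p \<in> chains" for p
    using members[OF that] zero by force
  have K'_chains: "r \<in> chains" if "r \<in> K'" for r
    using that K' by blast
  have induced_eq: "induced C ?S f (?\<rho> p) = ?\<rho> (g p)"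
    if p: "p \<in> chains" and f: "\<And>q. q \<in> chains \<Longrightarrow> f (\<pi> q) = \<pi> (g q) \<and> g q \<in> chains"
      and g: "\<And>r. r \<in> K' \<Longrightarrow> g (p + r) - g p \<in> K'" for f g p
  proof -
    have "coset C ?S (f x) = ?\<rho> (g p)" if x: "x \<in> ?\<rho> p" for x
    proof -
      obtain r where r: "r \<in> K'" "x = \<pi> (p + r)"
        using x members[OF p] by blast
      then have "p + r \<in> chains"
        using p K'_chains chains_add by blast
      then show ?thesis
        using r f[of "p + r"] f[of p] p g[of r] eq_iff[of "g (p + r)" "g p"] by simp
    qed
    then show ?thesis
      unfolding induced_def using nonempty[OF p] by blast
  qed
  have induced2_eq: "induced2 C ?S (vadd C) (?\<rho> p) (?\<rho> q) = ?\<rho> (p + q)"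
    if p: "p \<in> chains" and q: "q \<in> chains" for p q
  proof -
    have "coset C ?S (vadd C x y) = ?\<rho> (p + q)" if xy: "x \<in> ?\<rho> p" "y \<in> ?\<rho> q" for x y
    proof -
      obtain r s where r: "r \<in> K'" "x = \<pi> (p + r)" "s \<in> K'" "y = \<pi> (q + s)"
        using xy members[OF p] members[OF q] by blast
      have c: "p + r \<in> chains" "q + s \<in> chains"
        using r p q K'_chains chains_add by blast+
      have "(p + r) + (q + s) - (p + q) \<in> K'"
        using K'(3)[OF r(1,3)] by (simp add: algebra_simps)
      then have "?\<rho> ((p + r) + (q + s)) = ?\<rho> (p + q)"
        using eq_iff c p q chains_add by blast
      then show ?thesis
        using presents_add[OF c] r by simp
    qed
    then show ?thesis
      unfolding induced2_def using nonempty[OF p] nonempty[OF q] by blast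
  qed
  show ?thesis
    unfolding presents_def
  proof (intro conjI ballI allI)
    show "carrier (quotient_complex C ?S) = ?\<rho> ` chains"
      by (simp add: quotient_complex_def presents_carrier image_image)
    show "K' \<subseteq> chains"
      by fact
    show "(?\<rho> p = ?\<rho> q) = (p - q \<in> K')" if "p \<in> chains" "q \<in> chains" for p q
      using eq_iff that .
    show "vadd (quotient_complex C ?S) (?\<rho> p) (?\<rho> q) = ?\<rho> (p + q)" if "p \<in> chains" "q \<in> chains" for p q
      using induced2_eq[OF that] by (simp add: quotient_complex_def)
    show "vscale (quotient_complex C ?S) c (?\<rho> p) = ?\<rho> (pscale c p)" if "p \<in> chains" for p c
      unfolding quotient_complex_def
      by (simp, rule induced_eq[OF that, of "vscale C c" "pscale c"])
        (use presents_scale chains_pscale K' in \<open>auto simp: pscale_distribs\<close>)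
    show "vzero (quotient_complex C ?S) = ?\<rho> 0"
      by (simp add: quotient_complex_def presents_zero)
    show "component (quotient_complex C ?S) n = ?\<rho> ` chains_of_degree n" for n
      by (simp add: quotient_complex_def presents_component image_image)
    show "bd (quotient_complex C ?S) (?\<rho> p) = ?\<rho> (word_boundary p)" if "p \<in> chains" for p
      unfolding quotient_complex_def
      by (simp, rule induced_eq[OF that, of "bd C" word_boundary])
        (use presents_bd word_boundary_chains K' in \<open>auto simp: word_boundary_distribs\<close>)
  qed
qed

end

text \<open>By \<open>kernel\<close>, \<open>K\<close> is the preimage of \<open>L\<close> under
  \<open>F\<close>, so \<open>F\<close> induces an injective chain map from \<open>C\<close> to
  \<open>D\<close>. The subspace \<open>V\<close> restricts it to a subcomplex and its
  image.\<close>

lemma presents_isomorphic: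
  fixes C :: "('k::comm_ring_1, 'v) chain_complex" and D :: "('k, 'w) chain_complex"
    and F :: "('k, 'a::comm_ring) words \<Rightarrow> ('k, 'a) words"
  assumes C: "presents C \<pi> K" and D: "presents D \<rho> L"
    and F: "lin F" "F ` chains \<subseteq> chains"
    and F_bd: "\<And>p. p \<in> chains \<Longrightarrow> F (word_boundary p) = word_boundary (F p)"
    and F_deg: "\<And>n p. p \<in> chains \<Longrightarrow> F (degree_part n p) = degree_part n (F p)"
    and kernel: "\<And>p. p \<in> chains \<Longrightarrow> F p \<in> L \<longleftrightarrow> p \<in> K"
    and L_deg: "\<And>n. degree_part n ` L \<subseteq> L"
    and V: "V \<subseteq> chains" "\<And>p q. p \<in> V \<Longrightarrow> q \<in> V \<Longrightarrow> p + q \<in> V" "\<And>c p. p \<in> V \<Longrightarrow> pscale c p \<in> V"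
      "word_boundary ` V \<subseteq> V" "\<And>n. degree_part n ` V \<subseteq> V"
  shows "complexes_isomorphic (subcomplex C (\<pi> ` V)) (subcomplex D (\<rho> ` F ` V))"
proof -
  note C_rules = presents_add[OF C] presents_scale[OF C] presents_bd[OF C] presents_eq_iff[OF C]
  note D_rules = presents_add[OF D] presents_scale[OF D] presents_bd[OF D] presents_eq_iff[OF D]
  have F_chains: "F p \<in> chains" if "p \<in> chains" for p
    using that F(2) by blast
  have V_chains: "p \<in> chains" if "p \<in> V" for p
    using that V(1) by blast
  have FV: "F ` V \<subseteq> chains" "\<And>n. degree_part n ` F ` V \<subseteq> F ` V" "word_boundary ` F ` V \<subseteq> F ` V"
  proof -
    show "F ` V \<subseteq> chains"
      using F_chains V_chains by blast
    show "degree_part n ` F ` V \<subseteq> F ` V" for n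
      using V(5)[of n] V_chains by (auto simp: F_deg[symmetric])
    show "word_boundary ` F ` V \<subseteq> F ` V"
      using V(4) V_chains by (auto simp: F_bd[symmetric])
  qed
  have K_deg: "degree_part n ` K \<subseteq> K" for n
  proof safe
    fix p assume p: "p \<in> K"
    then have "p \<in> chains"
      using presents_subset[OF C] by blast
    moreover from this have "degree_part n (F p) \<in> L"
      using p kernel L_deg by blast
    ultimately show "degree_part n p \<in> K"
      using F_deg kernel chains_of_degree_subset[OF degree_part_in] by metis
  qed
  \<comment> \<open>An arbitrary representative is chosen; \<open>F_eq\<close> shows that the result
    does not depend on it.\<close>
  define \<phi> where "\<phi> x = \<rho> (F (SOME p. p \<in> chains \<and> \<pi> p = x))" for x
  have F_eq: "\<rho> (F p) = \<rho> (F q) \<longleftrightarrow> \<pi> p = \<pi> q" if "p \<in> chains" "q \<in> chains" for p q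
    using that kernel[OF chains_diff, of p q] by (simp add: C_rules D_rules F_chains lin_diff[OF F(1)])
  have \<phi>: "\<phi> (\<pi> p) = \<rho> (F p)" if "p \<in> chains" for p
  proof -
    have "\<exists>q. q \<in> chains \<and> \<pi> q = \<pi> p"
      using that by blast
    from someI_ex[OF this] show ?thesis
      unfolding \<phi>_def using F_eq that by blast
  qed
  let ?C = "subcomplex C (\<pi> ` V)" and ?D = "subcomplex D (\<rho> ` F ` V)"
  have "has_boundary ?C"
    by (rule has_boundary_subcomplex[OF C K_deg V(1) V(5) V(4)])
  moreover have "has_boundary ?D"
    by (rule has_boundary_subcomplex[OF D L_deg FV])
  moreover have "linear_between ?C ?D \<phi>"
    unfolding linear_between_def
    by (auto simp: subcomplex_def \<phi> V_chains C_rules D_rules F_chains chains_add chains_pscale lin_distribs[OF F(1)]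
       )
  moreover have "bij_betw \<phi> (carrier ?C) (carrier ?D)"
    unfolding bij_betw_def
  proof
    show "inj_on \<phi> (carrier ?C)"
      by (auto simp: subcomplex_def inj_on_def \<phi> V_chains F_eq)
    show "\<phi> ` carrier ?C = carrier ?D"
      using V_chains \<phi> by (auto simp: subcomplex_def image_image)
  qed
  moreover have "\<phi> ` component ?C n = component ?D n" for n
  proof -
    have "component ?C n = \<pi> ` degree_part n ` V"
      using component_Int_image[OF C K_deg V(1) V(5)] by (simp add: subcomplex_def)
    moreover have "component ?D n = \<rho> ` degree_part n ` F ` V"
      using component_Int_image[OF D L_deg FV(1,2)] by (simp add: subcomplex_def)
    moreover have "\<phi> (\<pi> (degree_part n p)) = \<rho> (degree_part n (F p))" if "p \<in> V" for p
      using that V_chains \<phi> F_deg chains_of_degree_subset[OF degree_part_in] by metis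
    ultimately show ?thesis
      by (simp add: image_image)
  qed
  moreover have "\<phi> (bd ?C x) = bd ?D (\<phi> x)" if "x \<in> carrier ?C" for x
    using that
    by (auto simp: subcomplex_def \<phi> V_chains C_rules D_rules F_chains word_boundary_chains F_bd
       )
  ultimately show ?thesis
    unfolding complexes_isomorphic_def by blast
qed

section \<open>The Harrison complex and the eulerian part\<close>

lemma presents_word_complex:
  "presents (word_complex :: ('k::comm_ring_1, ('k, 'a::comm_ring) words) chain_complex) (\<lambda>p. p) {0}"
  by (auto simp: presents_def word_complex_def chains_defs supported_def)

text \<open>With the identity in degree 0, its kernel modulo the relations represents I . I in all
  degrees.\<close>

definition e1_total :: "('k::field_char_0, 'a) words \<Rightarrow> ('k, 'a) words" where
  "e1_total p = word_e1 p + degree_part 0 p"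

lemma lin_e1_total: "lin e1_total"
  unfolding e1_total_def using lin_add[OF lin_word_e1 lin_degree_part[of 0]] by simp

lemma length_word_e1: "supported (\<lambda>v. length v = length w) (word_e1 (word w))" if "w \<noteq> []"
proof -
  obtain a w' where w: "w = a # w'"
    using \<open>w \<noteq> []\<close> by (auto simp: neq_Nil_conv)
  show ?thesis
    unfolding w word_e1_word
    by (rule supported_lin_ext[OF mset_eulerian]) (auto intro!: supported_word dest: mset_eq_length)
qed

lemma length_e1_total: "supported (\<lambda>v. length v = length w) (e1_total (word w))" if "w \<noteq> []"
  unfolding e1_total_def
  by (intro supported_add length_word_e1 that) (auto simp: degree_part_word intro: supported_word supported_zero)

lemma word_e1_chains: "p \<in> chains \<Longrightarrow> word_e1 p \<in> chains"
  unfolding chains_def mem_Collect_eq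
  by (rule supported_lin[OF lin_word_e1, of "\<lambda>w. w \<noteq> []"])
    (auto intro: supported_mono[OF length_word_e1])

lemma e1_total_chains: "p \<in> chains \<Longrightarrow> e1_total p \<in> chains"
  unfolding chains_def mem_Collect_eq
  by (rule supported_lin[OF lin_e1_total, of "\<lambda>w. w \<noteq> []"])
    (auto intro: supported_mono[OF length_e1_total])

lemma degree_part_supported:
  assumes "supported (\<lambda>w. length w = m) p"
  shows "degree_part n p = (if m = Suc n then p else 0)"
  by (rule lin_eq_on_supported[OF assms lin_degree_part, of "\<lambda>p. if m = Suc n then p else 0"])
    (auto simp: degree_part_word lin_def)

lemma e1_total_degree_part:
  fixes p :: "('k::field_char_0, 'a) words"
  assumes "p \<in> chains"
  shows "e1_total (degree_part n p) = degree_part n (e1_total p)"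
proof (rule lin_eq_on_supported[of "\<lambda>w. w \<noteq> []" p "\<lambda>p. e1_total (degree_part n p)"])
  fix w :: "'a list" assume "w \<noteq> []"
  then have "degree_part n (e1_total (word w :: ('k, 'a) words)) =
      (if length w = Suc n then e1_total (word w) else 0)"
    by (intro degree_part_supported length_e1_total)
  then show "e1_total (degree_part n (word w :: ('k, 'a) words)) = degree_part n (e1_total (word w))"
    by (simp add: degree_part_word lin_zero[OF lin_e1_total])
qed (use assms in \<open>simp_all add: chains_def lin_def lin_distribs[OF lin_e1_total] lin_distribs[OF lin_degree_part]\<close>)

lemma word_e1_degree_0: "p \<in> chains_of_degree 0 \<Longrightarrow> word_e1 p = 0"
proof (rule lin_eq_on_supported[OF _ lin_word_e1 lin_const_zero, of "\<lambda>w. length w = Suc 0"])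
  show "word_e1 (word w) = 0" if "length w = Suc 0" for w
    using that by (cases w) (auto simp: word_e1_word eulerian_Nil)
qed (simp add: chains_defs)

lemma e1_total_degree_0: "p \<in> chains_of_degree 0 \<Longrightarrow> e1_total p = p"
  by (simp add: e1_total_def word_e1_degree_0 degree_part_id)

lemma degree_part_positive: "p \<in> positive_chains \<Longrightarrow> degree_part 0 p = 0"
  by (rule lin_eq_on_supported[OF _ lin_degree_part lin_const_zero, of "\<lambda>w. 2 \<le> length w"])
    (auto simp: chains_defs degree_part_word)

lemma e1_total_positive: "p \<in> positive_chains \<Longrightarrow> e1_total p = word_e1 p"
  by (simp add: e1_total_def degree_part_positive)

lemma diff_degree_part_positive:
  fixes p :: "('k::comm_ring_1, 'b) words"
  assumes "p \<in> chains"
  shows "p - degree_part 0 p \<in> positive_chains"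
proof -
  have lin: "lin (\<lambda>p :: ('k, 'b) words. p - degree_part 0 p)"
    unfolding degree_part_def by (intro lin_intros)
  have "supported (\<lambda>v. 2 \<le> length v) (word w - degree_part 0 (word w) :: ('k, 'b) words)"
    if "w \<noteq> []" for w
    using that by (cases w; cases "tl w") (auto simp: degree_part_word supported_zero intro!: supported_word)
  then show ?thesis
    using assms supported_lin[OF lin, of "\<lambda>w. w \<noteq> []"] by (simp add: positive_chains_def chains_def)
qed

lemma word_e1_diff_degree_part: "word_e1 (p - degree_part 0 p) = word_e1 p"
  by (simp add: lin_diff[OF lin_word_e1] word_e1_degree_0[OF degree_part_in])

section \<open>The square of the augmentation ideal as the kernel of e1\<close>

context comm_unital_algebra
begin

lemma unit_mult_right: "x * unit = x"
  using unit_mult[of x] by (simp add: mult.commute)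

text \<open>The summand in degree 0 does no harm: it has zero boundary, and boundaries have no part
  in degree 0.\<close>

lemma e1_total_boundary:
  fixes p :: "('k, 'a) words"
  assumes "p \<in> chains"
  shows "e1_total (word_boundary p) = word_boundary (e1_total p)"
proof -
  have "word_boundary (word_e1 p) = word_e1 (word_boundary p)"
    by (rule word_boundary_e1[of unit]) (use assms unit_mult in \<open>simp_all add: chains_def\<close>)
  then show ?thesis
    unfolding e1_total_def
    by (simp add: word_boundary_distribs word_boundary_degree_0[OF degree_part_in]
        degree_part_positive[OF word_boundary_positive[OF assms]])
qed

lemma rel_chains: "R \<subseteq> chains"
proof
  fix p assume "p \<in> R"
  then show "p \<in> chains"
    unfolding tensor_relations_def
  proof induction
    case (base b)
    then show ?case
      by (auto simp: chains_def intro!: supported_diff supported_pscale supported_word)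
  qed (auto simp: word_space_def chains_zero chains_add chains_pscale)
qed

lemma rel_e1_total: "p \<in> R \<Longrightarrow> e1_total p \<in> R"
  unfolding e1_total_def
  by (intro rel_add descendsD[OF descends_word_e1] descendsD[OF descends_degree_part])

abbreviation hproj :: "('k, 'a) words \<Rightarrow> ('k, 'a) words set" where
  "hproj \<equiv> coset word_complex R"

lemma presents_hochschild: "presents (hochschild scale) hproj R"
  using presents_quotient[OF presents_word_complex, of R] rel_chains
  by (simp add: hochschild_def rel_zero rel_add rel_pscale descendsD[OF descends_word_boundary])

lemmas hproj_eq_iff = presents_eq_iff[OF presents_hochschild]

lemma mem_hproj: "p \<in> chains \<Longrightarrow> x \<in> hproj p \<longleftrightarrow> x - p \<in> R"
  unfolding coset_def word_complex_def by (force simp: algebra_simps intro: exI[of _ "x - p"])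

lemma e1_hproj:
  assumes "p \<in> chains"
  shows "e1 scale (hproj p) = hproj (word_e1 p)"
proof -
  have "hproj (word_e1 x) = hproj (word_e1 p)" if "x \<in> hproj p" for x
  proof -
    have "x - p \<in> R"
      using that assms by (simp add: mem_hproj)
    then have "word_e1 x - word_e1 p \<in> R" "x \<in> chains"
      using descendsD[OF descends_word_e1] chains_add[of "x - p" p] rel_chains assms
      by (auto simp: lin_diff[OF lin_word_e1, symmetric])
    then show ?thesis
      using assms hproj_eq_iff word_e1_chains by blast
  qed
  moreover have "p \<in> hproj p"
    using assms by (simp add: mem_hproj rel_zero)
  ultimately show ?thesis
    unfolding e1_def induced_def by blast
qed

text \<open>As e1 kills degree 0, its image is already attained on positive chains, where it agrees
  with \<open>e1_total\<close>.\<close>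

lemma e1_image_eq: "e1_image scale = hproj ` e1_total ` positive_chains"
proof -
  have "e1_image scale = hproj ` word_e1 ` chains"
    unfolding e1_image_def presents_carrier[OF presents_hochschild] image_image
    by (rule image_cong) (simp_all add: e1_hproj)
  also have "word_e1 ` chains = e1_total ` (positive_chains :: ('k, 'a) words set)"
  proof (intro equalityI subsetI; elim imageE)
    fix x p assume "p \<in> chains" "x = word_e1 (p :: ('k, 'a) words)"
    then show "x \<in> e1_total ` positive_chains"
      using diff_degree_part_positive e1_total_positive word_e1_diff_degree_part by (metis imageI)
  next
    fix x p assume "p \<in> positive_chains" "x = e1_total (p :: ('k, 'a) words)"
    then show "x \<in> word_e1 ` chains"
      using positive_chains_subset e1_total_positive by (metis imageI)
  qed
  finally show ?thesis .
qed

lemma e1_image_with_degree_0_eq: "e1_image_with_degree_0 scale = hproj ` e1_total ` chains"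
proof
  note component = presents_component[OF presents_hochschild]
  show "e1_image_with_degree_0 scale \<subseteq> hproj ` e1_total ` chains"
    unfolding e1_image_with_degree_0_def
  proof (rule lin_span_subset_image[OF presents_hochschild])
    show "component (hochschild scale) 0 \<union> e1_image scale \<subseteq> hproj ` e1_total ` chains"
      unfolding component e1_image_eq
      using positive_chains_subset chains_of_degree_subset e1_total_degree_0
      by (force simp: image_image)
    show "e1_total ` chains \<subseteq> (chains :: ('k, 'a) words set)"
      using e1_total_chains by blast
    show "0 \<in> e1_total ` (chains :: ('k, 'a) words set)"
      using chains_zero lin_zero[OF lin_e1_total] by (metis imageI)
    show "p + q \<in> e1_total ` chains" if "p \<in> e1_total ` chains" "q \<in> e1_total ` chains"
      for p q :: "('k, 'a) words"
      using that by (auto simp: lin_plus[OF lin_e1_total, symmetric] intro!: imageI chains_add)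
    show "pscale c p \<in> e1_total ` chains" if "p \<in> e1_total ` chains" for c and p :: "('k, 'a) words"
      using that by (auto simp: lin_scale[OF lin_e1_total, symmetric] intro!: imageI chains_pscale)
  qed
  show "hproj ` e1_total ` chains \<subseteq> e1_image_with_degree_0 scale"
  proof safe
    fix p :: "('k, 'a) words" assume p: "p \<in> chains"
    have e1: "hproj (word_e1 p) \<in> e1_image scale"
      unfolding e1_image_eq using diff_degree_part_positive[OF p] e1_total_positive word_e1_diff_degree_part
      by (metis imageI)
    have d: "hproj (degree_part 0 p) \<in> component (hochschild scale) 0"
      unfolding component using degree_part_in by blast
    have "word_e1 p \<in> chains" "degree_part 0 p \<in> chains"
      using e1_total_chains[of "p - degree_part 0 p"] diff_degree_part_positive[OF p]
        e1_total_positive[OF diff_degree_part_positive[OF p]] positive_chains_subset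
        chains_of_degree_subset[OF degree_part_in]
      by (auto simp: word_e1_diff_degree_part)
    then have "hproj (e1_total p) = vadd (hochschild scale) (hproj (word_e1 p)) (hproj (degree_part 0 p))"
      by (simp add: e1_total_def presents_add[OF presents_hochschild])
    also have "\<dots> \<in> e1_image_with_degree_0 scale"
      unfolding e1_image_with_degree_0_def using e1 d by (intro lin_span.add lin_span.base) auto
    finally show "hproj (e1_total p) \<in> e1_image_with_degree_0 scale" .
  qed
qed

lemma bullet_chains:
  assumes "p \<in> chains" "q \<in> chains"
  shows "word_bullet p q \<in> (chains :: ('k, 'a) words set)"
proof -
  have "supported (\<lambda>w. w \<noteq> []) (chain_shl v w :: ('k, 'a) words)" for v w
    unfolding chain_shl_def
    by (rule supported_lin_ext[of "\<lambda>_. True"]) (simp_all add: supported_def)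
  then show ?thesis
    using assms unfolding word_bullet_eq chains_def by (auto intro: supported_bilin_ext)
qed

lemma bullet_hproj:
  assumes "p \<in> chains" "q \<in> chains"
  shows "bullet scale (hproj p) (hproj q) = hproj (word_bullet p q)"
proof -
  have "hproj (word_bullet x y) = hproj (word_bullet p q)" if "x \<in> hproj p" "y \<in> hproj q" for x y
  proof -
    have d: "x - p \<in> R" "y - q \<in> R"
      using that assms by (simp_all add: mem_hproj)
    then have xy: "x \<in> chains" "y \<in> chains"
      using chains_add[of "x - p" p] chains_add[of "y - q" q] rel_chains assms by auto
    have "word_bullet x y - word_bullet p q = word_bullet (x - p) y + word_bullet p (y - q)"
      by (simp add: word_bullet_eq)
    also have "\<dots> \<in> R"
      by (intro rel_add descendsD[OF descends_word_bullet_left] descendsD[OF descends_word_bullet_right] d)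
    finally show ?thesis
      using hproj_eq_iff bullet_chains assms xy by blast
  qed
  moreover have "p \<in> hproj p" "q \<in> hproj q"
    using assms by (simp_all add: mem_hproj rel_zero)
  ultimately show ?thesis
    unfolding bullet_def induced2_def by blast
qed

lemma e1_total_bullet:
  assumes "p \<in> positive_chains" "q \<in> positive_chains"
  shows "e1_total (word_bullet p q) = (0 :: ('k, 'a) words)"
proof -
  have bil: "e1_total (word_bullet (word v) (word w)) = (0 :: ('k, 'a) words)"
    if vw: "2 \<le> length v" "2 \<le> length w" for v w
  proof -
    obtain a u b u' where v: "v = a # u" "w = b # u'" "u \<noteq> []" "u' \<noteq> []"
      using vw by (cases v; cases w) force+
    have "chain_shl v w \<in> (positive_chains :: ('k, 'a) words set)"
      unfolding chain_shl_def positive_chains_def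
      using v by (auto intro!: supported_lin_ext[OF length_shl] supported_word simp: neq_Nil_conv)
    then show ?thesis
      by (simp add: word_bullet_eq e1_total_positive)
        (simp add: chain_shl_def v word_e1_cons eulerian_shl)
  qed
  have "e1_total (word_bullet (word v) q) = 0" if "2 \<le> length v" for v
    by (rule lin_eq_on_supported[of "\<lambda>w. 2 \<le> length w" q "\<lambda>q. e1_total (word_bullet (word v) q)" "\<lambda>q. 0"])
      (use assms that bil in \<open>auto simp: positive_chains_def word_bullet_eq lin_def lin_distribs[OF lin_e1_total]\<close>)
  then show ?thesis
    by (intro lin_eq_on_supported[of "\<lambda>w. 2 \<le> length w" p "\<lambda>p. e1_total (word_bullet p q)" "\<lambda>p. 0"])
      (use assms in \<open>auto simp: positive_chains_def word_bullet_eq lin_def lin_distribs[OF lin_e1_total]\<close>)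
qed

abbreviation "I2 \<equiv> augmentation_ideal_squared scale"

text \<open>The representative is killed exactly, not just modulo relations, because
  \<open>eulerian_shl\<close> is an identity of words.\<close>

lemma I2_preimage: "X \<in> I2 \<Longrightarrow> \<exists>p\<in>chains. X = hproj p \<and> e1_total p = 0"
  unfolding augmentation_ideal_squared_def augmentation_ideal_def
    presents_positive_part[OF presents_hochschild]
proof (induction rule: lin_span.induct)
  case zero
  show ?case
    using presents_zero[OF presents_hochschild] chains_zero lin_zero[OF lin_e1_total] by blast
next
  case (base X)
  then obtain p q where "p \<in> positive_chains" "q \<in> positive_chains" "X = bullet scale (hproj p) (hproj q)"
    by blast
  then show ?case
    using bullet_hproj bullet_chains e1_total_bullet positive_chains_subset by metis
next
  case (add X Y)
  then obtain p q where "p \<in> chains" "q \<in> chains" "X = hproj p" "Y = hproj q"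
    "e1_total p = 0" "e1_total q = 0"
    by blast
  then show ?case
    by (intro bexI[of _ "p + q"])
      (simp_all add: presents_add[OF presents_hochschild] chains_add lin_plus[OF lin_e1_total])
next
  case (scale X c)
  then obtain p where "p \<in> chains" "X = hproj p" "e1_total p = 0"
    by blast
  then show ?case
    by (intro bexI[of _ "pscale c p"])
      (simp_all add: presents_scale[OF presents_hochschild] chains_pscale lin_scale[OF lin_e1_total])
qed

lemma bullet_in_I2: "p \<in> positive_chains \<Longrightarrow> q \<in> positive_chains \<Longrightarrow> hproj (word_bullet p q) \<in> I2"
  unfolding augmentation_ideal_squared_def augmentation_ideal_def
    presents_positive_part[OF presents_hochschild]
  by (rule lin_span.base) (use bullet_hproj positive_chains_subset in blast)

text \<open>The preimage of I . I among words, which is the subspace that presents the Harrison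
  complex.\<close>

definition I2_chains :: "('k, 'a) words set" where
  "I2_chains = {p \<in> chains. hproj p \<in> I2}"

lemma I2_chains_zero: "0 \<in> I2_chains"
  using lin_span.zero[of "hochschild scale"] presents_zero[OF presents_hochschild]
  by (simp add: I2_chains_def chains_zero augmentation_ideal_squared_def)

lemma I2_chains_add: "p \<in> I2_chains \<Longrightarrow> q \<in> I2_chains \<Longrightarrow> p + q \<in> I2_chains"
  unfolding I2_chains_def augmentation_ideal_squared_def
  by (auto simp: chains_add presents_add[OF presents_hochschild, symmetric] intro: lin_span.add)

lemma I2_chains_pscale: "p \<in> I2_chains \<Longrightarrow> pscale c p \<in> I2_chains"
  unfolding I2_chains_def augmentation_ideal_squared_def
  by (auto simp: chains_pscale presents_scale[OF presents_hochschild, symmetric] intro: lin_span.scale)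

lemma I2_chains_sum: "(\<And>i. i \<in> I \<Longrightarrow> p i \<in> I2_chains) \<Longrightarrow> (\<Sum>i\<in>I. p i) \<in> I2_chains"
  by (induction I rule: infinite_finite_induct) (auto intro: I2_chains_zero I2_chains_add)

lemma rel_in_I2_chains: "p \<in> R \<Longrightarrow> p \<in> I2_chains"
proof -
  assume "p \<in> R"
  then have "p \<in> chains" "hproj p = hproj 0"
    using rel_chains hproj_eq_iff[of p 0] chains_zero by auto
  with I2_chains_zero show "p \<in> I2_chains"
    by (simp add: I2_chains_def)
qed

text \<open>The unit of the algebra factors the chain as (a, u) . (1, v).\<close>

lemma cons_shl_in_I2_chains:
  assumes "u \<noteq> []" "v \<noteq> []"
  shows "cons a (shl u v) \<in> I2_chains"
proof -
  have pos: "word (a # u) \<in> (positive_chains :: ('k, 'a) words set)"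
    "word (unit # v) \<in> (positive_chains :: ('k, 'a) words set)"
    using assms by (auto simp: positive_chains_def neq_Nil_conv intro!: supported_word)
  have "cons a (shl u v) = word_bullet (word (a # u)) (word (unit # v) :: ('k, 'a) words)"
    by (simp add: word_bullet_eq chain_shl_def unit_mult_right)
  then show ?thesis
    using bullet_in_I2[OF pos] bullet_chains[OF pos[THEN positive_chains_subset]]
    by (simp add: I2_chains_def)
qed

lemma decomposable_in_I2_chains:
  assumes "p \<in> positive_chains"
  shows "p - word_e1 p \<in> I2_chains"
proof -
  have span: "cons a d \<in> I2_chains"
    if "d \<in> lin_span word_space {shl u v | u v. u \<noteq> [] \<and> v \<noteq> []}" for a d
    using that
    by induction (auto simp: word_space_def I2_chains_zero I2_chains_add I2_chains_pscale cons_shl_in_I2_chains)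
  have word: "word w - word_e1 (word w) \<in> I2_chains" if w: "2 \<le> length w" for w
  proof -
    obtain a u where "w = a # u" "u \<noteq> []"
      using w by (cases w) force+
    then show ?thesis
      using span[OF eulerian_decomposable[of u], of a] by (simp add: word_e1_word)
  qed
  have "p - word_e1 p = (\<Sum>w\<in>Poly_Mapping.keys p. pscale (Poly_Mapping.lookup p w) (word w - word_e1 (word w)))"
    by (subst (1 2) sum_keys_word)
      (simp add: lin_sum[OF lin_word_e1] lin_scale[OF lin_word_e1] sum_subtractf pscale_diff_right)
  also have "\<dots> \<in> I2_chains"
    using assms by (intro I2_chains_sum I2_chains_pscale word) (auto simp: positive_chains_def supported_def)
  finally show ?thesis .
qed

text \<open>Products are killed by \<open>e1_total\<close>. Conversely, if \<open>e1_total p\<close>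
  is a relation, so are its degree 0 part, which is that of \<open>p\<close>, and then
  \<open>word_e1 p\<close>. What is left of \<open>p\<close> after subtracting both is
  decomposable.\<close>

lemma I2_chains_eq_kernel: "I2_chains = {p \<in> chains. e1_total p \<in> R}"
proof (intro equalityI subsetI)
  fix p assume "p \<in> I2_chains"
  then obtain q where q: "p \<in> chains" "q \<in> chains" "hproj p = hproj q" "e1_total q = 0"
    using I2_preimage by (auto simp: I2_chains_def)
  then have "e1_total (p - q) \<in> R"
    using hproj_eq_iff rel_e1_total by blast
  with q show "p \<in> {p \<in> chains. e1_total p \<in> R}"
    by (simp add: lin_diff[OF lin_e1_total])
next
  fix p assume "p \<in> {p \<in> chains. e1_total p \<in> R}"
  then have p: "p \<in> chains" and e: "e1_total p \<in> R"
    by auto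
  have "degree_part 0 p = degree_part 0 (e1_total p)"
    using e1_total_degree_part[OF p, of 0] e1_total_degree_0[OF degree_part_in[of 0 p]] by simp
  then have d: "degree_part 0 p \<in> R"
    using descendsD[OF descends_degree_part e, of 0] by simp
  then have w: "word_e1 p \<in> R"
    using rel_diff[OF e d] by (simp add: e1_total_def)
  have "p - degree_part 0 p - word_e1 p \<in> I2_chains"
    using decomposable_in_I2_chains[OF diff_degree_part_positive[OF p]] word_e1_diff_degree_part[of p] by simp
  from I2_chains_add[OF I2_chains_add[OF this rel_in_I2_chains[OF w]] rel_in_I2_chains[OF d]]
  show "p \<in> I2_chains"
    by simp
qed

lemma presents_harrison:
  "presents (harrison scale) (\<lambda>p. coset (hochschild scale) I2 (hproj p)) I2_chains"
proof -
  have "I2 = hproj ` I2_chains"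
    using I2_preimage by (auto simp: I2_chains_def)
  \<comment> \<open>Stability under the boundary comes from the kernel description, since
    \<open>e1_total\<close> commutes with the boundary and the boundary preserves the
    relations.\<close>
  moreover have "word_boundary p \<in> I2_chains" if "p \<in> I2_chains" for p
    using that word_boundary_chains descendsD[OF descends_word_boundary]
    by (auto simp: I2_chains_eq_kernel e1_total_boundary)
  ultimately show ?thesis
    unfolding harrison_def
    using presents_quotient[OF presents_hochschild, of I2_chains] rel_in_I2_chains I2_chains_add I2_chains_pscale
    by (auto simp: I2_chains_def)
qed

lemma subcomplexes_isomorphic:
  assumes "V \<subseteq> chains" "\<And>p q. p \<in> V \<Longrightarrow> q \<in> V \<Longrightarrow> p + q \<in> V" "\<And>c p. p \<in> V \<Longrightarrow> pscale c p \<in> V"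
    "word_boundary ` V \<subseteq> V" "\<And>n. degree_part n ` V \<subseteq> V"
  shows "complexes_isomorphic
    (subcomplex (harrison scale) ((\<lambda>p. coset (hochschild scale) I2 (hproj p)) ` V))
    (subcomplex (hochschild scale) (hproj ` e1_total ` V))"
proof (rule presents_isomorphic[OF presents_harrison presents_hochschild lin_e1_total])
  show "degree_part n ` R \<subseteq> R" for n
    using descendsD[OF descends_degree_part] by blast
  show "e1_total ` chains \<subseteq> (chains :: ('k, 'a) words set)"
    using e1_total_chains by blast
  show "e1_total p \<in> R \<longleftrightarrow> p \<in> I2_chains" if "p \<in> chains" for p
    using that by (simp add: I2_chains_eq_kernel)
qed (simp_all add: assms e1_total_boundary e1_total_degree_part)

lemma harrison_isomorphic:
  "complexes_isomorphic
     (subcomplex (harrison scale) (positive_part (harrison scale)))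
     (subcomplex (hochschild scale) (e1_image scale)) \<and>
   complexes_isomorphic
     (harrison scale)
     (subcomplex (hochschild scale) (e1_image_with_degree_0 scale))"
proof
  show "complexes_isomorphic
     (subcomplex (harrison scale) (positive_part (harrison scale)))
     (subcomplex (hochschild scale) (e1_image scale))"
    unfolding presents_positive_part[OF presents_harrison] e1_image_eq
  proof (rule subcomplexes_isomorphic)
    show "positive_chains \<subseteq> (chains :: ('k, 'a) words set)"
      using positive_chains_subset by blast
    show "word_boundary ` positive_chains \<subseteq> (positive_chains :: ('k, 'a) words set)"
      using word_boundary_positive positive_chains_subset by blast
    show "degree_part n ` positive_chains \<subseteq> (positive_chains :: ('k, 'a) words set)" for n
      unfolding positive_chains_def
      by (clarsimp, rule supported_lin[OF lin_degree_part, of "\<lambda>w. 2 \<le> length w"])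
        (auto simp: degree_part_word intro: supported_word supported_zero)
  qed (auto simp: positive_chains_def intro: supported_intros)
  show "complexes_isomorphic (harrison scale)
     (subcomplex (hochschild scale) (e1_image_with_degree_0 scale))"
    unfolding e1_image_with_degree_0_eq
  \<comment> \<open>The whole Harrison complex is written as the subcomplex of all chains, which is
    the case \<open>V = chains\<close>.\<close>
  proof (subst (1) subcomplex_carrier[OF presents_harrison, symmetric], rule subcomplexes_isomorphic)
    show "degree_part n ` chains \<subseteq> (chains :: ('k, 'a) words set)" for n
      using chains_of_degree_subset[OF degree_part_in] by blast
    show "word_boundary ` chains \<subseteq> (chains :: ('k, 'a) words set)"
      using word_boundary_chains by blast
  qed (simp_all add: chains_add chains_pscale)
qed

end

theorem theorem4p2:
  fixes scale :: "'k::field_char_0 \<Rightarrow> 'a::comm_ring \<Rightarrow> 'a" and unit :: 'a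
  assumes "comm_unital_algebra scale unit"
  shows "complexes_isomorphic
           (subcomplex (harrison scale) (positive_part (harrison scale)))
           (subcomplex (hochschild scale) (e1_image scale)) \<and>
         complexes_isomorphic
           (harrison scale)
           (subcomplex (hochschild scale) (e1_image_with_degree_0 scale))"
  using assms by (rule comm_unital_algebra.harrison_isomorphic)

end
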